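(* Let $(W_t)_{t\ge 0}$ be a standard Brownian motion with $W_0=0$. Let $b:(0,\infty)\to\mathbb{R}$ be a continuous function with $b(0)\le 0$ (where $b(0):=\lim_{t\downarrow 0}b(t)$, the value $-\infty$ being allowed), let $\tau=\inf\{t>0:\ W_t\le b(t)\}$, and assume $b$ is regular, i.e. $P(\tau=0)=0$; if $b(0)=-\infty$, assume also that $b$ is monotone increasing on $(0,\epsilon]$ for some $\epsilon>0$. Let $F(t)=P(\tau\le t)$. Consider, for $p\in\mathbb{R}$, the equation $$\frac{e^{-\frac{b(t)^2}{4t}}D_{p}(-b(t)/\sqrt{t})}{t^{(p+1)/2}}=\int_{0}^t e^{-\frac{(b(s)-b(t))^2}{4(t-s)}}\,\frac{D_{p}\big((b(s)-b(t))/\sqrt{t-s}\big)}{(t-s)^{(p+1)/2}}\,F(ds).\qquad (B_p)$$ Then $(B_p)$ holds for all $t>0$ in each of the following cases: (i) for all $p\le -1$, when $b$ is continuous on $(0,\infty)$; (ii) for all $-1<p\le 0$, when $b$ is differentiable on $(0,\infty)$; (iii) for all $0<p<1$, when $b$ is continuously differentiable on $(0,\infty)$.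
   Context: $D_p$ ($p\in\mathbb{R}$) is the parabolic cylinder function: the entire solution of $u''(z)+\left(p+\tfrac12-\tfrac{z^2}{4}\right)u(z)=0$ normalized by $D_p(z)\sim z^p e^{-z^2/4}$ as $z\to+\infty$. For $p<0$, $D_p(z)=\frac{e^{-z^2/4}}{\Gamma(-p)}\int_0^\infty e^{-xz-x^2/2}x^{-p-1}\,dx$. The integral is a Lebesgue–Stieltjes integral with respect to $F$ over $0<s<t$ ($F$ has no atom at $t$). *)

theory Defs
  imports "HOL-Probability.Probability" "HOL-Complex_Analysis.Complex_Analysis"
    "HOL-Library.Landau_Symbols"
begin

text \<open>
  \<open>parabolic_cylinder p\<close> is \<open>D\<^sub>p\<close> as an entire function. The normalisation singles out exactly one
  solution: every solution that is not a multiple of \<open>D\<^sub>p\<close> grows like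
  \<open>x\<close> powr \<open>(- p - 1)\<close> times \<open>exp (x\<^sup>2 / 4)\<close> at \<open>+\<infinity>\<close>.
\<close>

definition parabolic_cylinder :: "real \<Rightarrow> complex \<Rightarrow> complex" where
  "parabolic_cylinder p = (THE u.
      u holomorphic_on UNIV \<and>
      (\<forall>z. deriv (deriv u) z + (of_real p + 1 / 2 - z\<^sup>2 / 4) * u z = 0) \<and>
      (\<lambda>x::real. u (of_real x)) \<sim>[at_top] (\<lambda>x. of_real (x powr p * exp (- x\<^sup>2 / 4))))"

text \<open>The order \<open>p\<close> is real, so \<open>D\<^sub>p\<close> is real-valued on the real line and \<open>Re\<close> loses nothing.\<close>

definition parabolic_cylinder_real :: "real \<Rightarrow> real \<Rightarrow> real" where
  "parabolic_cylinder_real p x = Re (parabolic_cylinder p (of_real x))"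

text \<open>Only the values \<open>W t\<close> with \<open>t \<ge> 0\<close> are constrained.\<close>

locale standard_brownian_motion = prob_space M
  for M :: "'a measure" and W :: "real \<Rightarrow> 'a \<Rightarrow> real" +
  assumes random_variable_W: "\<And>t. t \<ge> 0 \<Longrightarrow> random_variable borel (W t)"
    and start_at_zero: "AE \<omega> in M. W 0 \<omega> = 0"
    and continuous_paths: "\<And>\<omega>. \<omega> \<in> space M \<Longrightarrow> continuous_on {0..} (\<lambda>t. W t \<omega>)"
    and normal_increments: "\<And>s t. 0 \<le> s \<Longrightarrow> s < t \<Longrightarrow>
      distributed M lborel (\<lambda>\<omega>. W t \<omega> - W s \<omega>) (normal_density 0 (sqrt (t - s)))"
    and independent_increments: "\<And>(r :: nat \<Rightarrow> real) n. 0 \<le> r 0 \<Longrightarrow> (\<And>i. i < n \<Longrightarrow> r i < r (Suc i)) \<Longrightarrow>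
      indep_vars (\<lambda>_. borel) (\<lambda>i \<omega>. W (r (Suc i)) \<omega> - W (r i) \<omega>) {..<n}"

text \<open>Extended-real valued: the infimum of the empty set is \<open>\<infinity>\<close>.\<close>

definition first_passage_time ::
    "(real \<Rightarrow> 'a \<Rightarrow> real) \<Rightarrow> (real \<Rightarrow> real) \<Rightarrow> 'a \<Rightarrow> ereal" where
  "first_passage_time W b \<omega> = Inf (ereal ` {t. t > 0 \<and> W t \<omega> \<le> b t})"

definition first_passage_cdf ::
    "'a measure \<Rightarrow> (real \<Rightarrow> 'a \<Rightarrow> real) \<Rightarrow> (real \<Rightarrow> real) \<Rightarrow> real \<Rightarrow> real" where
  "first_passage_cdf M W b t = measure M {\<omega> \<in> space M. first_passage_time W b \<omega> \<le> ereal t}"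

definition passage_kernel :: "(real \<Rightarrow> real) \<Rightarrow> real \<Rightarrow> real \<Rightarrow> real \<Rightarrow> real" where
  "passage_kernel b p t s =
     exp (- (b s - b t)\<^sup>2 / (4 * (t - s))) *
     (parabolic_cylinder_real p ((b s - b t) / sqrt (t - s)) / (t - s) powr ((p + 1) / 2))"

text \<open>
  The Bochner integral of a non-integrable function is 0, so the existence of the
  Lebesgue--Stieltjes integral is stated explicitly as part of the equation.
\<close>

definition passage_equation :: "(real \<Rightarrow> real) \<Rightarrow> (real \<Rightarrow> real) \<Rightarrow> real \<Rightarrow> real \<Rightarrow> bool" where
  "passage_equation b F p t \<longleftrightarrow>
     set_integrable (interval_measure F) {0<..<t} (passage_kernel b p t) \<and>
     exp (- (b t)\<^sup>2 / (4 * t)) * parabolic_cylinder_real p (- b t / sqrt t) / t powr ((p + 1) / 2)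
       = set_lebesgue_integral (interval_measure F) {0<..<t} (passage_kernel b p t)"

end

theory Submission
  imports Defs "HOL-Real_Asymp.Real_Asymp"
begin

text \<open>
  For \<open>p < 0\<close> the integral representation of \<open>D\<^sub>p\<close> shows that, up to one and the same constant, the
  left-hand side of the equation is \<open>E (b t - W t)\<^sub>+\<close> to the power \<open>-p - 1\<close> and the kernel is the same
  expectation for a Brownian motion started at time \<open>s\<close> in \<open>b s\<close>. On \<open>W t < x\<close> with \<open>x \<le> b t\<close> the
  boundary has been crossed before \<open>t\<close>, so the strong Markov property at \<open>\<tau>\<close>, where \<open>W \<tau> = b \<tau>\<close>, gives
  the equation, even with the level \<open>b t\<close> replaced by any \<open>x \<le> b t\<close>.

  For \<open>0 \<le> p < 1\<close> the equation of order \<open>p - 1\<close> is differentiated from the left in the level \<open>x\<close> at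
  \<open>b t\<close>. Because \<open>b s - b t = O(t - s)\<close> and \<open>D\<^sub>p\<close> is positive near and to the right of 0, the
  difference quotients are nonnegative for \<open>s\<close> close to \<open>t\<close>. Fatou's lemma then shows that
  \<open>(t - s)\<close> powr \<open>(-(p + 1)/2)\<close> is integrable with respect to \<open>F\<close>, and a multiple of this function
  dominates the difference quotients.
\<close>

section \<open>Parabolic cylinder functions of order less than one\<close>

text \<open>Since D_p is given by a definite description, an explicit entire solution is needed for
  every p < 1, although x powr (-p - 1) is integrable at 0 only for p < 0. Raising the exponents
  helps: \<open>gauss_moment (1 - p) z + z * gauss_moment (- p) z\<close> equals -p times
  \<open>gauss_moment (- p - 1) z\<close> as long as the latter integral converges, and it keeps
  converging up to p < 1.

  Two obstacles shape the rest. The event W t < x forces an earlier crossing only for x \<le> b t,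
  so the level can be moved downwards only and just a one-sided derivative is at hand. And nothing
  is known beforehand about the mass that F puts just before t, so the integrability of the singular
  kernel has to be extracted from the equation of order p - 1 itself.

  The strong Markov property takes the form of an identity of laws: \<tau> is rounded up to a grid,
  independence of increments is applied at each grid time, and the characteristic functions pass to
  the limit by continuity of the paths.\<close>

lemma set_integrable_Gamma_real:
  fixes a :: real
  assumes "a > -1"
  shows "set_integrable lborel {0<..} (\<lambda>x. x powr a * exp (- x))"
proof -
  let ?f = "\<lambda>x::real. indicator {0..} x * x powr a / exp x"
  have "integrable lborel ?f"
  proof (rule integrableI_nonneg)
    have "(\<integral>\<^sup>+ x. ennreal (?f x) \<partial>lborel) = ennreal (Gamma (a + 1))"
      using Gamma_conv_nn_integral_real[of "a + 1"] assms by simp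
    then show "(\<integral>\<^sup>+ x. ennreal (?f x) \<partial>lborel) < \<infinity>" by simp
  qed auto
  then have "set_integrable lborel {0..} (\<lambda>x. x powr a * exp (- x))"
    unfolding set_integrable_def by (simp add: exp_minus field_simps)
  then show ?thesis
    by (rule set_integrable_subset) auto
qed

lemma set_integral_Gamma_real:
  fixes a :: real
  assumes "a > -1"
  shows "(LINT x:{0<..}|lborel. x powr a * exp (- x)) = Gamma (a + 1)"
proof -
  have A: "((\<lambda>x. indicator {0<..} x *\<^sub>R (x powr a * exp (- x))) has_integral
      (LINT x:{0<..}|lborel. x powr a * exp (- x))) UNIV"
    using has_integral_integral_lborel[OF set_integrable_Gamma_real[OF assms, unfolded set_integrable_def]]
    unfolding set_lebesgue_integral_def .
  have B: "(\<lambda>x::real. indicator {0<..} x *\<^sub>R (x powr a * exp (- x))) =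
      (\<lambda>x. if x \<in> {0..} then x powr (a + 1 - 1) / exp x else 0)"
    by (auto simp: fun_eq_iff indicator_def exp_minus field_simps)
  have C: "((\<lambda>x. if x \<in> {0..} then x powr (a + 1 - 1) / exp x else 0) has_integral Gamma (a + 1)) UNIV"
    using Gamma_integral_real[of "a + 1"] assms has_integral_restrict_UNIV[of "{0..}" "\<lambda>x. x powr (a + 1 - 1) / exp x" "Gamma (a + 1)"]
    by simp
  show ?thesis
    by (rule has_integral_unique[OF A[unfolded B] C])
qed

text \<open>Completing the square gives c x - x^2/2 \<le> (c + 1)^2/2 - x, so a constant multiple of
  the Gamma integrand is a majorant. The linear term is there to absorb the factor exp (- x z) of
  the cylinder integrals.\<close>

lemma set_integrable_powr_gauss:
  fixes a c :: real
  assumes "a > -1"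
  shows "set_integrable lborel {0<..} (\<lambda>x. x powr a * exp (c * x - x\<^sup>2 / 2))"
proof -
  have "set_integrable lborel {0<..} (\<lambda>x. exp ((c + 1)\<^sup>2 / 2) * (x powr a * exp (- x)))"
    by (rule set_integrable_mult_right) (rule set_integrable_Gamma_real[OF assms])
  then show ?thesis
  proof (rule set_integrable_bound)
    show "set_borel_measurable lborel {0<..} (\<lambda>x. x powr a * exp (c * x - x\<^sup>2 / 2))"
      unfolding set_borel_measurable_def by measurable
    have "c * x - x\<^sup>2 / 2 \<le> (c + 1)\<^sup>2 / 2 - x" for x
    proof -
      have "0 \<le> (x - (c + 1))\<^sup>2 / 2" by simp
      then show ?thesis by (simp add: power2_eq_square field_simps)
    qed
    then have "exp (c * x - x\<^sup>2 / 2) \<le> exp ((c + 1)\<^sup>2 / 2) * exp (- x)" for x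
      by (simp flip: exp_add)
    then show "AE x in lborel. x \<in> {0<..} \<longrightarrow> norm (x powr a * exp (c * x - x\<^sup>2 / 2))
        \<le> norm (exp ((c + 1)\<^sup>2 / 2) * (x powr a * exp (- x)))"
      by (auto simp: abs_mult mult.left_commute mult_left_mono)
  qed
qed

section \<open>Gaussian moment integrals in the complex plane\<close>

text \<open>For \<open>a = - p - 1\<close> this is the classical integral for D_p without its
  prefactor. The argument is complex because D_p is characterised among entire functions.\<close>

definition gauss_moment :: "real \<Rightarrow> complex \<Rightarrow> complex" where
  "gauss_moment a z =
    (LINT x:{0<..}|lborel. of_real (x powr a * exp (- x\<^sup>2 / 2)) * exp (- of_real x * z))"

lemma set_integrable_gauss_moment:
  assumes "a > -1"
  shows "set_integrable lborel {0<..}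
    (\<lambda>x. complex_of_real (x powr a * exp (- x\<^sup>2 / 2)) * exp (- of_real x * z))"
  using set_integrable_powr_gauss[OF assms, of "- Re z"]
proof (rule set_integrable_bound)
  show "set_borel_measurable lborel {0<..}
      (\<lambda>x. complex_of_real (x powr a * exp (- x\<^sup>2 / 2)) * exp (- of_real x * z))"
    unfolding set_borel_measurable_def by measurable
  show "AE x in lborel. x \<in> {0<..} \<longrightarrow>
      norm (complex_of_real (x powr a * exp (- x\<^sup>2 / 2)) * exp (- of_real x * z))
        \<le> norm (x powr a * exp (- Re z * x - x\<^sup>2 / 2))"
    by (intro AE_I2) (simp add: norm_mult abs_mult flip: exp_add)
qed

text \<open>Differentiation under the integral sign, done by hand: the first-order Taylor remainder
  of exp is quadratic in h, with an integrable coefficient that is uniform for |h| \<le> 1.\<close>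

lemma gauss_moment_has_field_derivative:
  assumes "a > -1"
  shows "(gauss_moment a has_field_derivative - gauss_moment (a + 1) z) (at z)"
proof -
  \<comment> \<open>The majorant collects x^2 from the quadratic remainder, exp (x |z|) from exp (-
    x z), and a further exp x from the exponential in the remainder, because |h| \<le> 1.\<close>
  define K where "K = (LINT x:{0<..}|lborel. x powr (a + 2) * exp ((cmod z + 1) * x - x\<^sup>2 / 2))"
  have int2: "set_integrable lborel {0<..} (\<lambda>x. x powr (a + 2) * exp ((cmod z + 1) * x - x\<^sup>2 / 2))"
    using assms by (intro set_integrable_powr_gauss) auto
  have bound: "norm (gauss_moment a (z + h) - gauss_moment a z + h * gauss_moment (a + 1) z) \<le> (cmod h)\<^sup>2 * K"
    if h: "cmod h \<le> 1" for h
  proof -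
    let ?f = "\<lambda>x. complex_of_real (x powr a * exp (- x\<^sup>2 / 2)) * exp (- of_real x * (z + h))
      - of_real (x powr a * exp (- x\<^sup>2 / 2)) * exp (- of_real x * z)
      + h * (of_real (x powr (a + 1) * exp (- x\<^sup>2 / 2)) * exp (- of_real x * z))"
    have I: "set_integrable lborel {0<..} ?f"
      using assms by (intro set_integral_add set_integral_diff set_integrable_mult_right
          set_integrable_gauss_moment) auto
    have eqn: "gauss_moment a (z + h) - gauss_moment a z + h * gauss_moment (a + 1) z
        = (LINT x:{0<..}|lborel. ?f x)"
    proof -
      note I = set_integrable_gauss_moment[OF assms]
      have I1: "set_integrable lborel {0<..} (\<lambda>x. h * (complex_of_real (x powr (a + 1) * exp (- x\<^sup>2 / 2)) * exp (- of_real x * z)))"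
        using assms by (intro set_integrable_mult_right set_integrable_gauss_moment) simp
      show ?thesis
        unfolding gauss_moment_def
        by (subst set_integral_add(2)[OF set_integral_diff(1)[OF I I] I1], subst set_integral_diff(2)[OF I I])
          (simp only: set_integral_mult_right)
    qed
    have le1: "norm (gauss_moment a (z + h) - gauss_moment a z + h * gauss_moment (a + 1) z)
        \<le> (LINT x:{0<..}|lborel. norm (?f x))"
      unfolding eqn by (rule set_integral_norm_bound[OF I])
    have le2: "(LINT x:{0<..}|lborel. norm (?f x)) \<le> (LINT x:{0<..}|lborel. (cmod h)\<^sup>2 * (x powr (a + 2) * exp ((cmod z + 1) * x - x\<^sup>2 / 2)))"
    proof (rule set_integral_mono)
      show "set_integrable lborel {0<..} (\<lambda>x. norm (?f x))"
        by (rule set_integrable_norm[OF I])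
      show "set_integrable lborel {0<..} (\<lambda>x. (cmod h)\<^sup>2 * (x powr (a + 2) * exp ((cmod z + 1) * x - x\<^sup>2 / 2)))"
        by (intro set_integrable_mult_right int2)
      fix x :: real assume "x \<in> {0<..}"
      then have x: "x > 0" by simp
      have eq: "?f x = of_real (x powr a * exp (- x\<^sup>2 / 2)) * exp (- of_real x * z)
          * (exp (- of_real x * h) - (1 + (- of_real x * h)))"
      proof -
        have "exp (- complex_of_real x * (z + h)) = exp (- of_real x * z) * exp (- of_real x * h)"
          by (simp add: exp_add[symmetric] ring_distribs)
        moreover have "x powr (a + 1) = x powr a * x" using x by (simp add: powr_add)
        ultimately show ?thesis by (simp add: algebra_simps)
      qed
      have "norm (exp (- of_real x * h) - (1 + (- of_real x * h))) \<le>
          exp \<bar>Re (- of_real x * h)\<bar> * (norm (- of_real x * h)) ^ 2"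
        using Taylor_exp[of "- of_real x * h" 1] by (simp add: numeral_2_eq_2)
      also have "\<dots> \<le> exp x * (x * norm h) ^ 2"
      proof -
        have "\<bar>Re (- of_real x * h)\<bar> \<le> x * 1"
          using x h abs_Re_le_cmod[of h] by (simp add: abs_mult)
        then show ?thesis using x by (auto simp: norm_mult intro!: mult_right_mono)
      qed
      finally have 1: "norm (exp (- of_real x * h) - (1 + (- of_real x * h))) \<le> exp x * (x * norm h) ^ 2" .
      have "- x * Re z \<le> x * cmod z"
      proof -
        have "x * (- Re z) \<le> x * cmod z"
          using x abs_Re_le_cmod[of z] by (intro mult_left_mono) auto
        then show ?thesis by simp
      qed
      then have 2: "norm (exp (- of_real x * z)) \<le> exp (x * cmod z)" by simp
      have "norm (?f x) \<le> x powr a * exp (- x\<^sup>2 / 2) * exp (x * cmod z) * (exp x * (x * norm h) ^ 2)"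
        unfolding eq norm_mult
        using 1 2 by (intro mult_mono) (auto simp: norm_mult)
      also have "\<dots> = (cmod h)\<^sup>2 * (x powr (a + 2) * exp ((cmod z + 1) * x - x\<^sup>2 / 2))"
      proof -
        have "x powr (a + 2) = x powr a * x\<^sup>2" using x by (simp add: powr_add)
        moreover have "exp ((cmod z + 1) * x - x\<^sup>2 / 2) = exp (- x\<^sup>2 / 2) * exp (x * cmod z) * exp x"
          by (simp add: exp_add[symmetric] algebra_simps)
        ultimately show ?thesis by (simp add: power_mult_distrib)
      qed
      finally show "norm (?f x) \<le> (cmod h)\<^sup>2 * (x powr (a + 2) * exp ((cmod z + 1) * x - x\<^sup>2 / 2))" .
    qed
    have eq2: "(LINT x:{0<..}|lborel. (cmod h)\<^sup>2 * (x powr (a + 2) * exp ((cmod z + 1) * x - x\<^sup>2 / 2))) = (cmod h)\<^sup>2 * K"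
      unfolding K_def by (rule set_integral_mult_right)
    show ?thesis
      using le1 le2 unfolding eq2 by (rule order_trans)
  qed
  have "((\<lambda>h. (gauss_moment a (z + h) - gauss_moment a z) / h - (- gauss_moment (a + 1) z)) \<longlongrightarrow> 0) (at 0)"
  proof (rule Lim_null_comparison)
    have "\<forall>\<^sub>F h in at 0. h \<noteq> 0 \<and> cmod h \<le> 1"
      unfolding eventually_at by (intro exI[of _ 1]) auto
    then show "\<forall>\<^sub>F h in at 0. norm ((gauss_moment a (z + h) - gauss_moment a z) / h - (- gauss_moment (a + 1) z))
        \<le> cmod h * K"
    proof eventually_elim
      case (elim h)
      have "(gauss_moment a (z + h) - gauss_moment a z) / h - (- gauss_moment (a + 1) z)
         = (gauss_moment a (z + h) - gauss_moment a z + h * gauss_moment (a + 1) z) / h"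
        using elim by (simp add: field_simps)
      also have "norm \<dots> \<le> (cmod h)\<^sup>2 * K / cmod h"
        using bound[of h] elim unfolding norm_divide by (intro divide_right_mono) auto
      finally show ?case using elim by (simp add: power2_eq_square)
    qed
    show "((\<lambda>h. cmod h * K) \<longlongrightarrow> 0) (at 0)"
      by (auto intro!: tendsto_eq_intros)
  qed
  then show ?thesis
    unfolding DERIV_def by (rule LIM_zero_cancel)
qed

text \<open>Integration by parts: the derivative of x powr (a + 1) times exp (- x^2/2 - x z)
  integrates to 0 over the half-line. The boundary term at 0 vanishes because a + 1 > 0.\<close>

lemma gauss_moment_recurrence:
  assumes "a > -1"
  shows "gauss_moment (a + 2) z + z * gauss_moment (a + 1) z = (a + 1) * gauss_moment a z"
proof -
  define g where "g = (\<lambda>a x. complex_of_real (x powr a * exp (- x\<^sup>2 / 2)) * exp (- of_real x * z))"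
  have gi: "set_integrable lborel {0<..} (g c)" if "c > -1" for c
    unfolding g_def using that by (rule set_integrable_gauss_moment)
  have gm: "gauss_moment c z = (LINT x:{0<..}|lborel. g c x)" for c
    unfolding g_def gauss_moment_def ..
  define f where "f = (\<lambda>x. of_real (a + 1) * g a x - z * g (a + 1) x - g (a + 2) x)"
  have ein: "einterval 0 \<infinity> = {0<..}" by (auto simp: einterval_def)
  have fi: "set_integrable lborel {0<..} f"
    unfolding f_def using assms by (intro set_integral_diff set_integrable_mult_right gi) auto
  have der: "(g (a + 1) has_vector_derivative f x) (at x)" if "x > 0" for x
  proof -
    have 1: "((\<lambda>x. x powr (a + 1) * exp (- x\<^sup>2 / 2)) has_real_derivative
       (a + 1) * x powr a * exp (- x\<^sup>2 / 2) - x powr (a + 1) * x * exp (- x\<^sup>2 / 2)) (at x)"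
      using that by (auto intro!: derivative_eq_intros simp: powr_diff field_simps)
    have 2: "((\<lambda>x. exp (- complex_of_real x * z)) has_vector_derivative (- z * exp (- of_real x * z))) (at x)"
    proof -
      have "((\<lambda>w. exp (- w * z)) has_field_derivative - z * exp (- of_real x * z)) (at (of_real x))"
        by (auto intro!: derivative_eq_intros)
      from has_vector_derivative_real_field[OF this] show ?thesis by simp
    qed
    have 3: "((\<lambda>x. complex_of_real (x powr (a + 1) * exp (- x\<^sup>2 / 2))) has_vector_derivative
       of_real ((a + 1) * x powr a * exp (- x\<^sup>2 / 2) - x powr (a + 1) * x * exp (- x\<^sup>2 / 2))) (at x)"
      by (rule has_vector_derivative_of_real) (use 1 in \<open>simp add: has_real_derivative_iff_has_vector_derivative\<close>)
    show ?thesis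
      unfolding g_def
      by (rule has_vector_derivative_eq_rhs[OF has_vector_derivative_mult[OF 3 2]])
        (use that in \<open>simp add: f_def g_def powr_add powr_numeral power2_eq_square algebra_simps\<close>)
  qed
  have norm_g: "norm (g (a + 1) x) = x powr (a + 1) * exp (- Re z * x - x\<^sup>2 / 2)" for x
    by (simp add: g_def norm_mult abs_mult flip: exp_add)
  have "(LBINT x=0..\<infinity>. f x) = 0 - 0"
  proof (rule interval_integral_FTC_integrable)
    show "set_integrable lborel (einterval 0 \<infinity>) f" using fi ein by simp
    show "isCont f x" if "0 < ereal x" "ereal x < \<infinity>" for x
      using that unfolding f_def g_def
      by (auto intro!: continuous_intros simp: zero_ereal_def)
    have "((\<lambda>x. g (a + 1) x) \<longlongrightarrow> 0) (at_right 0)"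
    proof (rule Lim_null_comparison)
      show "\<forall>\<^sub>F x in at_right 0. norm (g (a + 1) x) \<le> x powr (a + 1) * exp (- Re z * x - x\<^sup>2 / 2)"
        by (simp add: norm_g)
      show "((\<lambda>x. x powr (a + 1) * exp (- Re z * x - x\<^sup>2 / 2)) \<longlongrightarrow> 0) (at_right 0)"
        using assms by real_asymp
    qed
    then show "((g (a + 1) \<circ> real_of_ereal) \<longlongrightarrow> 0) (at_right 0)"
      by (simp add: zero_ereal_def ereal_tendsto_simps1)
    have "((\<lambda>x. g (a + 1) x) \<longlongrightarrow> 0) at_top"
    proof (rule Lim_null_comparison)
      show "\<forall>\<^sub>F x in at_top. norm (g (a + 1) x) \<le> x powr (a + 1) * exp (- Re z * x - x\<^sup>2 / 2)"
        by (simp add: norm_g)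
      show "((\<lambda>x. x powr (a + 1) * exp (- Re z * x - x\<^sup>2 / 2)) \<longlongrightarrow> 0) at_top"
        using assms by real_asymp
    qed
    then show "((g (a + 1) \<circ> real_of_ereal) \<longlongrightarrow> 0) (at_left \<infinity>)"
      by (simp add: ereal_tendsto_simps1)
  qed (use der in \<open>auto simp: zero_ereal_def\<close>)
  then have "(LINT x:{0<..}|lborel. f x) = 0"
    by (simp add: interval_lebesgue_integral_def ein)
  moreover have "(LINT x:{0<..}|lborel. f x) =
      of_real (a + 1) * gauss_moment a z - z * gauss_moment (a + 1) z - gauss_moment (a + 2) z"
  proof -
    have I: "set_integrable lborel {0<..} (\<lambda>x. of_real (a + 1) * g a x)"
      "set_integrable lborel {0<..} (\<lambda>x. z * g (a + 1) x)" "set_integrable lborel {0<..} (g (a + 2))"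
      using assms by (auto intro!: set_integrable_mult_right gi)
    show ?thesis
      unfolding f_def gm set_integral_mult_right[symmetric]
        set_integral_diff(2)[OF I(1,2), symmetric]
        set_integral_diff(2)[OF set_integral_diff(1)[OF I(1,2)] I(3), symmetric] ..
  qed
  ultimately show ?thesis by (simp add: algebra_simps)
qed

text \<open>
  Reduction of order: the quotient \<open>(v - u) / u\<close> has derivative \<open>K / u\<^sup>2\<close> with the constant Wronskian
  \<open>K\<close>, and \<open>1 / u\<^sup>2\<close> is unbounded at infinity, whereas the quotient tends to 0.
\<close>

lemma parabolic_cylinder_ode_unique:
  fixes u v :: "complex \<Rightarrow> complex" and p :: real
  assumes u: "u holomorphic_on UNIV" "\<And>z. deriv (deriv u) z + (of_real p + 1 / 2 - z\<^sup>2 / 4) * u z = 0"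
      "(\<lambda>x::real. u (of_real x)) \<sim>[at_top] (\<lambda>x. of_real (x powr p * exp (- x\<^sup>2 / 4)))"
    and v: "v holomorphic_on UNIV" "\<And>z. deriv (deriv v) z + (of_real p + 1 / 2 - z\<^sup>2 / 4) * v z = 0"
      "(\<lambda>x::real. v (of_real x)) \<sim>[at_top] (\<lambda>x. of_real (x powr p * exp (- x\<^sup>2 / 4)))"
  shows "u = v"
proof -
  define g where "g = (\<lambda>x::real. x powr p * exp (- x\<^sup>2 / 4))"
  have g_pos: "g x > 0" if "x > 0" for x using that by (simp add: g_def)
  have ev_g: "\<forall>\<^sub>F x in at_top. complex_of_real (g x) \<noteq> 0"
    using eventually_gt_at_top[of 0] by eventually_elim (simp add: g_pos less_imp_neq[THEN not_sym])
  have lim: "((\<lambda>x. w (of_real x) / of_real (g x)) \<longlongrightarrow> 1) at_top"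
    if "(\<lambda>x::real. w (of_real x)) \<sim>[at_top] (\<lambda>x. complex_of_real (x powr p * exp (- x\<^sup>2 / 4)))" for w :: "complex \<Rightarrow> complex"
  proof -
    have "\<forall>\<^sub>F x in at_top. w (complex_of_real x) \<noteq> 0 \<or> complex_of_real (x powr p * exp (- x\<^sup>2 / 4)) \<noteq> 0"
      using ev_g by eventually_elim (simp add: g_def)
    from asymp_equivD_strong[OF that this] show ?thesis unfolding g_def .
  qed
  define d where "d = (\<lambda>z. v z - u z)"
  have d_holo: "d holomorphic_on UNIV" unfolding d_def by (intro holomorphic_intros u v)
  have D: "(w has_field_derivative deriv w z) (at z)" if "w holomorphic_on UNIV" for w :: "complex \<Rightarrow> complex" and z
    using holomorphic_derivI[OF that, of z] by simp
  have D2: "(deriv w has_field_derivative deriv (deriv w) z) (at z)" if "w holomorphic_on UNIV" for w :: "complex \<Rightarrow> complex" and z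
    by (rule D) (intro holomorphic_deriv that open_UNIV)
  have deriv_d: "deriv d = (\<lambda>z. deriv v z - deriv u z)"
    unfolding d_def by (rule ext, rule DERIV_imp_deriv) (intro derivative_intros D u v)
  have d_ode: "deriv (deriv d) z = - (of_real p + 1 / 2 - z\<^sup>2 / 4) * d z" for z
  proof -
    have "deriv (deriv d) z = deriv (deriv v) z - deriv (deriv u) z"
      unfolding deriv_d by (rule DERIV_imp_deriv) (intro derivative_intros D2 u v)
    moreover have "deriv (deriv v) z = - (of_real p + 1 / 2 - z\<^sup>2 / 4) * v z"
      unfolding mult_minus_left using v(2)[of z] by (simp only: eq_neg_iff_add_eq_0)
    moreover have "deriv (deriv u) z = - (of_real p + 1 / 2 - z\<^sup>2 / 4) * u z"
      unfolding mult_minus_left using u(2)[of z] by (simp only: eq_neg_iff_add_eq_0)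
    ultimately show ?thesis by (simp add: d_def right_diff_distrib)
  qed
  have u_ode: "deriv (deriv u) z = - (of_real p + 1 / 2 - z\<^sup>2 / 4) * u z" for z
    unfolding mult_minus_left using u(2)[of z] by (simp only: eq_neg_iff_add_eq_0)
  have "\<exists>K. \<forall>z. deriv d z * u z - d z * deriv u z = K"
  proof -
    have "((\<lambda>z. deriv d z * u z - d z * deriv u z) has_field_derivative 0) (at z)" for z
      by (rule derivative_eq_intros D2 D u d_holo refl)+ (simp add: d_ode u_ode algebra_simps)
    from has_field_derivative_zero_constant[OF convex_UNIV, of "\<lambda>z. deriv d z * u z - d z * deriv u z"] this
    show ?thesis by auto
  qed
  then obtain K where K: "\<And>z. deriv d z * u z - d z * deriv u z = K" by blast
  \<comment> \<open>Write 1/u^2 as (1/g^2) (g/u)^2. The first factor exceeds 4 once g < 1/2, and the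
    second tends to 1. Real parts are taken because u is not known to be real on the real
    line.\<close>
  have "(g \<longlongrightarrow> 0) at_top" unfolding g_def by real_asymp
  then have "\<forall>\<^sub>F x in at_top. g x < 1 / 2" by (rule order_tendstoD) simp
  moreover have "((\<lambda>x. (of_real (g x) / u (of_real x))\<^sup>2) \<longlongrightarrow> 1) at_top"
    using tendsto_power[OF tendsto_inverse[OF lim[OF u(3)]], of 2] by (simp add: field_simps)
  then have "((\<lambda>x. Re ((of_real (g x) / u (of_real x))\<^sup>2)) \<longlongrightarrow> Re 1) at_top"
    by (rule tendsto_Re)
  then have "\<forall>\<^sub>F x in at_top. Re ((of_real (g x) / u (of_real x))\<^sup>2) > 1 / 2"
    by (rule order_tendstoD) simp
  ultimately have "\<forall>\<^sub>F x::real in at_top. x > 0 \<and> u (of_real x) \<noteq> 0 \<and> Re (1 / (u (of_real x))\<^sup>2) \<ge> 1"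
    using eventually_gt_at_top[of 0]
  proof eventually_elim
    case (elim x)
    have nz: "u (of_real x) \<noteq> 0" using elim by (intro notI) simp
    have gx: "0 < g x" using g_pos elim by simp
    have "1 / (u (of_real x))\<^sup>2 = of_real (1 / (g x)\<^sup>2) * (of_real (g x) / u (of_real x))\<^sup>2"
      using gx by (simp add: power_divide)
    then have eq: "Re (1 / (u (of_real x))\<^sup>2) = 1 / (g x)\<^sup>2 * Re ((of_real (g x) / u (of_real x))\<^sup>2)"
      by (simp only: Re_complex_of_real times_complex.sel Im_complex_of_real)
    have "(g x)\<^sup>2 \<le> (1 / 2)\<^sup>2" using elim gx by (intro power_mono) auto
    then have "1 * (g x)\<^sup>2 \<le> Re ((of_real (g x) / u (of_real x))\<^sup>2)" using elim
      by (simp add: power2_eq_square)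
    then have "1 \<le> Re (1 / (u (of_real x))\<^sup>2)"
      unfolding eq using gx by (simp add: field_simps)
    then show ?case using nz elim by simp
  qed
  then obtain X where X: "\<And>x. x \<ge> X \<Longrightarrow> x > 0 \<and> u (of_real x) \<noteq> 0 \<and> Re (1 / (u (of_real x))\<^sup>2) \<ge> 1"
    unfolding eventually_at_top_linorder by blast
  define q where "q = (\<lambda>x::real. d (of_real x) / u (of_real x))"
  have q_lim: "(q \<longlongrightarrow> 0) at_top"
  proof -
    have "((\<lambda>x. (v (of_real x) / of_real (g x)) / (u (of_real x) / of_real (g x)) - 1) \<longlongrightarrow> 1 / 1 - 1) at_top"
      by (intro tendsto_intros lim u v) auto
    moreover have "\<forall>\<^sub>F x in at_top. (v (of_real x) / of_real (g x)) / (u (of_real x) / of_real (g x)) - 1 = q x"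
      using eventually_ge_at_top[of X] ev_g
      by eventually_elim (use X in \<open>auto simp: q_def d_def field_simps\<close>)
    ultimately show ?thesis by (simp add: tendsto_cong)
  qed
  have q_der: "(q has_vector_derivative K * (1 / (u (of_real x))\<^sup>2)) (at x)" if "x \<ge> X" for x
  proof -
    have nz: "u (of_real x) \<noteq> 0" using X that by blast
    have "((\<lambda>z. d z / u z) has_field_derivative K * (1 / (u (of_real x))\<^sup>2)) (at (of_real x))"
      by (rule derivative_eq_intros D u d_holo refl nz)+ (simp add: K power2_eq_square)
    from has_vector_derivative_real_field[OF this] show ?thesis unfolding q_def .
  qed
  have "K = 0"
  proof (rule ccontr)
    assume K0: "K \<noteq> 0"
    \<comment> \<open>Dividing by K leaves the derivative 1/u^2, whose real part is at least 1
      beyond X. So r grows at least linearly, against its limit 0.\<close>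
    define r where "r = (\<lambda>x. Re (q x / K))"
    have r_lim: "(r \<longlongrightarrow> 0) at_top"
      unfolding r_def using tendsto_Re[OF tendsto_divide[OF q_lim tendsto_const, of K]] K0 by simp
    have r_der: "(r has_real_derivative Re (1 / (u (of_real x))\<^sup>2)) (at x)" if "x \<ge> X" for x
    proof -
      have "((\<lambda>x. q x / K) has_vector_derivative (K * (1 / (u (of_real x))\<^sup>2)) / K) (at x)"
        by (intro has_vector_derivative_divide q_der that)
      then have "((\<lambda>x. q x / K) has_vector_derivative (1 / (u (of_real x))\<^sup>2)) (at x)"
        using K0 by simp
      from bounded_linear.has_vector_derivative[OF bounded_linear_Re this]
      show ?thesis unfolding r_def has_real_derivative_iff_has_vector_derivative .
    qed
    have "r x \<ge> r X + (x - X)" if "x \<ge> X" for x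
    proof -
      have "r X - X \<le> r x - x"
      proof (rule DERIV_nonneg_imp_nondecreasing[OF that])
        fix y assume "X \<le> y" "y \<le> x"
        then have "((\<lambda>x. r x - x) has_real_derivative Re (1 / (u (of_real y))\<^sup>2) - 1) (at y)"
          by (intro derivative_intros r_der)
        moreover have "Re (1 / (u (of_real y))\<^sup>2) - 1 \<ge> 0" using X \<open>X \<le> y\<close> by simp
        ultimately show "\<exists>z. ((\<lambda>x. r x - x) has_real_derivative z) (at y) \<and> 0 \<le> z" by blast
      qed
      then show ?thesis by simp
    qed
    note growth = this
    have "\<forall>\<^sub>F x in at_top. r x < 1" using r_lim by (rule order_tendstoD) simp
    then have "\<forall>\<^sub>F x in at_top. r X + (x - X) < 1"
      using eventually_ge_at_top[of X] by eventually_elim (use growth in force)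
    then have "\<forall>\<^sub>F x in at_top. (x::real) < 1 + X - r X" by (auto elim: eventually_mono)
    moreover have "\<forall>\<^sub>F x in at_top. x \<ge> 1 + X - r X" by (rule eventually_ge_at_top)
    ultimately have "\<forall>\<^sub>F x::real in at_top. False" by eventually_elim simp
    then show False by simp
  qed
  have q_const: "q x = q X" if "x \<ge> X" for x
  proof -
    have "(q has_vector_derivative 0) (at y within {X..})" if "y \<in> {X..}" for y
      using q_der[of y] that \<open>K = 0\<close> by (auto intro: has_vector_derivative_at_within)
    then obtain c where "\<forall>y\<in>{X..}. q y = c"
      by (rule has_vector_derivative_zero_constant[OF convex_real_interval(1)]) auto
    then show ?thesis using that by simp
  qed
  have "q X = 0"
  proof (rule tendsto_unique[OF _ _ q_lim])
    show "(q \<longlongrightarrow> q X) at_top"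
      by (rule tendsto_eventually) (rule eventually_mono[OF eventually_ge_at_top[of X] q_const])
  qed simp
  then have d0: "d (of_real x) = 0" if "x \<ge> X" for x
    using q_const[OF that] X[OF that] unfolding q_def by (metis divide_eq_0_iff)
  \<comment> \<open>The zeros of d fill a ray, which accumulates at X, so the identity theorem
    applies.\<close>
  have "d z = 0" for z
  proof (rule analytic_continuation[of d UNIV "of_real ` {X..}" "of_real X"])
    show "complex_of_real X islimpt complex_of_real ` {X..}"
      unfolding islimpt_approachable
    proof (intro allI impI)
      fix e :: real assume "e > 0"
      then have "of_real (X + e / 2) \<in> complex_of_real ` {X..}" by (intro imageI) simp
      moreover have "dist (of_real (X + e / 2)) (complex_of_real X) < e" "of_real (X + e / 2) \<noteq> complex_of_real X"
        using \<open>e > 0\<close> by (auto simp: dist_norm norm_divide)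
      ultimately show "\<exists>x'\<in>complex_of_real ` {X..}. x' \<noteq> complex_of_real X \<and> dist x' (complex_of_real X) < e"
        by blast
    qed
    show "\<And>z. z \<in> complex_of_real ` {X..} \<Longrightarrow> d z = 0" using d0 by auto
  qed (use d_holo in auto)
  then show ?thesis by (auto simp: d_def)
qed

section \<open>The explicit solution of order less than one\<close>

text \<open>Differentiating produces a moment of order a + 2, which the recurrence eliminates. Thus
  this combination and \<open>gauss_moment a\<close> form a closed linear system, the source of a
  second-order equation.\<close>

lemma cylinder_moment_has_field_derivative:
  assumes "a > -1"
  shows "((\<lambda>z. gauss_moment (a + 1) z + z * gauss_moment a z) has_field_derivative
    - of_real a * gauss_moment a z) (at z)"
proof -
  have "a + 1 > -1" using assms by simp
  note D = gauss_moment_has_field_derivative[OF assms] gauss_moment_has_field_derivative[OF this]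
  have "- gauss_moment (a + 1 + 1) z + (1 * gauss_moment a z + - gauss_moment (a + 1) z * z)
      = - of_real a * gauss_moment a z"
    using gauss_moment_recurrence[OF assms, of z] by (simp add: algebra_simps)
  then show ?thesis
    using DERIV_add[OF D(2) DERIV_mult[OF DERIV_ident D(1)], of z] by simp
qed

text \<open>The continuation of the classical representation to p < 1. For p < 0 the recurrence and
  Gamma (1 - p) = -p Gamma (-p) reduce it to exp (- z^2/4) \<open>gauss_moment (- p - 1) z\<close> /
  Gamma (-p).\<close>

definition cylinder_integral :: "real \<Rightarrow> complex \<Rightarrow> complex" where
  "cylinder_integral p z =
    exp (- z\<^sup>2 / 4) * (gauss_moment (1 - p) z + z * gauss_moment (- p) z) / of_real (Gamma (1 - p))"

text \<open>With G = \<open>gauss_moment (- p)\<close> the system reads J' = p G and G' = z G - J,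
  hence J'' = z J' - p J. The factor exp (- z^2/4) removes the first-order term and leaves the
  potential p + 1/2 - z^2/4.\<close>

lemma cylinder_integral_ode:
  assumes "p < 1"
  shows "cylinder_integral p holomorphic_on UNIV"
    and "deriv (deriv (cylinder_integral p)) z + (of_real p + 1 / 2 - z\<^sup>2 / 4) * cylinder_integral p z = 0"
proof -
  have a: "- p > -1" using assms by simp
  define J where "J = (\<lambda>z. gauss_moment (1 - p) z + z * gauss_moment (- p) z)"
  define c where "c = complex_of_real (Gamma (1 - p))"
  have c: "c \<noteq> 0" using assms Gamma_real_pos[of "1 - p"] by (simp add: c_def less_imp_neq[THEN not_sym])
  have J: "(J has_field_derivative of_real p * gauss_moment (- p) z) (at z)" for z
    using cylinder_moment_has_field_derivative[OF a, of z] by (simp add: J_def)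
  have G: "(gauss_moment (- p) has_field_derivative - gauss_moment (1 - p) z) (at z)" for z
    using gauss_moment_has_field_derivative[OF a, of z] by simp
  have ci: "cylinder_integral p = (\<lambda>z. exp (- z\<^sup>2 / 4) * J z / c)"
    by (simp add: fun_eq_iff cylinder_integral_def J_def c_def)
  define u1 where "u1 = (\<lambda>z. exp (- z\<^sup>2 / 4) * (of_real p * gauss_moment (- p) z - z / 2 * J z) / c)"
  have 1: "(cylinder_integral p has_field_derivative u1 z) (at z)" for z
    unfolding ci u1_def using c
    by (auto intro!: derivative_eq_intros J simp: field_simps)
  then show "cylinder_integral p holomorphic_on UNIV"
    by (auto simp: holomorphic_on_open)
  have d1: "deriv (cylinder_integral p) = u1"
    using 1 by (intro ext DERIV_imp_deriv)
  have "(u1 has_field_derivative - (of_real p + 1 / 2 - z\<^sup>2 / 4) * (exp (- z\<^sup>2 / 4) * J z / c)) (at z)"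
    unfolding u1_def
  proof -
    have E: "((\<lambda>z. exp (- z\<^sup>2 / 4)) has_field_derivative (- z / 2 * exp (- z\<^sup>2 / 4))) (at z)"
      by (auto intro!: derivative_eq_intros)
    have L: "((\<lambda>z. z / 2 * J z) has_field_derivative 1 / 2 * J z + of_real p * gauss_moment (- p) z * (z / 2)) (at z)"
      by (rule DERIV_mult[OF DERIV_cdivide[OF DERIV_ident] J])
    show "((\<lambda>z. exp (- z\<^sup>2 / 4) * (of_real p * gauss_moment (- p) z - z / 2 * J z) / c) has_field_derivative
        - (of_real p + 1 / 2 - z\<^sup>2 / 4) * (exp (- z\<^sup>2 / 4) * J z / c)) (at z)"
      by (rule DERIV_cong[OF DERIV_cdivide[OF DERIV_mult[OF E DERIV_diff[OF DERIV_cmult[OF G] L]]]])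
        (use c in \<open>simp add: J_def field_simps power2_eq_square\<close>)
  qed
  then have ode: "deriv u1 z = - (of_real p + 1 / 2 - z\<^sup>2 / 4) * (exp (- z\<^sup>2 / 4) * J z / c)"
    by (rule DERIV_imp_deriv)
  show "deriv (deriv (cylinder_integral p)) z + (of_real p + 1 / 2 - z\<^sup>2 / 4) * cylinder_integral p z = 0"
    unfolding d1 unfolding ci ode mult_minus_left by (rule left_minus)
qed

lemma gauss_moment_of_real:
  "gauss_moment a (of_real y) = of_real (LINT x:{0<..}|lborel. x powr a * exp (- x\<^sup>2 / 2) * exp (- x * y))"
proof -
  have "gauss_moment a (of_real y) =
      (LINT x:{0<..}|lborel. complex_of_real (x powr a * exp (- x\<^sup>2 / 2) * exp (- x * y)))"
    unfolding gauss_moment_def by (simp flip: exp_of_real)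
  also have "\<dots> = of_real (LINT x:{0<..}|lborel. x powr a * exp (- x\<^sup>2 / 2) * exp (- x * y))"
    by (simp only: set_lebesgue_integral_def scaleR_conv_of_real of_real_mult[symmetric]
        integral_complex_of_real real_scaleR_def of_real_eq_id id_apply)
  finally show ?thesis .
qed

text \<open>Rescaling x by 1/y turns the left side into the integral of x powr a times exp (- x)
  times exp (- (x/y)^2/2). The last factor is at most 1 and tends to 1, so dominated convergence
  leaves the Gamma integral.\<close>

lemma gauss_moment_asymptotics:
  assumes a: "a > -1"
  shows "((\<lambda>y::real. of_real (y powr (a + 1)) * gauss_moment a (of_real y)) \<longlongrightarrow> of_real (Gamma (a + 1))) at_top"
proof -
  let ?s = "\<lambda>y x::real. indicator {0<..} x * (x powr a * exp (- x) * exp (- (x / y)\<^sup>2 / 2))"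
  have "((\<lambda>y. LINT x|lborel. ?s y x) \<longlongrightarrow> (LINT x|lborel. indicator {0<..} x * (x powr a * exp (- x)))) at_top"
  proof (rule integral_dominated_convergence_at_top)
    show "integrable lborel (\<lambda>x::real. indicator {0<..} x * (x powr a * exp (- x)))"
      using set_integrable_Gamma_real[OF a] by (simp add: set_integrable_def)
    show "AE x in lborel. ((\<lambda>y. ?s y x) \<longlongrightarrow> indicator {0<..} x * (x powr a * exp (- x))) at_top"
    proof (intro AE_I2)
      fix x :: real
      have "((\<lambda>y. exp (- (x / y)\<^sup>2 / 2)) \<longlongrightarrow> exp (- 0\<^sup>2 / 2)) at_top"
        by (intro tendsto_intros tendsto_divide_0[OF tendsto_const] filterlim_at_top_imp_at_infinity filterlim_ident) simp
      then have "((\<lambda>y. exp (- (x / y)\<^sup>2 / 2)) \<longlongrightarrow> 1) at_top" by simp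
      then have "((\<lambda>y. ?s y x) \<longlongrightarrow> indicator {0<..} x * (x powr a * exp (- x) * 1)) at_top"
        by (intro tendsto_mult tendsto_const)
      then show "((\<lambda>y. ?s y x) \<longlongrightarrow> indicator {0<..} x * (x powr a * exp (- x))) at_top" by simp
    qed
    show "\<forall>\<^sub>F y in at_top. AE x in lborel. norm (?s y x) \<le> indicator {0<..} x * (x powr a * exp (- x))"
      by (intro always_eventually allI AE_I2) (auto simp: indicator_def abs_mult mult_left_le)
  qed measurable
  then have lim: "((\<lambda>y. LINT x|lborel. ?s y x) \<longlongrightarrow> Gamma (a + 1)) at_top"
    using set_integral_Gamma_real[OF a] by (simp add: set_lebesgue_integral_def)
  have "\<forall>\<^sub>F y in at_top. (LINT x|lborel. ?s y x) =
      y powr (a + 1) * (LINT x:{0<..}|lborel. x powr a * exp (- x\<^sup>2 / 2) * exp (- x * y))"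
    using eventually_gt_at_top[of 0]
  proof eventually_elim
    case (elim y)
    have "(LINT x|lborel. ?s y x) = y * (LINT x|lborel. ?s y (0 + y * x))"
      using lborel_integral_real_affine[of y "?s y" 0] elim by simp
    also have "(\<lambda>x. ?s y (0 + y * x)) =
        (\<lambda>x. y powr a * (indicator {0<..} x * (x powr a * exp (- x\<^sup>2 / 2) * exp (- x * y))))"
      using elim by (auto simp: fun_eq_iff indicator_def powr_mult zero_less_mult_iff mult_ac)
    also have "y * (LINT x|lborel. y powr a * (indicator {0<..} x * (x powr a * exp (- x\<^sup>2 / 2) * exp (- x * y))))
        = y powr (a + 1) * (LINT x:{0<..}|lborel. x powr a * exp (- x\<^sup>2 / 2) * exp (- x * y))"
      unfolding integral_mult_right_zero set_lebesgue_integral_def real_scaleR_def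
      using elim by (simp add: powr_add)
    finally show ?case .
  qed
  then have "((\<lambda>y. y powr (a + 1) * (LINT x:{0<..}|lborel. x powr a * exp (- x\<^sup>2 / 2) * exp (- x * y)))
      \<longlongrightarrow> Gamma (a + 1)) at_top"
    using lim by (rule Lim_transform_eventually[rotated])
  from tendsto_of_real[OF this, where 'a=complex] show ?thesis
    by (simp add: gauss_moment_of_real)
qed

text \<open>The term z \<open>gauss_moment (- p) z\<close> dominates with size Gamma (1 - p) y powr
  p, while \<open>gauss_moment (1 - p)\<close> is smaller by the order y powr (-2). This fixes the
  constant Gamma (1 - p) in \<open>cylinder_integral\<close>.\<close>

lemma cylinder_integral_asymptotics:
  assumes "p < 1"
  shows "(\<lambda>x::real. cylinder_integral p (of_real x)) \<sim>[at_top] (\<lambda>x. of_real (x powr p * exp (- x\<^sup>2 / 4)))"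
proof (rule asymp_equivI')
  define c where "c = complex_of_real (Gamma (1 - p))"
  have c: "c \<noteq> 0" using assms Gamma_real_pos[of "1 - p"] by (simp add: c_def less_imp_neq[THEN not_sym])
  have l0: "((\<lambda>y::real. of_real (y powr (1 - p)) * gauss_moment (- p) (of_real y)) \<longlongrightarrow> c) at_top"
    using gauss_moment_asymptotics[of "- p"] assms by (simp add: c_def)
  have l1: "((\<lambda>y::real. of_real (y powr (2 - p)) * gauss_moment (1 - p) (of_real y)) \<longlongrightarrow> of_real (Gamma (2 - p))) at_top"
    using gauss_moment_asymptotics[of "1 - p"] assms by simp
  have l2: "((\<lambda>y. complex_of_real (y powr (-2))) \<longlongrightarrow> of_real 0) at_top"
    by (intro tendsto_of_real) real_asymp
  have "((\<lambda>y::real. (of_real (y powr (-2)) * (of_real (y powr (2 - p)) * gauss_moment (1 - p) (of_real y))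
      + of_real (y powr (1 - p)) * gauss_moment (- p) (of_real y)) / c)
      \<longlongrightarrow> (of_real 0 * of_real (Gamma (2 - p)) + c) / c) at_top"
    by (intro tendsto_intros l0 l1 l2 c)
  then have "((\<lambda>y::real. (of_real (y powr (-2)) * (of_real (y powr (2 - p)) * gauss_moment (1 - p) (of_real y))
      + of_real (y powr (1 - p)) * gauss_moment (- p) (of_real y)) / c) \<longlongrightarrow> 1) at_top"
    using c by simp
  moreover have "\<forall>\<^sub>F y::real in at_top.
      (of_real (y powr (-2)) * (of_real (y powr (2 - p)) * gauss_moment (1 - p) (of_real y))
        + of_real (y powr (1 - p)) * gauss_moment (- p) (of_real y)) / c =
      cylinder_integral p (of_real y) / of_real (y powr p * exp (- y\<^sup>2 / 4))"
    using eventually_gt_at_top[of 0]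
  proof eventually_elim
    case (elim y)
    define s where "s = complex_of_real (y powr p)"
    define e where "e = exp (- (complex_of_real y)\<^sup>2 / 4)"
    have s: "s \<noteq> 0" using elim by (simp add: s_def)
    have e: "e \<noteq> 0" by (simp add: e_def)
    have e': "complex_of_real (exp (- y\<^sup>2 / 4)) = e" by (simp add: e_def flip: exp_of_real)
    have 1: "complex_of_real (y powr (-2)) * of_real (y powr (2 - p)) = 1 / s"
      using elim by (simp add: s_def flip: of_real_mult powr_add) (simp add: powr_minus_divide)
    have 2: "complex_of_real (y powr (1 - p)) = of_real y / s"
      using elim by (simp add: s_def powr_diff)
    show ?case
      unfolding cylinder_integral_def c_def[symmetric] e_def[symmetric] of_real_mult e' s_def[symmetric]
        mult.assoc[symmetric] 1 2
      using s e c by (simp add: field_simps)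
  qed
  ultimately show "((\<lambda>x::real. cylinder_integral p (of_real x) / of_real (x powr p * exp (- x\<^sup>2 / 4))) \<longlongrightarrow> 1) at_top"
    by (rule Lim_transform_eventually)
qed

lemma parabolic_cylinder_eq_cylinder_integral:
  assumes "p < 1"
  shows "parabolic_cylinder p = cylinder_integral p"
  unfolding parabolic_cylinder_def
  by (rule the_equality)
    (use cylinder_integral_ode[OF assms] cylinder_integral_asymptotics[OF assms]
      in \<open>auto intro: parabolic_cylinder_ode_unique[where p = p]\<close>)

section \<open>Gaussian tails and the weighted cylinder function on the real line\<close>

text \<open>Up to the factor sqrt (2 pi), the expectation of (Z - z) powr a on Z > z for a standard
  normal Z. This is the form in which D_p meets Brownian motion.\<close>

definition gauss_tail :: "real \<Rightarrow> real \<Rightarrow> real" where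
  "gauss_tail a z = (LINT x:{0<..}|lborel. x powr a * exp (- (x + z)\<^sup>2 / 2))"

lemma set_integrable_gauss_tail:
  fixes a z :: real
  assumes "a > -1"
  shows "set_integrable lborel {0<..} (\<lambda>x. x powr a * exp (- (x + z)\<^sup>2 / 2))"
proof -
  have "exp (- z\<^sup>2 / 2) * (x powr a * exp (- z * x - x\<^sup>2 / 2)) = x powr a * exp (- (x + z)\<^sup>2 / 2)" for x
  proof -
    have "exp (- (x + z)\<^sup>2 / 2) = exp (- z\<^sup>2 / 2) * exp (- z * x - x\<^sup>2 / 2)"
      unfolding exp_add[symmetric] by (simp add: power2_eq_square field_simps)
    then show ?thesis by simp
  qed
  moreover have "set_integrable lborel {0<..} (\<lambda>x. exp (- z\<^sup>2 / 2) * (x powr a * exp (- z * x - x\<^sup>2 / 2)))"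
    by (intro set_integrable_mult_right set_integrable_powr_gauss assms)
  ultimately show ?thesis by (simp only:)
qed

lemma gauss_moment_eq_gauss_tail:
  "gauss_moment a (of_real z) = of_real (exp (z\<^sup>2 / 2) * gauss_tail a z)"
proof -
  have "x powr a * exp (- x\<^sup>2 / 2) * exp (- x * z) = exp (z\<^sup>2 / 2) * (x powr a * exp (- (x + z)\<^sup>2 / 2))" for x
  proof -
    have "exp (z\<^sup>2 / 2) * exp (- (x + z)\<^sup>2 / 2) = exp (- x\<^sup>2 / 2) * exp (- x * z)"
      unfolding exp_add[symmetric] by (simp add: power2_eq_square field_simps)
    then show ?thesis by simp
  qed
  then show ?thesis
    unfolding gauss_moment_of_real gauss_tail_def set_integral_mult_right[symmetric] by (simp only:)
qed

lemma gauss_tail_recurrence: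
  assumes "a > -1"
  shows "gauss_tail (a + 2) z + z * gauss_tail (a + 1) z = (a + 1) * gauss_tail a z"
proof -
  have "complex_of_real (exp (z\<^sup>2 / 2) * (gauss_tail (a + 2) z + z * gauss_tail (a + 1) z))
      = of_real (exp (z\<^sup>2 / 2) * ((a + 1) * gauss_tail a z))"
    using gauss_moment_recurrence[OF assms, of "of_real z"]
    unfolding gauss_moment_eq_gauss_tail by (simp add: algebra_simps)
  then show ?thesis unfolding of_real_eq_iff by simp
qed

lemma gauss_tail_has_real_derivative:
  assumes "a > -1"
  shows "(gauss_tail a has_real_derivative - (gauss_tail (a + 1) z + z * gauss_tail a z)) (at z)"
proof -
  have eq: "gauss_tail a = (\<lambda>y. exp (- y\<^sup>2 / 2) * Re (gauss_moment a (of_real y)))"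
    unfolding gauss_moment_eq_gauss_tail by (simp add: fun_eq_iff flip: exp_add mult.assoc)
  have 1: "((\<lambda>y. Re (gauss_moment a (of_real y))) has_real_derivative Re (- gauss_moment (a + 1) (of_real z))) (at z)"
    using bounded_linear.has_vector_derivative[OF bounded_linear_Re
        has_vector_derivative_real_field[OF gauss_moment_has_field_derivative[OF assms, of "of_real z"]]]
    unfolding has_real_derivative_iff_has_vector_derivative .
  have E: "((\<lambda>z. exp (- z\<^sup>2 / 2)) has_real_derivative (- z * exp (- z\<^sup>2 / 2))) (at z)"
    by (auto intro!: derivative_eq_intros)
  have "((\<lambda>y. exp (- y\<^sup>2 / 2) * Re (gauss_moment a (of_real y))) has_real_derivative
      - (gauss_tail (a + 1) z + z * gauss_tail a z)) (at z)"
    by (rule DERIV_cong[OF DERIV_mult[OF E 1]])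
      (simp add: gauss_moment_eq_gauss_tail algebra_simps flip: exp_add)
  then show ?thesis by (subst eq)
qed

lemma gauss_tail_nonneg: "gauss_tail a z \<ge> 0"
  unfolding gauss_tail_def set_lebesgue_integral_def by (rule Bochner_Integration.integral_nonneg) simp

lemma gauss_tail_pos:
  assumes "a > -1"
  shows "gauss_tail a z > 0"
proof -
  have "gauss_tail a z \<noteq> 0"
  proof
    assume "gauss_tail a z = 0"
    then have "AE x in lborel. indicator {0<..} x *\<^sub>R (x powr a * exp (- (x + z)\<^sup>2 / 2)) = 0"
      unfolding gauss_tail_def set_lebesgue_integral_def
      by (subst (asm) integral_nonneg_eq_0_iff_AE)
        (use set_integrable_gauss_tail[OF assms] in \<open>auto simp: set_integrable_def\<close>)
    then have "AE x in lborel. x \<notin> {0<..<1::real}"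
      by eventually_elim (auto simp: indicator_def split: if_splits)
    then have "emeasure lborel {0<..<1::real} = 0"
      by (subst (asm) AE_iff_measurable[OF _ refl]) (auto simp: greaterThanLessThan_def greaterThan_def lessThan_def Collect_conj_eq)
    then show False by simp
  qed
  then show ?thesis using gauss_tail_nonneg[of a z] by simp
qed

text \<open>At z = y / sqrt u the factor exp (- z^2/4) is exp (- y^2/(4 u)), the exponential that
  accompanies D_p on both sides of the equation. In the product all exponential prefactors of the
  Gaussian tails cancel.\<close>

definition weighted_cylinder :: "real \<Rightarrow> real \<Rightarrow> real" where
  "weighted_cylinder p z = exp (- z\<^sup>2 / 4) * parabolic_cylinder_real p z"

lemma weighted_cylinder_eq:
  assumes "p < 1"
  shows "weighted_cylinder p z = (gauss_tail (1 - p) z + z * gauss_tail (- p) z) / Gamma (1 - p)"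
proof -
  have "cylinder_integral p (of_real z) = of_real (exp (- z\<^sup>2 / 4) * exp (z\<^sup>2 / 2) *
      (gauss_tail (1 - p) z + z * gauss_tail (- p) z) / Gamma (1 - p))"
    unfolding cylinder_integral_def gauss_moment_eq_gauss_tail
    by (simp add: algebra_simps flip: exp_of_real)
  then have "parabolic_cylinder_real p z = exp (- z\<^sup>2 / 4) * exp (z\<^sup>2 / 2) *
      (gauss_tail (1 - p) z + z * gauss_tail (- p) z) / Gamma (1 - p)"
    unfolding parabolic_cylinder_real_def parabolic_cylinder_eq_cylinder_integral[OF assms] by simp
  moreover have "exp (- z\<^sup>2 / 4) * (exp (- z\<^sup>2 / 4) * exp (z\<^sup>2 / 2)) = 1"
    by (simp flip: exp_add)
  ultimately show ?thesis
    unfolding weighted_cylinder_def by (metis (no_types, opaque_lifting) mult.assoc mult_1 times_divide_eq_right)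
qed

lemma weighted_cylinder_eq_neg:
  assumes "p < 0"
  shows "weighted_cylinder p z = gauss_tail (- p - 1) z / Gamma (- p)"
proof -
  have "gauss_tail (1 - p) z + z * gauss_tail (- p) z = (- p) * gauss_tail (- p - 1) z"
    using gauss_tail_recurrence[of "- p - 1" z] assms by simp
  moreover have "Gamma (1 - p) = (- p) * Gamma (- p)"
  proof -
    have "- p \<notin> \<int>\<^sub>\<le>\<^sub>0" using assms by (auto elim!: nonpos_Ints_cases)
    from Gamma_plus1[OF this] show ?thesis by simp
  qed
  ultimately show ?thesis
    using weighted_cylinder_eq[of p z] assms by simp
qed

text \<open>The order p - 1 is negative, so a single tail \<open>gauss_tail (- p)\<close> represents
  it, and the derivative of that tail is minus the numerator for order p. This raising of the order
  is why differentiating one equation gives the next.\<close>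

lemma weighted_cylinder_has_real_derivative:
  assumes "p < 1"
  shows "(weighted_cylinder (p - 1) has_real_derivative - weighted_cylinder p z) (at z)"
proof -
  have "weighted_cylinder (p - 1) = (\<lambda>z. gauss_tail (- p) z / Gamma (1 - p))"
    using weighted_cylinder_eq_neg[of "p - 1"] assms by (simp add: fun_eq_iff)
  moreover have "((\<lambda>z. gauss_tail (- p) z / Gamma (1 - p)) has_real_derivative - weighted_cylinder p z) (at z)"
    by (rule DERIV_cong[OF DERIV_cdivide[OF gauss_tail_has_real_derivative[of "- p" z]]])
      (use assms in \<open>simp_all add: weighted_cylinder_eq minus_divide_left\<close>)
  ultimately show ?thesis by simp
qed

lemma isCont_weighted_cylinder:
  assumes "p < 1"
  shows "isCont (weighted_cylinder p) z"
proof -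
  have "weighted_cylinder p = (\<lambda>z. (gauss_tail (1 - p) z + z * gauss_tail (- p) z) / Gamma (1 - p))"
    using weighted_cylinder_eq[OF assms] by (simp add: fun_eq_iff)
  moreover have "isCont (gauss_tail a) z" if "a > -1" for a
    using gauss_tail_has_real_derivative[OF that] by (rule DERIV_isCont)
  moreover have "Gamma (1 - p) \<noteq> 0" using Gamma_real_pos[of "1 - p"] assms by (simp add: less_imp_neq[THEN not_sym])
  ultimately show ?thesis
    using assms by (auto intro!: continuous_intros)
qed

text \<open>For z \<ge> 0 both terms of the representation are nonnegative and the first is
  positive. For z < 0 they compete, so no sign can be read off there.\<close>

lemma weighted_cylinder_pos:
  assumes "p < 1" "z \<ge> 0"
  shows "weighted_cylinder p z > 0"
  unfolding weighted_cylinder_eq[OF assms(1)]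
  using assms gauss_tail_pos[of "1 - p" z] gauss_tail_nonneg[of "- p" z] Gamma_real_pos[of "1 - p"]
  by (intro divide_pos_pos add_pos_nonneg) auto

text \<open>The two tails combine to the integral of x powr (- p) times v exp (- v^2/2) with v = x +
  z. On x \<le> 1 the second factor is at most 1 in absolute value, which gives A. On x > 1 the
  power is at most 1 because p \<ge> 0, and translation invariance gives a B free of z.\<close>

lemma weighted_cylinder_bounded:
  assumes "0 \<le> p" "p < 1"
  obtains K where "K > 0" "\<And>z. \<bar>weighted_cylinder p z\<bar> \<le> K"
proof -
  have a: "- p > -1" using assms by simp
  define B where "B = (LINT v::real|lborel. \<bar>v\<bar> * exp (- v\<^sup>2 / 2))"
  have intB: "integrable lborel (\<lambda>v::real. \<bar>v\<bar> * exp (- v\<^sup>2 / 2))"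
  proof -
    have "integrable lborel (\<lambda>v. std_normal_density v * \<bar>v\<bar> ^ 1)"
      by (rule integrable_std_normal_moment_abs)
    then have "integrable lborel (\<lambda>v. sqrt (2 * pi) * (std_normal_density v * \<bar>v\<bar> ^ 1))"
      by (rule integrable_mult_right)
    then show ?thesis by (simp add: std_normal_density_def mult.commute)
  qed
  have int1: "set_integrable lborel {0<..1} (\<lambda>x::real. x powr (- p))"
  proof -
    have "set_integrable lborel {0<..1} (\<lambda>x::real. exp 1 * (x powr (- p) * exp (- x)))"
      by (intro set_integrable_mult_right set_integrable_subset[OF set_integrable_Gamma_real[OF a]]) auto
    then show ?thesis
    proof (rule set_integrable_bound)
      show "AE x in lborel. x \<in> {0<..1} \<longrightarrow> norm (x powr - p) \<le> norm (exp 1 * (x powr - p * exp (- x)))"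
      proof (intro AE_I2 impI)
        fix x :: real assume "x \<in> {0<..1}"
        then have "x powr - p * 1 \<le> x powr - p * (exp 1 * exp (- x))"
          by (intro mult_left_mono) (auto simp flip: exp_add)
        then show "norm (x powr - p) \<le> norm (exp 1 * (x powr - p * exp (- x)))"
          by (simp add: abs_mult mult_ac)
      qed
    qed (simp add: set_borel_measurable_def)
  qed
  define A where "A = (LINT x:{0<..1}|lborel. x powr (- p))"
  have bound: "\<bar>gauss_tail (1 - p) z + z * gauss_tail (- p) z\<bar> \<le> A + B" for z
  proof -
    have I: "set_integrable lborel {0<..} (\<lambda>x. x powr (1 - p) * exp (- (x + z)\<^sup>2 / 2))"
        "set_integrable lborel {0<..} (\<lambda>x. z * (x powr (- p) * exp (- (x + z)\<^sup>2 / 2)))"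
      using a by (intro set_integrable_mult_right set_integrable_gauss_tail; simp)+
    have intB': "integrable lborel (\<lambda>x. \<bar>z + x\<bar> * exp (- (z + x)\<^sup>2 / 2))"
      using lborel_integrable_real_affine[OF intB, of 1 z] by simp
    have B': "B = (LINT x|lborel. \<bar>z + x\<bar> * exp (- (z + x)\<^sup>2 / 2))"
      unfolding B_def using lborel_integral_real_affine[of 1 "\<lambda>v. \<bar>v\<bar> * exp (- v\<^sup>2 / 2)" z] by simp
    have "gauss_tail (1 - p) z + z * gauss_tail (- p) z =
        (LINT x:{0<..}|lborel. x powr (1 - p) * exp (- (x + z)\<^sup>2 / 2) + z * (x powr (- p) * exp (- (x + z)\<^sup>2 / 2)))"
      unfolding gauss_tail_def by (subst set_integral_add(2)[OF I]) (simp only: set_integral_mult_right)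
    moreover have "\<bar>LINT x:{0<..}|lborel. x powr (1 - p) * exp (- (x + z)\<^sup>2 / 2) + z * (x powr (- p) * exp (- (x + z)\<^sup>2 / 2))\<bar>
        \<le> (LINT x|lborel. indicator {0<..1} x * x powr (- p) + \<bar>z + x\<bar> * exp (- (z + x)\<^sup>2 / 2))"
      unfolding set_lebesgue_integral_def
    proof (rule integral_abs_bound_integral)
      show "integrable lborel (\<lambda>x. indicator {0<..} x *\<^sub>R (x powr (1 - p) * exp (- (x + z)\<^sup>2 / 2)
          + z * (x powr - p * exp (- (x + z)\<^sup>2 / 2))))"
        using set_integral_add(1)[OF I] by (simp add: set_integrable_def)
      show "integrable lborel (\<lambda>x. indicator {0<..1} x * x powr (- p) + \<bar>z + x\<bar> * exp (- (z + x)\<^sup>2 / 2))"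
        using int1 intB' by (auto simp: set_integrable_def)
      fix x :: real
      show "\<bar>indicator {0<..} x *\<^sub>R (x powr (1 - p) * exp (- (x + z)\<^sup>2 / 2) + z * (x powr - p * exp (- (x + z)\<^sup>2 / 2)))\<bar>
          \<le> indicator {0<..1} x * x powr (- p) + \<bar>z + x\<bar> * exp (- (z + x)\<^sup>2 / 2)"
      proof (cases "x > 0")
        case True
        define e where "e = \<bar>z + x\<bar> * exp (- (z + x)\<^sup>2 / 2)"
        have e0: "e \<ge> 0" by (simp add: e_def)
        have "\<bar>z + x\<bar> \<le> exp ((z + x)\<^sup>2 / 2)"
        proof -
          have "0 \<le> (\<bar>z + x\<bar> - 1)\<^sup>2" by simp
          then have "\<bar>z + x\<bar> \<le> 1 + (z + x)\<^sup>2 / 2" unfolding power2_diff power2_abs by simp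
          also have "\<dots> \<le> exp ((z + x)\<^sup>2 / 2)" by (rule exp_ge_add_one_self)
          finally show ?thesis .
        qed
        then have e1: "e \<le> 1" by (simp add: e_def exp_minus field_simps)
        have "x powr (1 - p) = x powr (- p) * x" using True powr_add[of x "- p" 1] by simp
        then have "x powr (1 - p) * exp (- (x + z)\<^sup>2 / 2) + z * (x powr - p * exp (- (x + z)\<^sup>2 / 2))
            = x powr (- p) * ((z + x) * exp (- (z + x)\<^sup>2 / 2))"
          by (simp add: algebra_simps)
        then have "\<bar>x powr (1 - p) * exp (- (x + z)\<^sup>2 / 2) + z * (x powr - p * exp (- (x + z)\<^sup>2 / 2))\<bar> = x powr (- p) * e"
          by (simp add: abs_mult e_def)
        also have "\<dots> \<le> indicator {0<..1} x * x powr (- p) + e"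
        proof (cases "x \<le> 1")
          case True2: True
          have "x powr (- p) * e \<le> x powr (- p) * 1" using e1 by (intro mult_left_mono) auto
          then have "x powr (- p) * e \<le> x powr (- p) + e" using e0 by linarith
          then show ?thesis using True True2 by simp
        next
          case False
          have "x powr (- p) \<le> x powr 0" using False assms by (intro powr_mono) auto
          then have "x powr (- p) * e \<le> 1 * e" using True e0 by (intro mult_right_mono) auto
          then show ?thesis using False by simp
        qed
        finally show ?thesis using True by (simp add: e_def)
      qed auto
    qed
    moreover have "(LINT x|lborel. indicator {0<..1} x * x powr (- p) + \<bar>z + x\<bar> * exp (- (z + x)\<^sup>2 / 2)) = A + B"
      unfolding B' A_def using int1 intB' by (simp add: set_integrable_def set_lebesgue_integral_def)
    ultimately show ?thesis by simp
  qed
  have G: "Gamma (1 - p) > 0" using assms Gamma_real_pos by simp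
  have AB: "A + B \<ge> 0" using bound[of 0] by linarith
  show ?thesis
  proof
    \<comment> \<open>The summand 1 only makes the bound strictly positive.\<close>
    show "(A + B) / Gamma (1 - p) + 1 > 0" using G AB by (simp add: add_nonneg_pos)
    fix z
    have "\<bar>weighted_cylinder p z\<bar> \<le> (A + B) / Gamma (1 - p)"
      unfolding weighted_cylinder_eq[OF assms(2)] abs_divide
      using G bound[of z] by (simp add: divide_right_mono)
    then show "\<bar>weighted_cylinder p z\<bar> \<le> (A + B) / Gamma (1 - p) + 1" by simp
  qed
qed

text \<open>Here u is the remaining time and y the height of the starting point above the level. The
  left-hand side of the equation is the value at u = t, y = - b t, the kernel the value at u = t -
  s, y = b s - b t.\<close>

definition passage_density :: "real \<Rightarrow> real \<Rightarrow> real \<Rightarrow> real" where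
  "passage_density p u y = weighted_cylinder p (y / sqrt u) / u powr ((p + 1) / 2)"

lemma passage_kernel_eq_density:
  assumes "s < t"
  shows "passage_kernel b p t s = passage_density p (t - s) (b s - b t)"
  using assms by (simp add: passage_kernel_def passage_density_def weighted_cylinder_def power_divide)

lemma passage_density_nonneg:
  assumes "p < 0"
  shows "passage_density p u y \<ge> 0"
  unfolding passage_density_def weighted_cylinder_eq_neg[OF assms]
  using gauss_tail_nonneg Gamma_real_pos[of "- p"] assms by simp

text \<open>The expectation of (x - X) powr (- p - 1) on X < x for X normal with mean m and variance
  u. Scaling by sqrt u produces the power u powr (- (p + 1) / 2). The constant Gamma (-p) / sqrt (2
  pi) depends on none of m, u, x and will cancel between the two sides.\<close>

lemma nn_integral_normal_power_tail:
  assumes p: "p < 0" and u: "u > 0"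
  shows "(\<integral>\<^sup>+ z. ennreal (indicator {..<x} (m + sqrt u * z) * (x - (m + sqrt u * z)) powr (- p - 1))
      \<partial>std_normal_distribution) = ennreal (Gamma (- p) / sqrt (2 * pi) * passage_density p u (m - x))"
proof -
  define q where "q = - p - 1"
  have q: "q > -1" using p by (simp add: q_def)
  define y where "y = (m - x) / sqrt u"
  let ?f = "\<lambda>z. indicator {..<x} (m + sqrt u * z) * (x - (m + sqrt u * z)) powr q"
  have e1: "(\<integral>\<^sup>+ z. ennreal (?f z) \<partial>std_normal_distribution) = (\<integral>\<^sup>+ z. ennreal (std_normal_density z) * ennreal (?f z) \<partial>lborel)"
    by (rule nn_integral_density) auto
  \<comment> \<open>The reflection z = - y - v turns the lower tail X < x into v > 0, with x - X =
    sqrt u v.\<close>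
  have e2: "(\<integral>\<^sup>+ z. ennreal (std_normal_density z) * ennreal (?f z) \<partial>lborel) =
      (\<integral>\<^sup>+ v. ennreal (std_normal_density (- y + -1 * v)) * ennreal (?f (- y + -1 * v)) \<partial>lborel)"
    using nn_integral_real_affine[of "\<lambda>z. ennreal (std_normal_density z) * ennreal (?f z)" "-1" "- y"] by simp
  have e3: "(\<integral>\<^sup>+ v. ennreal (std_normal_density (- y + -1 * v)) * ennreal (?f (- y + -1 * v)) \<partial>lborel) = (\<integral>\<^sup>+ v. ennreal (u powr (q / 2) / sqrt (2 * pi)) * ennreal (indicator {0<..} v *\<^sub>R (v powr q * exp (- (v + y)\<^sup>2 / 2))) \<partial>lborel)"
  proof (rule nn_integral_cong)
    fix v :: real
    have s: "sqrt u > 0" using u by simp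
    have 1: "m + sqrt u * (- y + -1 * v) = x - sqrt u * v"
      using s by (simp add: y_def field_simps)
    have 2: "std_normal_density (- y + -1 * v) = exp (- (v + y)\<^sup>2 / 2) / sqrt (2 * pi)"
    proof -
      have "(- y + -1 * v)\<^sup>2 = (v + y)\<^sup>2" by (simp add: power2_eq_square algebra_simps)
      then show ?thesis unfolding std_normal_density_def by simp
    qed
    have 3: "(sqrt u * v) powr q = u powr (q / 2) * v powr q" if "v > 0"
      using s that u by (simp add: powr_mult powr_half_sqrt[symmetric] powr_powr)
    have "std_normal_density (- y + -1 * v) * ?f (- y + -1 * v) =
       u powr (q / 2) / sqrt (2 * pi) * (indicator {0<..} v *\<^sub>R (v powr q * exp (- (v + y)\<^sup>2 / 2)))"
      unfolding 1 2 using s 3 by (auto simp: indicator_def zero_less_mult_iff)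
    then show "ennreal (std_normal_density (- y + -1 * v)) * ennreal (?f (- y + -1 * v)) =
        ennreal (u powr (q / 2) / sqrt (2 * pi)) * ennreal (indicator {0<..} v *\<^sub>R (v powr q * exp (- (v + y)\<^sup>2 / 2)))"
      by (simp only: ennreal_mult'[symmetric] normal_density_nonneg) (simp add: ennreal_mult'[symmetric])
  qed
  have e4: "(\<integral>\<^sup>+ v. ennreal (u powr (q / 2) / sqrt (2 * pi)) * ennreal (indicator {0<..} v *\<^sub>R (v powr q * exp (- (v + y)\<^sup>2 / 2))) \<partial>lborel)
      = ennreal (u powr (q / 2) / sqrt (2 * pi)) * (\<integral>\<^sup>+ v. ennreal (indicator {0<..} v *\<^sub>R (v powr q * exp (- (v + y)\<^sup>2 / 2))) \<partial>lborel)"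
    by (rule nn_integral_cmult) auto
  have e5: "(\<integral>\<^sup>+ v. ennreal (indicator {0<..} v *\<^sub>R (v powr q * exp (- (v + y)\<^sup>2 / 2))) \<partial>lborel) = ennreal (gauss_tail q y)"
    unfolding gauss_tail_def set_lebesgue_integral_def
    by (rule nn_integral_eq_integral) (use set_integrable_gauss_tail[OF q] in \<open>auto simp: set_integrable_def\<close>)
  have e6: "ennreal (u powr (q / 2) / sqrt (2 * pi)) * ennreal (gauss_tail q y) = ennreal (u powr (q / 2) / sqrt (2 * pi) * gauss_tail q y)"
    by (rule ennreal_mult'[symmetric]) simp
  have e7: "u powr (q / 2) / sqrt (2 * pi) * gauss_tail q y = Gamma (- p) / sqrt (2 * pi) * passage_density p u (m - x)"
  proof -
    have "q / 2 = - ((p + 1) / 2)" by (simp add: q_def field_simps)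
    then have "u powr (q / 2) = 1 / u powr ((p + 1) / 2)" by (simp only: powr_minus_divide)
    moreover have "Gamma (- p) > 0" using p Gamma_real_pos by simp
    ultimately show ?thesis
      unfolding passage_density_def weighted_cylinder_eq_neg[OF p] y_def[symmetric] q_def[symmetric] by simp
  qed
  show ?thesis
    unfolding q_def[symmetric] e1 e2 e3 e4 e5 e6 e7 ..
qed

section \<open>First passage of Brownian motion\<close>

text \<open>An uncountable union of crossing times is reduced to countably many. The strict bound by
  1 / (k + 1) survives a small move to a point of D; conversely, a compact subinterval of the open
  interval supplies a limit of near-zeros at which f is nonpositive. The offset 3 keeps every such
  subinterval nondegenerate.\<close>

lemma ex_nonpos_iff_dense:
  fixes f :: "real \<Rightarrow> real"
  assumes cont: "continuous_on {0<..} f"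
    and dense: "\<And>x y. 0 < x \<Longrightarrow> x < y \<Longrightarrow> y < a \<Longrightarrow> \<exists>d\<in>D. x < d \<and> d < y"
    and a: "0 < a"
  shows "(\<exists>r. 0 < r \<and> r < a \<and> f r \<le> 0) \<longleftrightarrow>
    (\<exists>m::nat. \<forall>k::nat. \<exists>d\<in>D \<inter> {a / (real m + 3)..a - a / (real m + 3)}. f d < 1 / (real k + 1))"
proof
  assume "\<exists>r. 0 < r \<and> r < a \<and> f r \<le> 0"
  then obtain r where r: "0 < r" "r < a" "f r \<le> 0" by blast
  have "((\<lambda>m::nat. a / (real m + 3)) \<longlonglongrightarrow> 0)" by real_asymp
  then have "\<forall>\<^sub>F m in sequentially. a / (real m + 3) < min r (a - r)"
    using r by (intro order_tendstoD) auto
  then obtain m :: nat where m: "a / (real m + 3) < min r (a - r)"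
    by (auto simp: eventually_sequentially)
  have am: "0 < a / (real m + 3)" using a by simp
  have "\<exists>d\<in>D \<inter> {a / (real m + 3)..a - a / (real m + 3)}. f d < 1 / (real k + 1)" for k :: nat
  proof -
    have "isCont f r" using cont r by (simp add: continuous_on_eq_continuous_at)
    then have "\<forall>\<^sub>F x in nhds r. f x < 1 / (real k + 1)"
      using r by (intro order_tendstoD[of f "f r"])
        (auto simp: isCont_def tendsto_at_iff_tendsto_nhds intro: le_less_trans)
    then obtain e where e: "e > 0" "\<And>x. dist x r < e \<Longrightarrow> f x < 1 / (real k + 1)"
      unfolding eventually_nhds_metric by blast
    define y where "y = min (r + e) (a - a / (real m + 3))"
    have "r < y" using e m by (auto simp: y_def)
    moreover have "y < a" using am by (auto simp: y_def min_def)
    ultimately obtain d where d: "d \<in> D" "r < d" "d < y" using dense[of r y] r by blast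
    then have "f d < 1 / (real k + 1)" using e by (auto simp: dist_real_def y_def)
    moreover have "d \<in> {a / (real m + 3)..a - a / (real m + 3)}" using d m by (auto simp: y_def)
    ultimately show ?thesis using d by blast
  qed
  then show "\<exists>m::nat. \<forall>k::nat. \<exists>d\<in>D \<inter> {a / (real m + 3)..a - a / (real m + 3)}. f d < 1 / (real k + 1)" by blast
next
  assume "\<exists>m::nat. \<forall>k::nat. \<exists>d\<in>D \<inter> {a / (real m + 3)..a - a / (real m + 3)}. f d < 1 / (real k + 1)"
  then obtain m :: nat and d :: "nat \<Rightarrow> real"
    where d: "\<And>k. d k \<in> {a / (real m + 3)..a - a / (real m + 3)}" "\<And>k. f (d k) < 1 / (real k + 1)"
    by (metis IntD2)
  have am: "0 < a / (real m + 3)" using a by simp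
  from d(1) compact_Icc[of "a / (real m + 3)" "a - a / (real m + 3)"]
  obtain l and \<sigma> :: "nat \<Rightarrow> nat" where l: "l \<in> {a / (real m + 3)..a - a / (real m + 3)}" "strict_mono \<sigma>" "(d \<circ> \<sigma>) \<longlonglongrightarrow> l"
    unfolding compact_def by blast
  have l0: "0 < l" "l < a" using l(1) am by auto
  then have "isCont f l" using cont by (simp add: continuous_on_eq_continuous_at)
  then have "(\<lambda>k. f ((d \<circ> \<sigma>) k)) \<longlonglongrightarrow> f l" using l(3) by (rule isCont_tendsto_compose)
  moreover have "(\<lambda>k. 1 / (real (\<sigma> k) + 1)) \<longlonglongrightarrow> 0"
  proof -
    have "(\<lambda>k. 1 / (real k + 1)) \<longlonglongrightarrow> 0" by real_asymp
    from LIMSEQ_subseq_LIMSEQ[OF this l(2)] show ?thesis by (simp add: o_def)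
  qed
  ultimately have "f l \<le> 0"
    by (rule LIMSEQ_le) (use d(2) in \<open>auto intro!: exI[of _ 0] less_imp_le\<close>)
  then show "\<exists>r. 0 < r \<and> r < a \<and> f r \<le> 0" using l0 by blast
qed

text \<open>Once the mesh s / 2 ^ n is below y - x, the first grid point to the right of x lies
  before y.\<close>

lemma dyadic_between:
  fixes s x y :: real
  assumes "0 < s" "0 \<le> x" "x < y" "y < s"
  obtains n i :: nat where "i \<le> 2 ^ n" "x < s * real i / 2 ^ n" "s * real i / 2 ^ n < y"
proof -
  obtain n :: nat where n: "s / (y - x) < 2 ^ n"
    using real_arch_pow[of 2 "s / (y - x)"] by auto
  define i where "i = nat (floor (x * 2 ^ n / s) + 1)"
  have nn: "0 \<le> x * 2 ^ n / s" using assms by simp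
  have i: "real i = of_int (floor (x * 2 ^ n / s)) + 1"
    using nn by (simp add: i_def)
  have "x * 2 ^ n / s < real i" "real i \<le> x * 2 ^ n / s + 1" unfolding i by linarith+
  then have 1: "x < s * real i / 2 ^ n" and 2: "s * real i / 2 ^ n \<le> x + s / 2 ^ n"
    using assms by (simp_all add: field_simps)
  have "s / 2 ^ n < y - x" using n assms by (simp add: field_simps)
  with 2 have 3: "s * real i / 2 ^ n < y" by simp
  then have "s * real i / 2 ^ n < s" using assms by simp
  then have "real i < 2 ^ n" using assms by (simp add: field_simps)
  then have "i \<le> 2 ^ n" by (metis of_nat_less_iff of_nat_numeral of_nat_power less_imp_le)
  with 1 3 show ?thesis by (rule that[rotated])
qed

text \<open>Measurability of \<tau> is needed for W and for its translate starting at 0 before their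
  passage times can be compared. This locale therefore holds what is available for both;
  \<open>brownian_passage\<close> adds the rest.\<close>

locale brownian_boundary = standard_brownian_motion M W
  for M :: "'a measure" and W :: "real \<Rightarrow> 'a \<Rightarrow> real" +
  fixes b :: "real \<Rightarrow> real"
  assumes continuous_b: "continuous_on {0<..} b"
begin

abbreviation "\<tau> \<equiv> first_passage_time W b"
abbreviation "F \<equiv> first_passage_cdf M W b"

lemma tau_less_iff: "\<tau> \<omega> < ereal a \<longleftrightarrow> (\<exists>r. 0 < r \<and> r < a \<and> W r \<omega> \<le> b r)"
  unfolding first_passage_time_def Inf_less_iff by auto

lemma tau_nonneg: "0 \<le> \<tau> \<omega>"
  unfolding first_passage_time_def by (rule Inf_greatest) auto

lemma continuous_gap:
  assumes "\<omega> \<in> space M"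
  shows "continuous_on {0<..} (\<lambda>r. W r \<omega> - b r)"
  by (intro continuous_intros continuous_b continuous_on_subset[OF continuous_paths[OF assms]]) auto

text \<open>The sigma-algebra and the dense set are left open because two choices are needed: all
  events with rational times, and the past of a time s with dyadic fractions of s.\<close>

lemma tau_less_in_sets:
  assumes N: "space N = space M" and D: "countable D"
    and W: "\<And>d. d \<in> D \<Longrightarrow> W d \<in> borel_measurable N"
    and dense: "\<And>x y. 0 < x \<Longrightarrow> x < y \<Longrightarrow> y < a \<Longrightarrow> \<exists>d\<in>D. x < d \<and> d < y"
  shows "{\<omega> \<in> space M. \<tau> \<omega> < ereal a} \<in> sets N"
proof (cases "a > 0")
  case False
  then have "{\<omega> \<in> space M. \<tau> \<omega> < ereal a} = {}" by (auto simp: tau_less_iff)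
  then show ?thesis by (metis sets.empty_sets)
next
  case True
  have "{\<omega> \<in> space M. \<tau> \<omega> < ereal a} =
      {\<omega> \<in> space N. \<exists>m::nat. \<forall>k::nat. \<exists>d\<in>D \<inter> {a / (real m + 3)..a - a / (real m + 3)}. W d \<omega> - b d < 1 / (real k + 1)}"
    (is "?L = ?R")
  proof (rule Collect_cong, rule conj_cong)
    fix \<omega> assume "\<omega> \<in> space N"
    then have "\<omega> \<in> space M" by (simp add: N)
    have "\<tau> \<omega> < ereal a \<longleftrightarrow> (\<exists>r. 0 < r \<and> r < a \<and> W r \<omega> - b r \<le> 0)" by (simp add: tau_less_iff)
    also have "\<dots> \<longleftrightarrow> (\<exists>m::nat. \<forall>k::nat. \<exists>d\<in>D \<inter> {a / (real m + 3)..a - a / (real m + 3)}. W d \<omega> - b d < 1 / (real k + 1))"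
      using continuous_gap[OF \<open>\<omega> \<in> space M\<close>] dense True by (rule ex_nonpos_iff_dense)
    finally show "\<tau> \<omega> < ereal a \<longleftrightarrow> (\<exists>m::nat. \<forall>k::nat. \<exists>d\<in>D \<inter> {a / (real m + 3)..a - a / (real m + 3)}. W d \<omega> - b d < 1 / (real k + 1))" .
  qed (simp add: N)
  moreover have "?R \<in> sets N"
  proof (intro sets.sets_Collect_countable_Ex sets.sets_Collect_countable_All)
    fix m k :: nat
    have "countable (D \<inter> {a / (real m + 3)..a - a / (real m + 3)})" using D by simp
    moreover have "{\<omega> \<in> space N. W d \<omega> - b d < 1 / (real k + 1)} \<in> sets N" if "d \<in> D \<inter> {a / (real m + 3)..a - a / (real m + 3)}" for d
    proof -
      have [measurable]: "W d \<in> borel_measurable N" using W that by simp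
      show ?thesis by measurable
    qed
    ultimately show "{\<omega> \<in> space N. \<exists>d\<in>D \<inter> {a / (real m + 3)..a - a / (real m + 3)}. W d \<omega> - b d < 1 / (real k + 1)} \<in> sets N"
      by (rule sets.sets_Collect_countable_Ex'[rotated])
  qed
  ultimately show ?thesis by simp
qed

lemma tau_less_event: "{\<omega> \<in> space M. \<tau> \<omega> < ereal a} \<in> events"
proof (rule tau_less_in_sets)
  show "countable (\<rat> \<inter> {0<..} :: real set)" by (auto intro: countable_rat)
  show "\<And>d. d \<in> \<rat> \<inter> {0<..} \<Longrightarrow> W d \<in> borel_measurable M" by (rule random_variable_W) auto
  show "\<And>x y. 0 < x \<Longrightarrow> x < y \<Longrightarrow> y < a \<Longrightarrow> \<exists>d\<in>\<rat> \<inter> {0<..}. x < d \<and> d < y"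
    using Rats_dense_in_real by fastforce
qed simp

lemma tau_measurable [measurable]: "\<tau> \<in> borel_measurable M"
proof (rule borel_measurableI_less)
  fix y :: ereal
  show "{x \<in> space M. \<tau> x < y} \<in> events"
  proof (cases y)
    case (real r) then show ?thesis using tau_less_event by simp
  next
    case PInf
    have "{x \<in> space M. \<tau> x < \<infinity>} = (\<Union>n::nat. {x \<in> space M. \<tau> x < ereal (real n)})"
    proof (intro equalityI subsetI)
      fix x assume x: "x \<in> {x \<in> space M. \<tau> x < \<infinity>}"
      with tau_nonneg[of x] obtain c where "\<tau> x = ereal c" by (cases "\<tau> x") auto
      moreover obtain n :: nat where "c < real n" using reals_Archimedean2 by blast
      ultimately show "x \<in> (\<Union>n::nat. {x \<in> space M. \<tau> x < ereal (real n)})" using x by auto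
    next
      fix x assume "x \<in> (\<Union>n::nat. {x \<in> space M. \<tau> x < ereal (real n)})"
      then show "x \<in> {x \<in> space M. \<tau> x < \<infinity>}" by (auto intro: less_trans)
    qed
    then show ?thesis using PInf tau_less_event by auto
  next
    case MInf then show ?thesis by simp
  qed
qed

text \<open>Crossing times accumulate at c from the right or include c, so the path cannot be
  strictly above the boundary at c. Before c there is no crossing, so it cannot be strictly below.
  Both limits use continuity of b at c > 0.\<close>

lemma W_at_tau:
  assumes \<omega>: "\<omega> \<in> space M" and \<tau>: "\<tau> \<omega> = ereal c" "0 < c"
  shows "W c \<omega> = b c"
proof -
  have cont: "isCont (\<lambda>r. W r \<omega> - b r) c"
    using continuous_gap[OF \<omega>] \<tau> by (simp add: continuous_on_eq_continuous_at)
  have "W c \<omega> - b c \<le> 0"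
  proof (rule ccontr)
    assume "\<not> W c \<omega> - b c \<le> 0"
    then have "\<forall>\<^sub>F r in nhds c. W r \<omega> - b r > 0"
      using cont tendsto_at_iff_tendsto_nhds[of "\<lambda>r. W r \<omega> - b r" c]
      by (intro order_tendstoD[of _ "W c \<omega> - b c"]) (auto simp: isCont_def)
    then obtain e where e: "e > 0" "\<And>r. dist r c < e \<Longrightarrow> W r \<omega> - b r > 0"
      unfolding eventually_nhds_metric by blast
    have "\<tau> \<omega> < ereal (c + e)" using \<tau> e by simp
    then obtain r where r: "0 < r" "r < c + e" "W r \<omega> \<le> b r" unfolding tau_less_iff by blast
    have "\<not> r < c"
    proof
      assume "r < c"
      then have "\<tau> \<omega> < ereal c" unfolding tau_less_iff using r by blast
      then show False using \<tau> by simp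
    qed
    then have "dist r c < e" using r by (simp add: dist_real_def)
    then show False using e(2)[of r] r by simp
  qed
  moreover have "0 \<le> W c \<omega> - b c"
  proof (rule tendsto_lowerbound)
    show "((\<lambda>r. W r \<omega> - b r) \<longlongrightarrow> W c \<omega> - b c) (at_left c)"
      using cont by (simp add: isCont_def filterlim_at_split)
    have "\<forall>\<^sub>F r in at_left c. r \<in> {0<..<c}"
      using \<tau>(2) by (intro eventually_at_left_real)
    then show "\<forall>\<^sub>F r in at_left c. 0 \<le> W r \<omega> - b r"
    proof eventually_elim
      case (elim r)
      have "\<not> W r \<omega> \<le> b r"
      proof
        assume "W r \<omega> \<le> b r"
        then have "\<tau> \<omega> < ereal c" unfolding tau_less_iff using elim by auto
        then show False using \<tau> by simp
      qed
      then show ?case by simp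
    qed
  qed simp
  ultimately show ?thesis by simp
qed

text \<open>By continuity the path is already below the boundary shortly before t. The crossing is
  thus strictly before t, as fits an integral over 0 < s < t.\<close>

lemma tau_less_if_below:
  assumes \<omega>: "\<omega> \<in> space M" and t: "0 < t" and below: "W t \<omega> < b t"
  shows "\<tau> \<omega> < ereal t"
proof -
  have "isCont (\<lambda>r. W r \<omega> - b r) t"
    using continuous_gap[OF \<omega>] t by (simp add: continuous_on_eq_continuous_at)
  then have "\<forall>\<^sub>F r in nhds t. W r \<omega> - b r < 0"
    using below tendsto_at_iff_tendsto_nhds[of "\<lambda>r. W r \<omega> - b r" t]
    by (intro order_tendstoD[of _ "W t \<omega> - b t"]) (auto simp: isCont_def)
  then obtain e where e: "e > 0" "\<And>r. dist r t < e \<Longrightarrow> W r \<omega> - b r < 0"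
    unfolding eventually_nhds_metric by blast
  define r where "r = max (t - e / 2) (t / 2)"
  have "0 < r" "r < t" "dist r t < e" using e t by (auto simp: r_def dist_real_def max_def)
  then show ?thesis unfolding tau_less_iff using e(2)[of r] by (intro exI[of _ r]) auto
qed

end

section \<open>The past of a fixed time and its independence from later increments\<close>

text \<open>The start at 0 is required at every sample point, not almost surely: the past is
  generated by increments only, and W is recovered from it pointwise as a telescoping sum.\<close>

locale brownian_passage = brownian_boundary M W b
  for M :: "'a measure" and W :: "real \<Rightarrow> 'a \<Rightarrow> real" and b :: "real \<Rightarrow> real" +
  assumes W_0: "\<And>\<omega>. \<omega> \<in> space M \<Longrightarrow> W 0 \<omega> = 0"
    and regular: "measure M {\<omega> \<in> space M. first_passage_time W b \<omega> = 0} = 0"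
begin

lemma tau_pos_AE: "AE \<omega> in M. 0 < \<tau> \<omega>"
proof -
  have "{\<omega> \<in> space M. \<tau> \<omega> = 0} \<in> null_sets M"
    using regular by (intro null_setsI) (auto simp: emeasure_eq_measure)
  then have "AE \<omega> in M. \<omega> \<notin> {\<omega> \<in> space M. \<tau> \<omega> = 0}" by (rule AE_not_in)
  then show ?thesis
    using AE_space by eventually_elim (use tau_nonneg in \<open>auto simp: less_le\<close>)
qed

text \<open>Dyadic partitions of \<open>{0..s}\<close> are nested, so the events they generate form a \<open>\<pi>\<close>-system.\<close>

definition dyadic_increments :: "real \<Rightarrow> nat \<Rightarrow> 'a \<Rightarrow> nat \<Rightarrow> real" where
  "dyadic_increments s n \<omega> =
    restrict (\<lambda>i. W (s * real (Suc i) / 2 ^ n) \<omega> - W (s * real i / 2 ^ n) \<omega>) {..<2 ^ n}"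

definition dyadic_past :: "real \<Rightarrow> nat \<Rightarrow> 'a measure" where
  "dyadic_past s n = vimage_algebra (space M) (dyadic_increments s n) (PiM {..<2 ^ n} (\<lambda>_. borel))"

lemma space_dyadic_past [simp]: "space (dyadic_past s n) = space M"
  by (simp add: dyadic_past_def)

lemma dyadic_increments_measurable:
  assumes "s \<ge> 0"
  shows "dyadic_increments s n \<in> M \<rightarrow>\<^sub>M PiM {..<2 ^ n} (\<lambda>_. borel)"
  unfolding dyadic_increments_def
proof (rule measurable_restrict)
  fix i
  have [measurable]: "W (s * real (Suc i) / 2 ^ n) \<in> borel_measurable M" "W (s * real i / 2 ^ n) \<in> borel_measurable M"
    using assms by (auto intro!: random_variable_W)
  show "(\<lambda>\<omega>. W (s * real (Suc i) / 2 ^ n) \<omega> - W (s * real i / 2 ^ n) \<omega>) \<in> borel_measurable M"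
    by measurable
qed

lemma dyadic_increments_measurable_past:
  "dyadic_increments s n \<in> dyadic_past s n \<rightarrow>\<^sub>M PiM {..<2 ^ n} (\<lambda>_. borel)"
  unfolding dyadic_past_def
  by (rule measurable_vimage_algebra1) (auto simp: dyadic_increments_def space_PiM)

lemma dyadic_past_subset_events:
  assumes "s \<ge> 0"
  shows "sets (dyadic_past s n) \<subseteq> events"
  unfolding dyadic_past_def
  by (rule sets_image_in_sets[OF refl dyadic_increments_measurable[OF assms]])

lemma dyadic_past_Suc: "sets (dyadic_past s n) \<subseteq> sets (dyadic_past s (Suc n))"
proof -
  have comp: "(\<lambda>\<omega>. dyadic_increments s (Suc n) \<omega> i) \<in> borel_measurable (dyadic_past s (Suc n))" if "i < 2 ^ Suc n" for i
    using measurable_compose[OF dyadic_increments_measurable_past measurable_component_singleton, of i] that by simp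
  have "dyadic_increments s n \<in> dyadic_past s (Suc n) \<rightarrow>\<^sub>M PiM {..<2 ^ n} (\<lambda>_. borel)"
    unfolding dyadic_increments_def[of s n]
  proof (rule measurable_restrict)
    fix i :: nat assume "i \<in> {..<2 ^ n}"
    then have i: "2 * i < 2 ^ Suc n" "2 * i + 1 < 2 ^ Suc n" by auto
    have h: "s * real i / 2 ^ n = s * real (2 * i) / 2 ^ Suc n"
      "s * real (Suc i) / 2 ^ n = s * real (Suc (2 * i + 1)) / 2 ^ Suc n"
      by (simp_all add: field_simps)
    \<comment> \<open>Each coarse increment is the sum of the two fine increments over its
      halves.\<close>
    have "(\<lambda>\<omega>. W (s * real (Suc i) / 2 ^ n) \<omega> - W (s * real i / 2 ^ n) \<omega>)
        = (\<lambda>\<omega>. dyadic_increments s (Suc n) \<omega> (2 * i) + dyadic_increments s (Suc n) \<omega> (2 * i + 1))"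
      using i unfolding h by (simp add: dyadic_increments_def fun_eq_iff)
    then show "(\<lambda>\<omega>. W (s * real (Suc i) / 2 ^ n) \<omega> - W (s * real i / 2 ^ n) \<omega>) \<in> borel_measurable (dyadic_past s (Suc n))"
      using comp[OF i(1)] comp[OF i(2)] by simp
  qed
  then show ?thesis
    unfolding dyadic_past_def[of s n] by (intro sets_image_in_sets) auto
qed

lemma dyadic_past_mono: "m \<le> n \<Longrightarrow> sets (dyadic_past s m) \<subseteq> sets (dyadic_past s n)"
  by (rule lift_Suc_mono_le) (rule dyadic_past_Suc)

lemma dyadic_past_indep:
  assumes s: "0 < s" "s < t" and A: "A \<in> sets (dyadic_past s n)" and B: "B \<in> sets borel"
  shows "prob (A \<inter> ((\<lambda>\<omega>. W t \<omega> - W s \<omega>) -` B \<inter> space M)) =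
    prob A * prob ((\<lambda>\<omega>. W t \<omega> - W s \<omega>) -` B \<inter> space M)"
proof -
  \<comment> \<open>The grid of {0..s} is extended by the single time t. Thus the increment with
    index 2 ^ n is W t - W s, and the 2 ^ n increments before it are those of the past.\<close>
  define r where "r = (\<lambda>i::nat. if i \<le> 2 ^ n then s * real i / 2 ^ n else t)"
  define X where "X = (\<lambda>i \<omega>. W (r (Suc i)) \<omega> - W (r i) \<omega>)"
  have ind: "indep_vars (\<lambda>_. borel) X {..<Suc (2 ^ n)}"
    unfolding X_def
  proof (rule independent_increments)
    show "0 \<le> r 0" by (simp add: r_def)
    fix i :: nat assume i: "i < Suc (2 ^ n)"
    show "r i < r (Suc i)"
    proof (cases "i < 2 ^ n")
      case True then show ?thesis using s by (simp add: r_def divide_strict_right_mono)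
    next
      case False
      then have "i = 2 ^ n" using i by simp
      then show ?thesis using s by (simp add: r_def)
    qed
  qed
  have "indep_var (PiM {..<2 ^ n} (\<lambda>_. borel)) (\<lambda>\<omega>. restrict (\<lambda>i. X i \<omega>) {..<2 ^ n})
      (PiM {2 ^ n} (\<lambda>_. borel)) (\<lambda>\<omega>. restrict (\<lambda>i. X i \<omega>) {2 ^ n})"
    by (rule indep_var_restrict[OF ind]) auto
  moreover have "(\<lambda>\<omega>. restrict (\<lambda>i. X i \<omega>) {..<2 ^ n}) = dyadic_increments s n"
    by (auto simp: fun_eq_iff dyadic_increments_def X_def r_def)
  ultimately have iv0: "indep_var (PiM {..<2 ^ n} (\<lambda>_. borel)) (dyadic_increments s n)
      (PiM {2 ^ n} (\<lambda>_. borel)) (\<lambda>\<omega>. restrict (\<lambda>i. X i \<omega>) {2 ^ n})"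
    by simp
  define S' where "S' = (\<lambda>f. f (2 ^ n)) -` B \<inter> space (PiM {2 ^ n :: nat} (\<lambda>_. borel :: real measure))"
  have S': "S' \<in> sets (PiM {2 ^ n} (\<lambda>_. borel))"
    unfolding S'_def using B by (intro measurable_sets[OF measurable_component_singleton]) auto
  from A obtain S where S: "S \<in> sets (PiM {..<2 ^ n} (\<lambda>_. borel))" "A = dyadic_increments s n -` S \<inter> space M"
    unfolding dyadic_past_def
    by (subst (asm) sets_vimage_algebra2) (auto simp: dyadic_increments_def space_PiM)
  have eq: "(\<lambda>\<omega>. restrict (\<lambda>i. X i \<omega>) {2 ^ n}) -` S' \<inter> space M = (\<lambda>\<omega>. W t \<omega> - W s \<omega>) -` B \<inter> space M"
    by (auto simp: S'_def X_def r_def space_PiM)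
  have "A \<inter> ((\<lambda>\<omega>. W t \<omega> - W s \<omega>) -` B \<inter> space M) =
      (\<lambda>x. (dyadic_increments s n x, restrict (\<lambda>i. X i x) {2 ^ n})) -` (S \<times> S') \<inter> space M"
    unfolding eq[symmetric] S(2) by auto
  then show ?thesis using indep_varD[OF iv0 S(1) S'] unfolding eq S(2) by simp
qed

text \<open>Only dyadic fractions of s enter. They are dense in {0..s}, which suffices to decide by
  continuity whether the boundary is crossed before s.\<close>

definition past :: "real \<Rightarrow> 'a measure" where
  "past s = sigma (space M) (\<Union>n. sets (dyadic_past s n))"

lemma space_past [simp]: "space (past s) = space M"
  by (simp add: past_def space_measure_of_conv)

lemma dyadic_past_space: "(\<Union>n. sets (dyadic_past s n)) \<subseteq> Pow (space M)"
  using sets.sets_into_space by fastforce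

lemma dyadic_past_subset_past: "sets (dyadic_past s n) \<subseteq> sets (past s)"
  unfolding past_def using dyadic_past_space[of s] by auto

lemma past_subset_events:
  assumes "s \<ge> 0"
  shows "sets (past s) \<subseteq> events"
  unfolding past_def using dyadic_past_space[of s] dyadic_past_subset_events[OF assms]
  by (simp add: sets.sigma_sets_subset UN_least)

lemma past_indep:
  assumes s: "0 < s" "s < t"
  shows "indep_set (sets (past s)) (sigma_sets (space M) {(\<lambda>\<omega>. W t \<omega> - W s \<omega>) -` B \<inter> space M |B. B \<in> sets borel})"
proof -
  have [measurable]: "W s \<in> borel_measurable M" "W t \<in> borel_measurable M"
    using s by (auto intro!: random_variable_W)
  have "indep_set (\<Union>n. sets (dyadic_past s n)) {(\<lambda>\<omega>. W t \<omega> - W s \<omega>) -` B \<inter> space M |B. B \<in> sets borel}"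
  proof (rule indep_setI)
    show "(\<Union>n. sets (dyadic_past s n)) \<subseteq> events" using dyadic_past_subset_events s by (intro UN_least) auto
    show "{(\<lambda>\<omega>. W t \<omega> - W s \<omega>) -` B \<inter> space M |B. B \<in> sets borel} \<subseteq> events" by auto
  qed (use dyadic_past_indep[OF s] in auto)
  moreover have "Int_stable (\<Union>n. sets (dyadic_past s n))"
  proof (rule Int_stableI)
    fix A B assume "A \<in> (\<Union>n. sets (dyadic_past s n))" "B \<in> (\<Union>n. sets (dyadic_past s n))"
    then obtain m n where "A \<in> sets (dyadic_past s m)" "B \<in> sets (dyadic_past s n)" by auto
    then have "A \<in> sets (dyadic_past s (max m n))" "B \<in> sets (dyadic_past s (max m n))"
      using dyadic_past_mono[of m "max m n" s] dyadic_past_mono[of n "max m n" s] by auto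
    then show "A \<inter> B \<in> (\<Union>n. sets (dyadic_past s n))" by blast
  qed
  moreover have "Int_stable {(\<lambda>\<omega>. W t \<omega> - W s \<omega>) -` B \<inter> space M |B. B \<in> sets borel}"
  proof (rule Int_stableI)
    fix A B assume "A \<in> {(\<lambda>\<omega>. W t \<omega> - W s \<omega>) -` B \<inter> space M |B. B \<in> sets borel}"
      "B \<in> {(\<lambda>\<omega>. W t \<omega> - W s \<omega>) -` B \<inter> space M |B. B \<in> sets borel}"
    then obtain A' B' where *: "A' \<in> sets borel" "B' \<in> sets borel"
      "A = (\<lambda>\<omega>. W t \<omega> - W s \<omega>) -` A' \<inter> space M" "B = (\<lambda>\<omega>. W t \<omega> - W s \<omega>) -` B' \<inter> space M" by blast
    then have "A \<inter> B = (\<lambda>\<omega>. W t \<omega> - W s \<omega>) -` (A' \<inter> B') \<inter> space M" by auto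
    then show "A \<inter> B \<in> {(\<lambda>\<omega>. W t \<omega> - W s \<omega>) -` B \<inter> space M |B. B \<in> sets borel}" using * by blast
  qed
  ultimately have "indep_set (sigma_sets (space M) (\<Union>n. sets (dyadic_past s n)))
     (sigma_sets (space M) {(\<lambda>\<omega>. W t \<omega> - W s \<omega>) -` B \<inter> space M |B. B \<in> sets borel})"
    by (rule indep_set_sigma_sets)
  then show ?thesis
    unfolding past_def using dyadic_past_space[of s] by simp
qed

lemma W_dyadic_past_measurable:
  assumes "i \<le> 2 ^ n"
  shows "W (s * real i / 2 ^ n) \<in> borel_measurable (past s)"
proof -
  have comp: "(\<lambda>\<omega>. dyadic_increments s n \<omega> j) \<in> borel_measurable (dyadic_past s n)" if "j < 2 ^ n" for j
    using measurable_compose[OF dyadic_increments_measurable_past measurable_component_singleton, of j] that by simp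
  have "(\<lambda>\<omega>. \<Sum>j<i. dyadic_increments s n \<omega> j) \<in> borel_measurable (dyadic_past s n)"
    using assms by (intro borel_measurable_sum comp) auto
  moreover have "(\<Sum>j<i. dyadic_increments s n \<omega> j) = W (s * real i / 2 ^ n) \<omega>" if "\<omega> \<in> space M" for \<omega>
  proof -
    have "(\<Sum>j<i. dyadic_increments s n \<omega> j) = (\<Sum>j<i. W (s * real (Suc j) / 2 ^ n) \<omega> - W (s * real j / 2 ^ n) \<omega>)"
      using assms by (intro sum.cong) (auto simp: dyadic_increments_def)
    also have "\<dots> = W (s * real i / 2 ^ n) \<omega> - W (s * real 0 / 2 ^ n) \<omega>"
      by (rule sum_lessThan_telescope)
    finally show ?thesis using W_0[OF that] by simp
  qed
  ultimately have "W (s * real i / 2 ^ n) \<in> borel_measurable (dyadic_past s n)"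
    by (subst (asm) measurable_cong) auto
  then show ?thesis
    using dyadic_past_subset_past[of s n] by (auto simp: measurable_def)
qed

lemma tau_less_past:
  assumes "0 < s" "a \<le> s"
  shows "{\<omega> \<in> space M. \<tau> \<omega> < ereal a} \<in> sets (past s)"
proof (rule tau_less_in_sets)
  let ?D = "(\<lambda>(n, i). s * real i / 2 ^ n) ` {(n, i). i \<le> 2 ^ n}"
  show "countable ?D" by auto
  show "\<And>d. d \<in> ?D \<Longrightarrow> W d \<in> borel_measurable (past s)"
    using W_dyadic_past_measurable by auto
  fix x y :: real assume "0 < x" "x < y" "y < a"
  then have "0 \<le> x" "x < y" "y < s" using assms by auto
  from dyadic_between[OF \<open>0 < s\<close> this]
  obtain n i where "i \<le> 2 ^ n" "x < s * real i / 2 ^ n" "s * real i / 2 ^ n < y" .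
  then show "\<exists>d\<in>?D. x < d \<and> d < y" by (intro bexI[of _ "s * real i / 2 ^ n"]) auto
qed simp

lemma expectation_iexp_increment:
  assumes "0 \<le> s" "s < t"
  shows "(CLINT \<omega>|M. iexp (\<theta> * (W t \<omega> - W s \<omega>))) = of_real (exp (- \<theta>\<^sup>2 * (t - s) / 2))"
proof -
  define \<sigma> where "\<sigma> = sqrt (t - s)"
  have \<sigma>: "\<sigma> > 0" "\<sigma>\<^sup>2 = t - s" using assms by (auto simp: \<sigma>_def)
  have [measurable]: "W s \<in> borel_measurable M" "W t \<in> borel_measurable M"
    using assms by (auto intro!: random_variable_W)
  define Z where "Z = (\<lambda>\<omega>. (W t \<omega> - W s \<omega> - 0) / \<sigma>)"
  have [measurable]: "Z \<in> borel_measurable M" unfolding Z_def by measurable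
  have "distributed M lborel Z std_normal_density"
    unfolding Z_def
    using normal_increments[OF assms] normal_standard_normal_convert[OF \<sigma>(1), of "\<lambda>\<omega>. W t \<omega> - W s \<omega>" 0] by (simp add: \<sigma>_def)
  then have "distr M lborel Z = std_normal_distribution" by (rule distributed_distr_eq_density)
  moreover have "distr M lborel Z = distr M borel Z" by (rule distr_cong) auto
  ultimately have D: "distr M borel Z = std_normal_distribution" by simp
  have "of_real (exp (- (\<theta> * \<sigma>)\<^sup>2 / 2)) = char std_normal_distribution (\<theta> * \<sigma>)"
    by (simp add: char_std_normal_distribution)
  also have "\<dots> = (CLINT \<omega>|M. iexp (\<theta> * \<sigma> * Z \<omega>))"
    unfolding char_def D[symmetric] by (subst integral_distr) auto
  also have "(\<lambda>\<omega>. iexp (\<theta> * \<sigma> * Z \<omega>)) = (\<lambda>\<omega>. iexp (\<theta> * (W t \<omega> - W s \<omega>)))"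
    using \<sigma> by (auto simp: fun_eq_iff Z_def)
  finally show ?thesis using \<sigma>(2) by (simp add: power_mult_distrib)
qed

text \<open>To be applied with X the indicator of a grid cell containing \<tau>, times the
  exponential of W at the right end s of that cell.\<close>

lemma expectation_past_iexp:
  fixes X :: "'a \<Rightarrow> complex"
  assumes s: "0 < s" "s < t" and X: "X \<in> borel_measurable (past s)" and bound: "\<And>\<omega>. norm (X \<omega>) \<le> 1"
  shows "(CLINT \<omega>|M. X \<omega> * iexp (\<theta> * (W t \<omega> - W s \<omega>))) =
    (CLINT \<omega>|M. X \<omega>) * of_real (exp (- \<theta>\<^sup>2 * (t - s) / 2))"
proof -
  have [measurable]: "W s \<in> borel_measurable M" "W t \<in> borel_measurable M"
    using s by (auto intro!: random_variable_W)
  have XM[measurable]: "X \<in> borel_measurable M"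
    using X past_subset_events[of s] s by (auto simp: measurable_def)
  have "indep_var borel X borel (\<lambda>\<omega>. iexp (\<theta> * (W t \<omega> - W s \<omega>)))"
    unfolding indep_var_eq
  proof (intro conjI)
    show "indep_set (sigma_sets (space M) {X -` A \<inter> space M |A. A \<in> sets borel})
      (sigma_sets (space M) {(\<lambda>\<omega>. iexp (\<theta> * (W t \<omega> - W s \<omega>))) -` A \<inter> space M |A. A \<in> sets borel})"
      using past_indep[OF s] unfolding indep_set_def
    proof (rule indep_sets_mono_sets)
      have 1: "sigma_sets (space M) {X -` A \<inter> space M |A. A \<in> sets borel} \<subseteq> sets (past s)"
      proof -
        have "{X -` A \<inter> space M |A. A \<in> sets borel} \<subseteq> sets (past s)"
          using measurable_sets[OF X] by auto
        then show ?thesis using sets.sigma_sets_subset[of _ "past s"] by simp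
      qed
      have 2: "{(\<lambda>\<omega>. iexp (\<theta> * (W t \<omega> - W s \<omega>))) -` A \<inter> space M |A. A \<in> sets borel}
        \<subseteq> {(\<lambda>\<omega>. W t \<omega> - W s \<omega>) -` B \<inter> space M |B. B \<in> sets borel}"
      proof safe
        fix A :: "complex set" assume A: "A \<in> sets borel"
        have "(\<lambda>y. iexp (\<theta> * y)) \<in> borel_measurable borel" by measurable
        from measurable_sets[OF this A] have "(\<lambda>y. iexp (\<theta> * y)) -` A \<in> sets borel" by simp
        then show "\<exists>B. (\<lambda>\<omega>. iexp (\<theta> * (W t \<omega> - W s \<omega>))) -` A \<inter> space M = (\<lambda>\<omega>. W t \<omega> - W s \<omega>) -` B \<inter> space M \<and> B \<in> sets borel"
          by (intro exI[of _ "(\<lambda>y. iexp (\<theta> * y)) -` A"]) auto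
      qed
      fix i :: bool
      show "(case i of True \<Rightarrow> sigma_sets (space M) {X -` A \<inter> space M |A. A \<in> sets borel}
          | False \<Rightarrow> sigma_sets (space M) {(\<lambda>\<omega>. iexp (\<theta> * (W t \<omega> - W s \<omega>))) -` A \<inter> space M |A. A \<in> sets borel})
        \<subseteq> (case i of True \<Rightarrow> sets (past s)
          | False \<Rightarrow> sigma_sets (space M) {(\<lambda>\<omega>. W t \<omega> - W s \<omega>) -` B \<inter> space M |B. B \<in> sets borel})"
        using 1 sigma_sets_mono'[OF 2] by (cases i) auto
    qed
  qed measurable
  moreover have "integrable M X"
    by (rule integrable_const_bound[of _ 1]) (use bound in auto)
  moreover have "integrable M (\<lambda>\<omega>. iexp (\<theta> * (W t \<omega> - W s \<omega>)))"
    by (rule integrable_const_bound[of _ 1]) auto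
  ultimately show ?thesis
    using indep_var_lebesgue_integral expectation_iexp_increment[of s t \<theta>] s by fastforce
qed

section \<open>The strong Markov property at the passage time\<close>

abbreviation "T \<omega> \<equiv> real_of_ereal (\<tau> \<omega>)"

text \<open>Nothing is known about \<open>b\<close> on the nonpositive reals, not even measurability.\<close>

definition boundary :: "real \<Rightarrow> real" where
  "boundary s = (if s \<in> {0<..} then b s else 0)"

lemma boundary_measurable [measurable]: "boundary \<in> borel_measurable borel"
  unfolding boundary_def by (rule borel_measurable_continuous_on_if) (auto intro: continuous_b)

text \<open>\<tau> is rounded up, since the event that it falls in a half-open cell is known only at
  the right end of that cell. From there W t is reached by an independent increment. The mesh is t /
  (n + 1) but only n cells are summed, so every right end is strictly before t; the omitted last
  cell disappears in the limit.\<close>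

lemma discretised_strong_markov:
  fixes n :: nat
  assumes t: "0 < t"
  defines "s \<equiv> \<lambda>k::nat. t * real k / real (Suc n)"
  defines "e \<equiv> \<lambda>k \<omega>. complex_of_real (of_bool (ereal (s k) \<le> \<tau> \<omega> \<and> \<tau> \<omega> < ereal (s (Suc k))))"
  shows "(CLINT \<omega>|M. \<Sum>k<n. e k \<omega> * iexp (\<theta> * W t \<omega>)) =
    (CLINT \<omega>|M. \<Sum>k<n. e k \<omega> * (iexp (\<theta> * W (s (Suc k)) \<omega>) * of_real (exp (- \<theta>\<^sup>2 * (t - s (Suc k)) / 2))))"
proof -
  have Wm[measurable]: "W r \<in> borel_measurable M" if "r \<ge> 0" for r using that by (rule random_variable_W)
  have s0: "0 \<le> s k" for k using t by (simp add: s_def)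
  have [measurable]: "W t \<in> borel_measurable M" "\<And>k. W (s k) \<in> borel_measurable M" using t s0 by (auto intro: Wm)
  have [measurable]: "e k \<in> borel_measurable M" for k unfolding e_def by measurable
  have e1: "norm (e k \<omega>) \<le> 1" for k \<omega> by (auto simp: e_def)
  have I1: "integrable M (\<lambda>\<omega>. e k \<omega> * iexp (\<theta> * W t \<omega>))" for k
    by (rule integrable_const_bound[of _ 1]) (use e1 in \<open>auto simp: norm_mult\<close>)
  have I2: "integrable M (\<lambda>\<omega>. e k \<omega> * iexp (\<theta> * W (s (Suc k)) \<omega>))" for k
    by (rule integrable_const_bound[of _ 1]) (use e1 in \<open>auto simp: norm_mult\<close>)
  have I3: "integrable M (\<lambda>\<omega>. e k \<omega> * (iexp (\<theta> * W (s (Suc k)) \<omega>) * of_real (exp (- \<theta>\<^sup>2 * (t - s (Suc k)) / 2))))" for k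
    unfolding mult.assoc[symmetric] by (intro integrable_mult_left I2)
  have step: "(CLINT \<omega>|M. e k \<omega> * iexp (\<theta> * W t \<omega>)) =
      (CLINT \<omega>|M. e k \<omega> * (iexp (\<theta> * W (s (Suc k)) \<omega>) * of_real (exp (- \<theta>\<^sup>2 * (t - s (Suc k)) / 2))))"
    if k: "k < n" for k
  proof -
    have "0 < s (Suc k)" unfolding s_def using t by (intro divide_pos_pos mult_pos_pos) auto
    moreover have "s (Suc k) < t" "s k \<le> s (Suc k)" using t k by (auto simp: s_def field_simps)
    ultimately have sk: "0 < s (Suc k)" "s (Suc k) < t" "s k \<le> s (Suc k)" by simp_all
    let ?X = "\<lambda>\<omega>. e k \<omega> * iexp (\<theta> * W (s (Suc k)) \<omega>)"
    have "?X \<in> borel_measurable (past (s (Suc k)))"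
    proof -
      have [measurable]: "W (s (Suc k)) \<in> borel_measurable (past (s (Suc k)))"
        using W_dyadic_past_measurable[of 1 0 "s (Suc k)"] by simp
      have "{\<omega> \<in> space M. ereal (s k) \<le> \<tau> \<omega> \<and> \<tau> \<omega> < ereal (s (Suc k))} =
          {\<omega> \<in> space M. \<tau> \<omega> < ereal (s (Suc k))} - {\<omega> \<in> space M. \<tau> \<omega> < ereal (s k)}" by auto
      also have "\<dots> \<in> sets (past (s (Suc k)))"
        using sk by (intro sets.Diff tau_less_past) auto
      finally have [measurable]: "Measurable.pred (past (s (Suc k))) (\<lambda>\<omega>. ereal (s k) \<le> \<tau> \<omega> \<and> \<tau> \<omega> < ereal (s (Suc k)))"
        by (simp add: pred_def)
      show ?thesis unfolding e_def by measurable
    qed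
    from expectation_past_iexp[OF sk(1,2) this, of \<theta>]
    have "(CLINT \<omega>|M. ?X \<omega> * iexp (\<theta> * (W t \<omega> - W (s (Suc k)) \<omega>))) =
        (CLINT \<omega>|M. ?X \<omega>) * of_real (exp (- \<theta>\<^sup>2 * (t - s (Suc k)) / 2))"
      using e1 by (simp add: norm_mult)
    moreover have "(\<lambda>\<omega>. ?X \<omega> * iexp (\<theta> * (W t \<omega> - W (s (Suc k)) \<omega>))) = (\<lambda>\<omega>. e k \<omega> * iexp (\<theta> * W t \<omega>))"
    proof
      fix \<omega>
      have "iexp (\<theta> * W (s (Suc k)) \<omega>) * iexp (\<theta> * (W t \<omega> - W (s (Suc k)) \<omega>)) = iexp (\<theta> * W t \<omega>)"
        unfolding exp_add[symmetric] by (simp add: algebra_simps)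
      then show "?X \<omega> * iexp (\<theta> * (W t \<omega> - W (s (Suc k)) \<omega>)) = e k \<omega> * iexp (\<theta> * W t \<omega>)"
        by (simp only: mult.assoc)
    qed
    moreover have "(CLINT \<omega>|M. ?X \<omega>) * of_real (exp (- \<theta>\<^sup>2 * (t - s (Suc k)) / 2)) =
        (CLINT \<omega>|M. e k \<omega> * (iexp (\<theta> * W (s (Suc k)) \<omega>) * of_real (exp (- \<theta>\<^sup>2 * (t - s (Suc k)) / 2))))"
      unfolding mult.assoc[symmetric] by (rule integral_mult_left_zero[symmetric])
    ultimately show ?thesis by (simp only:)
  qed
  show ?thesis
    unfolding Bochner_Integration.integral_sum[OF I1] Bochner_Integration.integral_sum[OF I3]
    by (intro sum.cong refl step) simp
qed

text \<open>The cells are disjoint, so the sum keeps at most one summand, whose index is the floor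
  of c (n + 1) / t. This gives bounds and pointwise limits without estimating sums.\<close>

lemma grid_sum_eq:
  fixes v :: "nat \<Rightarrow> complex" and n :: nat and \<omega> :: 'a
  assumes t: "0 < t"
  defines "s \<equiv> \<lambda>k::nat. t * real k / real (Suc n)"
  defines "S \<equiv> (\<Sum>k<n. complex_of_real (of_bool (ereal (s k) \<le> \<tau> \<omega> \<and> \<tau> \<omega> < ereal (s (Suc k)))) * v k)"
  shows "\<not> \<tau> \<omega> < ereal (s n) \<Longrightarrow> S = 0"
    and "\<tau> \<omega> = ereal c \<Longrightarrow> c < s n \<Longrightarrow> S = v (nat \<lfloor>c * real (Suc n) / t\<rfloor>)"
proof -
  have mono: "s i \<le> s j" if "i \<le> j" for i j
    using t that by (simp add: s_def divide_right_mono)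
  show "S = 0" if "\<not> \<tau> \<omega> < ereal (s n)"
  proof -
    have "\<not> \<tau> \<omega> < ereal (s (Suc k))" if "k < n" for k
      using mono[of "Suc k" n] that \<open>\<not> \<tau> \<omega> < ereal (s n)\<close> by (auto intro: less_le_trans)
    then show ?thesis unfolding S_def by (intro sum.neutral) auto
  qed
  assume c: "\<tau> \<omega> = ereal c" "c < s n"
  have c0: "0 \<le> c" using tau_nonneg[of \<omega>] c by simp
  define j where "j = nat \<lfloor>c * real (Suc n) / t\<rfloor>"
  have nn: "0 \<le> c * real (Suc n) / t" using c0 t by simp
  have iff: "s k \<le> c \<and> c < s (Suc k) \<longleftrightarrow> k = j" for k
  proof -
    have "s k \<le> c \<and> c < s (Suc k) \<longleftrightarrow> real k \<le> c * real (Suc n) / t \<and> c * real (Suc n) / t < real k + 1"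
      unfolding s_def using t by (simp add: field_simps)
    also have "\<dots> \<longleftrightarrow> \<lfloor>c * real (Suc n) / t\<rfloor> = int k"
      by (simp add: floor_eq_iff)
    also have "\<dots> \<longleftrightarrow> k = j" using nn by (auto simp: j_def)
    finally show ?thesis .
  qed
  have "j < n"
  proof (rule ccontr)
    assume "\<not> j < n"
    then have "s n \<le> s j" by (intro mono) simp
    moreover have "s j \<le> c" using iff[of j] by simp
    ultimately show False using c by simp
  qed
  have "S = (\<Sum>k<n. if k = j then v k else 0)"
    unfolding S_def c(1) using iff by (intro sum.cong) auto
  also have "\<dots> = v j" using \<open>j < n\<close> by simp
  finally show "S = v (nat \<lfloor>c * real (Suc n) / t\<rfloor>)" by (simp add: j_def)
qed

text \<open>Limit of the discretised identity as the mesh shrinks. The right ends decrease towards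
  \<tau>, path continuity carries W at the right end to W at \<tau>, and there W equals the
  boundary.\<close>

lemma strong_markov_char:
  assumes t: "0 < t"
  shows "(CLINT \<omega>|M. if \<tau> \<omega> < ereal t then iexp (\<theta> * W t \<omega>) else 0) =
    (CLINT \<omega>|M. if \<tau> \<omega> < ereal t then iexp (\<theta> * boundary (T \<omega>)) * of_real (exp (- \<theta>\<^sup>2 * (t - T \<omega>) / 2)) else 0)"
proof -
  define s where "s = (\<lambda>(n::nat) (k::nat). t * real k / real (Suc n))"
  define e where "e = (\<lambda>n k \<omega>. complex_of_real (of_bool (ereal (s n k) \<le> \<tau> \<omega> \<and> \<tau> \<omega> < ereal (s n (Suc k)))))"
  define h where "h = (\<lambda>\<omega> r. iexp (\<theta> * W r \<omega>) * complex_of_real (exp (- \<theta>\<^sup>2 * (t - r) / 2)))"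
  define f where "f = (\<lambda>n \<omega>. \<Sum>k<n. e n k \<omega> * h \<omega> (s n (Suc k)))"
  define g where "g = (\<lambda>n \<omega>. \<Sum>k<n. e n k \<omega> * iexp (\<theta> * W t \<omega>))"
  have Wm[measurable]: "W r \<in> borel_measurable M" if "r \<ge> 0" for r using that by (rule random_variable_W)
  have s0: "0 \<le> s n k" for n k using t by (simp add: s_def)
  have [measurable]: "W t \<in> borel_measurable M" "\<And>n k. W (s n k) \<in> borel_measurable M" using t s0 by (auto intro: Wm)
  have [measurable]: "e n k \<in> borel_measurable M" for n k unfolding e_def by measurable
  have f_meas: "f n \<in> borel_measurable M" for n unfolding f_def h_def by measurable
  have g_meas: "g n \<in> borel_measurable M" for n unfolding g_def by measurable
  have sn: "s n n < t" for n using t by (simp add: s_def field_simps)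
  have zero: "(\<Sum>k<n. e n k \<omega> * v k) = 0" if "\<not> \<tau> \<omega> < ereal (s n n)" for n v \<omega>
    using that unfolding e_def s_def by (rule grid_sum_eq(1)[OF t])
  define j where "j = (\<lambda>n c. nat \<lfloor>c * real (Suc n) / t\<rfloor>)"
  have one: "(\<Sum>k<n. e n k \<omega> * v k) = v (j n c)" if "\<tau> \<omega> = ereal c" "c < s n n" for n v \<omega> c
    using that unfolding e_def s_def j_def by (rule grid_sum_eq(2)[OF t])
  have cases: "(\<not> \<tau> \<omega> < ereal (s n n)) \<or> (\<exists>c. \<tau> \<omega> = ereal c \<and> c < s n n)" for n \<omega>
    using tau_nonneg[of \<omega>] by (cases "\<tau> \<omega>") auto
  \<comment> \<open>The right end stays at most t, which makes the exponent in h nonpositive and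
    gives the dominating constant 1.\<close>
  have jt: "s n (Suc (j n c)) \<le> t" if "0 \<le> c" "c < s n n" for n c
  proof -
    have "c * real (Suc n) / t < real n" using that t by (simp add: s_def field_simps)
    then have "\<lfloor>c * real (Suc n) / t\<rfloor> < int n" by (simp add: floor_less_iff)
    moreover have "0 \<le> \<lfloor>c * real (Suc n) / t\<rfloor>" using that t by simp
    ultimately have "j n c < n" unfolding j_def by linarith
    then have "real (Suc (j n c)) \<le> real (Suc n)" by simp
    then have "t * real (Suc (j n c)) / real (Suc n) \<le> t * real (Suc n) / real (Suc n)"
      using t by (intro divide_right_mono mult_left_mono) auto
    then show ?thesis by (simp add: s_def)
  qed
  have norm_h: "norm (h \<omega> r) \<le> 1" if "r \<le> t" for \<omega> r
    using that by (simp add: h_def norm_mult)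
  have f_bound: "norm (f n \<omega>) \<le> 1" for n \<omega>
    using cases[of \<omega> n]
  proof
    assume "\<not> \<tau> \<omega> < ereal (s n n)"
    then show ?thesis unfolding f_def by (subst zero) auto
  next
    assume "\<exists>c. \<tau> \<omega> = ereal c \<and> c < s n n"
    then obtain c where c: "\<tau> \<omega> = ereal c" "c < s n n" by blast
    then have "0 \<le> c" using tau_nonneg[of \<omega>] by simp
    have "f n \<omega> = h \<omega> (s n (Suc (j n c)))"
      unfolding f_def by (rule one[OF c])
    then show ?thesis using norm_h jt[OF \<open>0 \<le> c\<close> c(2)] by simp
  qed
  have g_bound: "norm (g n \<omega>) \<le> 1" for n \<omega>
    using cases[of \<omega> n]
  proof
    assume "\<not> \<tau> \<omega> < ereal (s n n)"
    then show ?thesis unfolding g_def by (subst zero) auto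
  next
    assume "\<exists>c. \<tau> \<omega> = ereal c \<and> c < s n n"
    then obtain c where c: "\<tau> \<omega> = ereal c" "c < s n n" by blast
    have "g n \<omega> = iexp (\<theta> * W t \<omega>)"
      unfolding g_def by (rule one[OF c])
    then show ?thesis by simp
  qed
  have ev: "\<forall>\<^sub>F n in sequentially. c < s n n" if "c < t" for c
  proof -
    have "(\<lambda>n. t * (real n / real (Suc n))) \<longlonglongrightarrow> t * 1"
      by (intro tendsto_mult tendsto_const LIMSEQ_n_over_Suc_n)
    then have "(\<lambda>n. s n n) \<longlonglongrightarrow> t" by (simp add: s_def)
    then show ?thesis using that by (rule order_tendstoD)
  qed
  have f_lim: "(\<lambda>n. f n \<omega>) \<longlonglongrightarrow> (if \<tau> \<omega> < ereal t then h \<omega> (T \<omega>) else 0)"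
    if \<omega>: "\<omega> \<in> space M" "0 < \<tau> \<omega>" for \<omega>
  proof (cases "\<tau> \<omega> < ereal t")
    case False
    then have "\<not> \<tau> \<omega> < ereal (s n n)" for n using sn[of n] by (auto intro: less_trans)
    then have "f n \<omega> = 0" for n unfolding f_def by (rule zero)
    then show ?thesis using False by simp
  next
    case True
    then obtain c where c: "\<tau> \<omega> = ereal c" "0 < c" "c < t" using \<omega> by (cases "\<tau> \<omega>") auto
    have "(\<lambda>n. s n (Suc (j n c))) \<longlonglongrightarrow> c"
    proof (rule tendsto_sandwich)
      have b1: "c * real (Suc n) / t < real (Suc (j n c))" "real (Suc (j n c)) \<le> c * real (Suc n) / t + 1" for n
      proof -
        have "real (Suc (j n c)) = of_int \<lfloor>c * real (Suc n) / t\<rfloor> + 1"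
          using c t by (simp add: j_def)
        then show "c * real (Suc n) / t < real (Suc (j n c))" "real (Suc (j n c)) \<le> c * real (Suc n) / t + 1" by linarith+
      qed
      show "\<forall>\<^sub>F n in sequentially. c \<le> s n (Suc (j n c))"
      proof (intro always_eventually allI)
        fix n
        show "c \<le> s n (Suc (j n c))"
          using b1(1)[of n] t by (simp add: s_def field_simps)
      qed
      show "\<forall>\<^sub>F n in sequentially. s n (Suc (j n c)) \<le> c + t / real (Suc n)"
      proof (intro always_eventually allI)
        fix n
        have "s n (Suc (j n c)) \<le> t * (c * real (Suc n) / t + 1) / real (Suc n)"
          unfolding s_def using b1(2)[of n] t by (intro divide_right_mono mult_left_mono) auto
        also have "t * (c * real (Suc n) / t + 1) / real (Suc n) = c + t / real (Suc n)"
          using t by (simp add: distrib_left add_divide_distrib del: of_nat_Suc)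
        finally show "s n (Suc (j n c)) \<le> c + t / real (Suc n)" .
      qed
      have "(\<lambda>n. c + t * inverse (real (Suc n))) \<longlonglongrightarrow> c + t * 0"
        by (intro tendsto_intros LIMSEQ_inverse_real_of_nat)
      then show "(\<lambda>n. c + t / real (Suc n)) \<longlonglongrightarrow> c" by (simp add: divide_inverse)
    qed simp
    moreover have "isCont (h \<omega>) c"
    proof -
      have "isCont (\<lambda>r. W r \<omega>) c"
      proof (rule continuous_on_interior[OF continuous_paths[OF \<omega>(1)]])
        show "c \<in> interior {0..}" using c by simp
      qed
      then show ?thesis unfolding h_def by (intro continuous_intros) auto
    qed
    ultimately have "(\<lambda>n. h \<omega> (s n (Suc (j n c)))) \<longlonglongrightarrow> h \<omega> c"
      by (rule isCont_tendsto_compose[rotated])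
    moreover have "\<forall>\<^sub>F n in sequentially. h \<omega> (s n (Suc (j n c))) = f n \<omega>"
      using ev[OF c(3)]
    proof eventually_elim
      case (elim n)
      show ?case unfolding f_def by (rule one[OF c(1) elim, symmetric])
    qed
    ultimately have "(\<lambda>n. f n \<omega>) \<longlonglongrightarrow> h \<omega> c" by (rule Lim_transform_eventually)
    then show ?thesis using c True by simp
  qed
  have g_lim: "(\<lambda>n. g n \<omega>) \<longlonglongrightarrow> (if \<tau> \<omega> < ereal t then iexp (\<theta> * W t \<omega>) else 0)" for \<omega>
  proof (cases "\<tau> \<omega> < ereal t")
    case False
    then have "\<not> \<tau> \<omega> < ereal (s n n)" for n using sn[of n] by (auto intro: less_trans)
    then have "g n \<omega> = 0" for n unfolding g_def by (rule zero)
    then show ?thesis using False by simp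
  next
    case True
    then obtain c where c: "\<tau> \<omega> = ereal c" "c < t" using tau_nonneg[of \<omega>] by (cases "\<tau> \<omega>") auto
    have "\<forall>\<^sub>F n in sequentially. iexp (\<theta> * W t \<omega>) = g n \<omega>"
      using ev[OF c(2)]
    proof eventually_elim
      case (elim n)
      show ?case unfolding g_def by (rule one[OF c(1) elim, symmetric])
    qed
    then have "(\<lambda>n. g n \<omega>) \<longlonglongrightarrow> iexp (\<theta> * W t \<omega>)"
      by (rule Lim_transform_eventually[OF tendsto_const])
    then show ?thesis using True by simp
  qed
  have eq: "(CLINT \<omega>|M. g n \<omega>) = (CLINT \<omega>|M. f n \<omega>)" for n
    using discretised_strong_markov[OF t, of n \<theta>] unfolding f_def g_def h_def e_def s_def .
  let ?G = "\<lambda>\<omega>. if \<tau> \<omega> < ereal t then iexp (\<theta> * W t \<omega>) else 0"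
  \<comment> \<open>\<open>h \<omega> (T \<omega>)\<close> evaluates a path at a random time; its
    measurability is obtained from that of the approximations f n. The cut-off at 0 < \<tau> is
    present because their convergence is established only there, and it alters nothing outside a
    null set.\<close>
  let ?F = "\<lambda>\<omega>. if 0 < \<tau> \<omega> then if \<tau> \<omega> < ereal t then h \<omega> (T \<omega>) else 0 else 0"
  have lim1: "(\<lambda>n. CLINT \<omega>|M. g n \<omega>) \<longlonglongrightarrow> (CLINT \<omega>|M. ?G \<omega>)"
  proof (rule integral_dominated_convergence[where w = "\<lambda>_. 1"])
    show "?G \<in> borel_measurable M" by measurable
  qed (use g_lim g_bound g_meas in auto)
  have lim2: "(\<lambda>n. CLINT \<omega>|M. if 0 < \<tau> \<omega> then f n \<omega> else 0) \<longlonglongrightarrow> (CLINT \<omega>|M. ?F \<omega>)"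
  proof (rule integral_dominated_convergence[where w = "\<lambda>_. 1"])
    have m: "(\<lambda>\<omega>. if 0 < \<tau> \<omega> then f n \<omega> else 0) \<in> borel_measurable M" for n
      using f_meas[of n] by measurable
    then show "(\<lambda>\<omega>. if 0 < \<tau> \<omega> then f n \<omega> else 0) \<in> borel_measurable M" for n .
    have l: "(\<lambda>n. if 0 < \<tau> \<omega> then f n \<omega> else 0) \<longlonglongrightarrow> ?F \<omega>" if "\<omega> \<in> space M" for \<omega>
      using f_lim[OF that] by auto
    then show "AE \<omega> in M. (\<lambda>n. if 0 < \<tau> \<omega> then f n \<omega> else 0) \<longlonglongrightarrow> ?F \<omega>" by simp
    show "?F \<in> borel_measurable M" by (rule borel_measurable_LIMSEQ_metric[OF m l])
    show "AE \<omega> in M. norm (if 0 < \<tau> \<omega> then f n \<omega> else 0) \<le> 1" for n using f_bound by simp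
  qed simp
  have eq2: "(CLINT \<omega>|M. if 0 < \<tau> \<omega> then f n \<omega> else 0) = (CLINT \<omega>|M. f n \<omega>)" for n
  proof (rule integral_cong_AE)
    show "(\<lambda>\<omega>. if 0 < \<tau> \<omega> then f n \<omega> else 0) \<in> borel_measurable M" using f_meas[of n] by measurable
    show "f n \<in> borel_measurable M" by (rule f_meas)
    show "AE \<omega> in M. (if 0 < \<tau> \<omega> then f n \<omega> else 0) = f n \<omega>"
      using tau_pos_AE by eventually_elim simp
  qed
  have "(CLINT \<omega>|M. ?G \<omega>) = (CLINT \<omega>|M. ?F \<omega>)"
    using lim1 lim2 unfolding eq2 eq by (rule LIMSEQ_unique)
  also have "\<dots> = (CLINT \<omega>|M. if \<tau> \<omega> < ereal t then iexp (\<theta> * boundary (T \<omega>)) * of_real (exp (- \<theta>\<^sup>2 * (t - T \<omega>) / 2)) else 0)"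
  proof (rule integral_cong_AE)
    have m: "(\<lambda>\<omega>. if 0 < \<tau> \<omega> then f n \<omega> else 0) \<in> borel_measurable M" for n
      using f_meas[of n] by measurable
    have l: "(\<lambda>n. if 0 < \<tau> \<omega> then f n \<omega> else 0) \<longlonglongrightarrow> ?F \<omega>" if "\<omega> \<in> space M" for \<omega>
      using f_lim[OF that] by auto
    show "?F \<in> borel_measurable M" by (rule borel_measurable_LIMSEQ_metric[OF m l])
    show "(\<lambda>\<omega>. if \<tau> \<omega> < ereal t then iexp (\<theta> * boundary (T \<omega>)) * of_real (exp (- \<theta>\<^sup>2 * (t - T \<omega>) / 2)) else 0)
      \<in> borel_measurable M" by measurable
    show "AE \<omega> in M. ?F \<omega> = (if \<tau> \<omega> < ereal t then iexp (\<theta> * boundary (T \<omega>)) * of_real (exp (- \<theta>\<^sup>2 * (t - T \<omega>) / 2)) else 0)"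
      using tau_pos_AE AE_space
    proof eventually_elim
      case (elim \<omega>)
      show ?case
      proof (cases "\<tau> \<omega> < ereal t")
        case True
        then obtain c where c: "\<tau> \<omega> = ereal c" "0 < c" using elim by (cases "\<tau> \<omega>") auto
        have "W c \<omega> = b c" using W_at_tau elim c by blast
        then show ?thesis using c by (simp add: h_def boundary_def)
      qed simp
    qed
  qed
  finally show ?thesis .
qed

text \<open>
  The value \<open>c\<close> off the event \<open>\<tau> < t\<close> makes both sides probability measures, so that Levy's uniqueness
  theorem applies.
\<close>

lemma passage_law_eq:
  assumes t: "0 < t"
  shows "distr M borel (\<lambda>\<omega>. if \<tau> \<omega> < ereal t then W t \<omega> else c) =
    distr (M \<Otimes>\<^sub>M std_normal_distribution) borel
      (\<lambda>(\<omega>, z). if \<tau> \<omega> < ereal t then boundary (T \<omega>) + sqrt (t - T \<omega>) * z else c)"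
    (is "?\<mu> = ?\<nu>")
proof -
  have [measurable]: "W t \<in> borel_measurable M" using t by (intro random_variable_W) simp
  interpret N: real_distribution std_normal_distribution by (rule real_dist_normal_dist)
  interpret P: pair_prob_space M std_normal_distribution ..
  define R where "R = (\<lambda>(\<omega>, z). if \<tau> \<omega> < ereal t then boundary (T \<omega>) + sqrt (t - T \<omega>) * z else c)"
  have R[measurable]: "R \<in> borel_measurable (M \<Otimes>\<^sub>M std_normal_distribution)"
    unfolding R_def by measurable
  define Q where "Q = (\<lambda>\<omega>. if \<tau> \<omega> < ereal t then W t \<omega> else c)"
  have Q[measurable]: "Q \<in> borel_measurable M" unfolding Q_def by measurable
  have "distr M borel Q = distr (M \<Otimes>\<^sub>M std_normal_distribution) borel R"
  proof (rule Levy_uniqueness)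
    show "real_distribution (distr M borel Q)" by (rule real_distribution_distr) measurable
    show "real_distribution (distr (M \<Otimes>\<^sub>M std_normal_distribution) borel R)"
      by (rule P.real_distribution_distr) measurable
    show "char (distr M borel Q) = char (distr (M \<Otimes>\<^sub>M std_normal_distribution) borel R)"
    proof
      fix \<theta> :: real
      \<comment> \<open>The contribution of the complement of \<tau> < t, which is the same for both
        laws.\<close>
      define k where "k = (\<lambda>\<omega>. if \<tau> \<omega> < ereal t then 0 else iexp (\<theta> * c))"
      have k: "integrable M k"
        by (rule integrable_const_bound[of _ 1]) (auto simp: k_def)
      let ?A = "\<lambda>\<omega>. if \<tau> \<omega> < ereal t then iexp (\<theta> * W t \<omega>) else 0"
      let ?B = "\<lambda>\<omega>. if \<tau> \<omega> < ereal t then iexp (\<theta> * boundary (T \<omega>)) * of_real (exp (- \<theta>\<^sup>2 * (t - T \<omega>) / 2)) else 0"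
      have TB: "T \<omega> < t" if "\<tau> \<omega> < ereal t" for \<omega>
        using that tau_nonneg[of \<omega>] by (cases "\<tau> \<omega>") auto
      have A: "integrable M ?A"
        by (rule integrable_const_bound[of _ 1]) auto
      have B: "integrable M ?B"
        by (rule integrable_const_bound[of _ 1]) (auto simp: norm_mult intro!: AE_I2 mult_nonneg_nonneg dest: TB)
      have "char (distr M borel Q) \<theta> = (CLINT \<omega>|M. iexp (\<theta> * Q \<omega>))"
        unfolding char_def by (rule integral_distr) auto
      also have "\<dots> = (CLINT \<omega>|M. ?A \<omega> + k \<omega>)"
        by (rule Bochner_Integration.integral_cong) (auto simp: Q_def k_def)
      also have "\<dots> = (CLINT \<omega>|M. ?A \<omega>) + (CLINT \<omega>|M. k \<omega>)"
        by (rule Bochner_Integration.integral_add[OF A k])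
      also have "\<dots> = (CLINT \<omega>|M. ?B \<omega>) + (CLINT \<omega>|M. k \<omega>)"
        by (simp only: strong_markov_char[OF t])
      also have "\<dots> = (CLINT \<omega>|M. ?B \<omega> + k \<omega>)"
        by (rule Bochner_Integration.integral_add[OF B k, symmetric])
      \<comment> \<open>For fixed \<omega> the z-integral is a normal characteristic function. It
        reproduces the damping factor with variance t - T \<omega>.\<close>
      also have "\<dots> = (CLINT \<omega>|M. CLINT z|std_normal_distribution. iexp (\<theta> * R (\<omega>, z)))"
      proof (rule Bochner_Integration.integral_cong[OF refl])
        fix \<omega>
        show "?B \<omega> + k \<omega> = (CLINT z|std_normal_distribution. iexp (\<theta> * R (\<omega>, z)))"
        proof (cases "\<tau> \<omega> < ereal t")
          case True
          have "(CLINT z|std_normal_distribution. iexp (\<theta> * R (\<omega>, z))) =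
              (CLINT z|std_normal_distribution. iexp (\<theta> * boundary (T \<omega>)) * iexp (\<theta> * sqrt (t - T \<omega>) * z))"
            using True by (simp add: R_def exp_add[symmetric] algebra_simps)
          also have "\<dots> = iexp (\<theta> * boundary (T \<omega>)) * char std_normal_distribution (\<theta> * sqrt (t - T \<omega>))"
            unfolding char_def by (rule integral_mult_right_zero)
          also have "char std_normal_distribution (\<theta> * sqrt (t - T \<omega>)) = of_real (exp (- \<theta>\<^sup>2 * (t - T \<omega>) / 2))"
            using TB[OF True] by (simp add: char_std_normal_distribution power_mult_distrib)
          finally show ?thesis using True by (simp add: k_def)
        next
          case False
          then show ?thesis using N.prob_space by (simp add: R_def k_def)
        qed
      qed
      also have "\<dots> = (CLINT p|(M \<Otimes>\<^sub>M std_normal_distribution). iexp (\<theta> * R p))"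
        by (rule P.integral_fst') (rule P.integrable_const_bound[of _ 1]; auto)
      also have "\<dots> = char (distr (M \<Otimes>\<^sub>M std_normal_distribution) borel R) \<theta>"
        unfolding char_def by (rule integral_distr[symmetric]) auto
      finally show "char (distr M borel Q) \<theta> = char (distr (M \<Otimes>\<^sub>M std_normal_distribution) borel R) \<theta>" .
    qed
  qed
  then show ?thesis unfolding Q_def R_def .
qed

text \<open>The equality of laws tested against g. Because g vanishes at c, the artificial value c
  adds nothing on either side.\<close>

lemma nn_integral_passage:
  fixes g :: "real \<Rightarrow> ennreal"
  assumes t: "0 < t" and g[measurable]: "g \<in> borel_measurable borel" and c: "g c = 0"
  shows "(\<integral>\<^sup>+ \<omega>. (if \<tau> \<omega> < ereal t then g (W t \<omega>) else 0) \<partial>M) =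
    (\<integral>\<^sup>+ \<omega>. (if \<tau> \<omega> < ereal t then \<integral>\<^sup>+ z. g (boundary (T \<omega>) + sqrt (t - T \<omega>) * z) \<partial>std_normal_distribution else 0) \<partial>M)"
proof -
  have [measurable]: "W t \<in> borel_measurable M" using t by (intro random_variable_W) simp
  interpret N: real_distribution std_normal_distribution by (rule real_dist_normal_dist)
  define R where "R = (\<lambda>(\<omega>, z). if \<tau> \<omega> < ereal t then boundary (T \<omega>) + sqrt (t - T \<omega>) * z else c)"
  have R[measurable]: "R \<in> borel_measurable (M \<Otimes>\<^sub>M std_normal_distribution)"
    unfolding R_def by measurable
  define Q where "Q = (\<lambda>\<omega>. if \<tau> \<omega> < ereal t then W t \<omega> else c)"
  have Q[measurable]: "Q \<in> borel_measurable M" unfolding Q_def by measurable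
  have "(\<integral>\<^sup>+ \<omega>. (if \<tau> \<omega> < ereal t then g (W t \<omega>) else 0) \<partial>M) = (\<integral>\<^sup>+ \<omega>. g (Q \<omega>) \<partial>M)"
    by (rule nn_integral_cong) (auto simp: Q_def c)
  also have "\<dots> = (\<integral>\<^sup>+ y. g y \<partial>distr M borel Q)"
    by (rule nn_integral_distr[symmetric]) auto
  also have "\<dots> = (\<integral>\<^sup>+ y. g y \<partial>distr (M \<Otimes>\<^sub>M std_normal_distribution) borel R)"
    unfolding Q_def R_def by (simp only: passage_law_eq[OF t])
  also have "\<dots> = (\<integral>\<^sup>+ p. g (R p) \<partial>(M \<Otimes>\<^sub>M std_normal_distribution))"
    by (rule nn_integral_distr) auto
  also have "\<dots> = (\<integral>\<^sup>+ \<omega>. \<integral>\<^sup>+ z. g (R (\<omega>, z)) \<partial>std_normal_distribution \<partial>M)"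
    by (rule N.nn_integral_fst[symmetric]) measurable
  also have "\<dots> = (\<integral>\<^sup>+ \<omega>. (if \<tau> \<omega> < ereal t then \<integral>\<^sup>+ z. g (boundary (T \<omega>) + sqrt (t - T \<omega>) * z) \<partial>std_normal_distribution else 0) \<partial>M)"
    by (rule nn_integral_cong) (auto simp: R_def c)
  finally show ?thesis .
qed

section \<open>The Stieltjes measure of the passage time\<close>

lemma F_mono: "x \<le> y \<Longrightarrow> F x \<le> F y"
  unfolding first_passage_cdf_def by (intro finite_measure_mono) (auto intro: order_trans)

lemma F_right_continuous: "continuous (at_right a) F"
proof (rule iffD2[OF continuous_at_right_real_increasing[OF F_mono]], assumption, intro allI impI)
  fix e :: real assume e: "e > 0"
  have "(\<lambda>n. prob {\<omega> \<in> space M. \<tau> \<omega> \<le> ereal (a + 1 / real (Suc n))})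
      \<longlonglongrightarrow> prob (\<Inter>n. {\<omega> \<in> space M. \<tau> \<omega> \<le> ereal (a + 1 / real (Suc n))})"
  proof (rule finite_Lim_measure_decseq)
    show "decseq (\<lambda>n. {\<omega> \<in> space M. \<tau> \<omega> \<le> ereal (a + 1 / real (Suc n))})"
    proof (rule decseq_SucI, safe)
      fix n \<omega> assume "\<tau> \<omega> \<le> ereal (a + 1 / real (Suc (Suc n)))"
      moreover have "ereal (a + 1 / real (Suc (Suc n))) \<le> ereal (a + 1 / real (Suc n))"
        by (simp add: field_simps)
      ultimately show "\<tau> \<omega> \<le> ereal (a + 1 / real (Suc n))" by (rule order_trans)
    qed
  qed auto
  also have "(\<Inter>n. {\<omega> \<in> space M. \<tau> \<omega> \<le> ereal (a + 1 / real (Suc n))}) = {\<omega> \<in> space M. \<tau> \<omega> \<le> ereal a}"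
  proof safe
    fix \<omega> assume *: "\<omega> \<in> (\<Inter>n. {\<omega> \<in> space M. \<tau> \<omega> \<le> ereal (a + 1 / real (Suc n))})"
    then show "\<omega> \<in> space M" by auto
    have "(\<lambda>n. ereal (a + 1 / real (Suc n))) \<longlonglongrightarrow> ereal (a + 0)"
      unfolding divide_inverse mult_1 by (intro tendsto_intros LIMSEQ_inverse_real_of_nat tendsto_ereal)
    then have "(\<lambda>n. ereal (a + 1 / real (Suc n))) \<longlonglongrightarrow> ereal a" by simp
    then show "\<tau> \<omega> \<le> ereal a"
      by (rule LIMSEQ_le_const) (use * in auto)
  next
    fix \<omega> n assume "\<tau> \<omega> \<le> ereal a"
    then show "\<tau> \<omega> \<le> ereal (a + 1 / real (Suc n))" by (rule order_trans) simp
  qed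
  finally have "(\<lambda>n. F (a + 1 / real (Suc n))) \<longlonglongrightarrow> F a" by (simp only: first_passage_cdf_def)
  then have "\<forall>\<^sub>F n in sequentially. F (a + 1 / real (Suc n)) < F a + e"
    by (rule order_tendstoD) (use e in simp)
  then obtain n where "F (a + 1 / real (Suc n)) < F a + e"
    by (auto simp: eventually_sequentially)
  then show "\<exists>\<delta>>0. F (a + \<delta>) - F a < e" by (intro exI[of _ "1 / real (Suc n)"]) auto
qed

text \<open>\<tau> may be infinite with positive probability, so the measure of F is the law of
  \<tau> restricted to \<tau> < \<infinity>. The two measures are compared on half-lines, each
  exhausted by bounded intervals on which the Stieltjes measure is an increment of F.\<close>

lemma nn_integral_F:
  fixes h :: "real \<Rightarrow> ennreal"
  assumes h[measurable]: "h \<in> borel_measurable borel"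
  shows "(\<integral>\<^sup>+ s. h s \<partial>interval_measure F) = (\<integral>\<^sup>+ \<omega>. (if \<tau> \<omega> < \<infinity> then h (T \<omega>) else 0) \<partial>M)"
proof -
  define \<nu> where "\<nu> = distr (density M (indicator {\<omega> \<in> space M. \<tau> \<omega> < \<infinity>})) borel T"
  have emb: "emeasure \<nu> S = emeasure M {\<omega> \<in> space M. \<tau> \<omega> < \<infinity> \<and> T \<omega> \<in> S}" if [measurable]: "S \<in> sets borel" for S
  proof -
    have "emeasure \<nu> S = emeasure (density M (indicator {\<omega> \<in> space M. \<tau> \<omega> < \<infinity>})) (T -` S \<inter> space M)"
      unfolding \<nu>_def by (subst emeasure_distr) auto
    also have "\<dots> = (\<integral>\<^sup>+ \<omega>. indicator {\<omega> \<in> space M. \<tau> \<omega> < \<infinity>} \<omega> * indicator (T -` S \<inter> space M) \<omega> \<partial>M)"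
      by (rule emeasure_density) measurable
    also have "\<dots> = (\<integral>\<^sup>+ \<omega>. indicator {\<omega> \<in> space M. \<tau> \<omega> < \<infinity> \<and> T \<omega> \<in> S} \<omega> \<partial>M)"
      by (rule nn_integral_cong) (auto simp: indicator_def)
    also have "\<dots> = emeasure M {\<omega> \<in> space M. \<tau> \<omega> < \<infinity> \<and> T \<omega> \<in> S}"
      by (rule nn_integral_indicator) measurable
    finally show ?thesis .
  qed
  have T_iff: "\<tau> \<omega> < \<infinity> \<and> x < T \<omega> \<longleftrightarrow> \<tau> \<omega> < \<infinity> \<and> ereal x < \<tau> \<omega>" for \<omega> x
    using tau_nonneg[of \<omega>] by (cases "\<tau> \<omega>") auto
  have "\<nu> = interval_measure F"
  proof (rule measure_eqI_lessThan)
    show "sets \<nu> = sets borel" by (simp add: \<nu>_def)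
    fix x :: real
    have e: "emeasure \<nu> {x<..} = emeasure M {\<omega> \<in> space M. \<tau> \<omega> < \<infinity> \<and> ereal x < \<tau> \<omega>}"
      unfolding emb[OF borel_open[OF open_greaterThan]] greaterThan_iff T_iff ..
    show "emeasure \<nu> {x<..} < \<infinity>" unfolding e by (simp add: emeasure_eq_measure)
    have "(\<lambda>n. emeasure (interval_measure F) {x<..x + real n}) \<longlonglongrightarrow> emeasure (interval_measure F) (\<Union>n. {x<..x + real n})"
      by (rule Lim_emeasure_incseq) (auto simp: incseq_def)
    moreover have "(\<Union>n. {x<..x + real n}) = {x<..}"
    proof safe
      fix y assume "x < y"
      obtain n :: nat where "y - x \<le> real n" using real_arch_simple by blast
      then show "y \<in> (\<Union>n. {x<..x + real n})" using \<open>x < y\<close> by (auto intro!: exI[of _ n])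
    qed auto
    ultimately have l1: "(\<lambda>n. emeasure (interval_measure F) {x<..x + real n}) \<longlonglongrightarrow> emeasure (interval_measure F) {x<..}"
      by simp
    have "(\<lambda>n. emeasure M {\<omega> \<in> space M. ereal x < \<tau> \<omega> \<and> \<tau> \<omega> \<le> ereal (x + real n)})
      \<longlonglongrightarrow> emeasure M (\<Union>n. {\<omega> \<in> space M. ereal x < \<tau> \<omega> \<and> \<tau> \<omega> \<le> ereal (x + real n)})"
    proof (rule Lim_emeasure_incseq)
      show "incseq (\<lambda>n. {\<omega> \<in> space M. ereal x < \<tau> \<omega> \<and> \<tau> \<omega> \<le> ereal (x + real n)})"
        by (auto simp: incseq_def intro: order_trans)
    qed auto
    moreover have "(\<Union>n. {\<omega> \<in> space M. ereal x < \<tau> \<omega> \<and> \<tau> \<omega> \<le> ereal (x + real n)}) = {\<omega> \<in> space M. \<tau> \<omega> < \<infinity> \<and> ereal x < \<tau> \<omega>}"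
    proof safe
      fix \<omega> n assume "\<tau> \<omega> \<le> ereal (x + real n)"
      then show "\<tau> \<omega> < \<infinity>" by (rule le_less_trans) simp
    next
      fix \<omega> assume \<omega>: "\<omega> \<in> space M" "\<tau> \<omega> < \<infinity>" "ereal x < \<tau> \<omega>"
      then obtain y where y: "\<tau> \<omega> = ereal y" by (cases "\<tau> \<omega>") auto
      obtain n :: nat where "y - x \<le> real n" using real_arch_simple by blast
      then show "\<omega> \<in> (\<Union>n. {\<omega> \<in> space M. ereal x < \<tau> \<omega> \<and> \<tau> \<omega> \<le> ereal (x + real n)})"
        using \<omega> y by (auto intro!: exI[of _ n])
    qed
    ultimately have l2: "(\<lambda>n. emeasure M {\<omega> \<in> space M. ereal x < \<tau> \<omega> \<and> \<tau> \<omega> \<le> ereal (x + real n)}) \<longlonglongrightarrow> emeasure \<nu> {x<..}"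
      unfolding e by simp
    have "emeasure (interval_measure F) {x<..x + real n} = emeasure M {\<omega> \<in> space M. ereal x < \<tau> \<omega> \<and> \<tau> \<omega> \<le> ereal (x + real n)}" for n
    proof -
      have "emeasure (interval_measure F) {x<..x + real n} = ennreal (F (x + real n) - F x)"
        by (rule emeasure_interval_measure_Ioc) (auto intro: F_mono F_right_continuous)
      also have "F (x + real n) - F x = prob ({\<omega> \<in> space M. \<tau> \<omega> \<le> ereal (x + real n)} - {\<omega> \<in> space M. \<tau> \<omega> \<le> ereal x})"
        unfolding first_passage_cdf_def by (rule finite_measure_Diff[symmetric]) (auto intro: order_trans)
      also have "{\<omega> \<in> space M. \<tau> \<omega> \<le> ereal (x + real n)} - {\<omega> \<in> space M. \<tau> \<omega> \<le> ereal x} =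
          {\<omega> \<in> space M. ereal x < \<tau> \<omega> \<and> \<tau> \<omega> \<le> ereal (x + real n)}" by auto
      finally show ?thesis by (simp add: emeasure_eq_measure)
    qed
    then show "emeasure \<nu> {x<..} = emeasure (interval_measure F) {x<..}"
      using l1 l2 by (simp add: LIMSEQ_unique)
  qed simp
  then have "(\<integral>\<^sup>+ s. h s \<partial>interval_measure F) = (\<integral>\<^sup>+ s. h s \<partial>\<nu>)" by simp
  also have "\<dots> = (\<integral>\<^sup>+ \<omega>. h (T \<omega>) \<partial>density M (indicator {\<omega> \<in> space M. \<tau> \<omega> < \<infinity>}))"
    unfolding \<nu>_def by (rule nn_integral_distr) auto
  also have "\<dots> = (\<integral>\<^sup>+ \<omega>. indicator {\<omega> \<in> space M. \<tau> \<omega> < \<infinity>} \<omega> * h (T \<omega>) \<partial>M)"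
    by (rule nn_integral_density) measurable
  also have "\<dots> = (\<integral>\<^sup>+ \<omega>. (if \<tau> \<omega> < \<infinity> then h (T \<omega>) else 0) \<partial>M)"
    by (rule nn_integral_cong) (auto simp: indicator_def)
  finally show ?thesis .
qed

end

section \<open>The integral equation\<close>

lemma weighted_cylinder_measurable:
  assumes "p < 1"
  shows "weighted_cylinder p \<in> borel_measurable borel"
  using isCont_weighted_cylinder[OF assms] by (intro borel_measurable_continuous_onI continuous_at_imp_continuous_on) auto

text \<open>The inner derivative 1 / sqrt u raises the power p/2, which belongs to order p - 1, to
  (p + 1)/2, which belongs to order p.\<close>

lemma passage_density_has_real_derivative:
  assumes p: "p < 1" and u: "0 < u"
  shows "((\<lambda>y. passage_density (p - 1) u y) has_real_derivative - passage_density p u y) (at y)"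
proof -
  have "((\<lambda>y. weighted_cylinder (p - 1) (y / sqrt u)) has_real_derivative - weighted_cylinder p (y / sqrt u) * (1 / sqrt u)) (at y)"
    by (rule DERIV_chain2[OF weighted_cylinder_has_real_derivative[OF p] DERIV_cdivide[OF DERIV_ident]])
  from DERIV_cdivide[OF this, of "u powr (p / 2)"]
  have "((\<lambda>y. weighted_cylinder (p - 1) (y / sqrt u) / u powr (p / 2)) has_real_derivative
      - weighted_cylinder p (y / sqrt u) * (1 / sqrt u) / u powr (p / 2)) (at y)" .
  moreover have "u powr ((p + 1) / 2) = sqrt u * u powr (p / 2)"
    using u by (simp add: add_divide_distrib powr_add powr_half_sqrt)
  ultimately show ?thesis by (simp add: passage_density_def)
qed

text \<open>Since y is a height above the level, lowering the level by 1 / Suc n is adding that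
  amount to y. The minus sign in the derivative explains the order of the difference.\<close>

lemma passage_density_difference_quotient:
  assumes p: "p < 1" and u: "0 < u"
  shows "(\<lambda>n. real (Suc n) * (passage_density (p - 1) u y - passage_density (p - 1) u (y + 1 / real (Suc n))))
    \<longlonglongrightarrow> passage_density p u y"
proof -
  have "((\<lambda>h. (passage_density (p - 1) u (y + h) - passage_density (p - 1) u y) / h) \<longlongrightarrow> - passage_density p u y) (at 0)"
    using passage_density_has_real_derivative[OF p u, of y] by (simp add: DERIV_def)
  moreover have "filterlim (\<lambda>n. 1 / real (Suc n)) (at 0) sequentially"
    unfolding filterlim_at
    using LIMSEQ_inverse_real_of_nat by (auto simp: divide_inverse)
  ultimately have "(\<lambda>n. (passage_density (p - 1) u (y + 1 / real (Suc n)) - passage_density (p - 1) u y) / (1 / real (Suc n)))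
      \<longlonglongrightarrow> - passage_density p u y"
    by (rule filterlim_compose)
  from tendsto_minus[OF this] show ?thesis by (simp add: algebra_simps)
qed

text \<open>The location y < \<xi> matters as much as the value: near t it gives the sign of the
  quotient, while the value gives a bound uniform in n.\<close>

lemma passage_density_mean_value:
  assumes p: "p < 1" and u: "0 < u"
  obtains \<xi> where "y < \<xi>" "real (Suc n) * (passage_density (p - 1) u y - passage_density (p - 1) u (y + 1 / real (Suc n))) = passage_density p u \<xi>"
proof -
  have "y < y + 1 / real (Suc n)" by simp
  from MVT2[OF this passage_density_has_real_derivative[OF p u]]
  obtain z where "y < z" "passage_density (p - 1) u (y + 1 / real (Suc n)) - passage_density (p - 1) u y = (y + 1 / real (Suc n) - y) * - passage_density p u z"
    by blast
  then show ?thesis by (intro that[of z]) (auto simp: field_simps)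
qed

context brownian_passage
begin

text \<open>The level x is separate from b t so that it can be varied, and \<open>boundary\<close>
  replaces b so that the integrand is measurable on the whole line.\<close>

definition passage_integrand :: "real \<Rightarrow> real \<Rightarrow> real \<Rightarrow> real \<Rightarrow> real" where
  "passage_integrand p t x s = indicator {0<..<t} s * passage_density p (t - s) (boundary s - x)"

lemma passage_integrand_measurable [measurable]:
  assumes "p < 1"
  shows "passage_integrand p t x \<in> borel_measurable borel"
proof -
  note [measurable] = weighted_cylinder_measurable[OF assms]
  show ?thesis unfolding passage_integrand_def passage_density_def by measurable
qed

lemma nn_integral_terminal_value:
  assumes p: "p < 0" and t: "0 < t"
  shows "(\<integral>\<^sup>+ \<omega>. ennreal (indicator {..<x} (W t \<omega>) * (x - W t \<omega>) powr (- p - 1)) \<partial>M)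
    = ennreal (Gamma (- p) / sqrt (2 * pi) * passage_density p t (- x))"
proof -
  define g where "g = (\<lambda>w::real. ennreal (indicator {..<x} w * (x - w) powr (- p - 1)))"
  have [measurable]: "g \<in> borel_measurable borel" unfolding g_def by measurable
  have "(\<integral>\<^sup>+ \<omega>. g (W t \<omega>) \<partial>M) = (\<integral>\<^sup>+ \<omega>. g (W t \<omega> - W 0 \<omega>) \<partial>M)"
    by (rule nn_integral_cong) (simp add: W_0)
  also have "\<dots> = (\<integral>\<^sup>+ y. ennreal (normal_density 0 (sqrt t) y) * g y \<partial>lborel)"
    using distributed_nn_integral[OF normal_increments[of 0 t], of g] t by simp
  also have "\<dots> = ennreal \<bar>sqrt t\<bar> * (\<integral>\<^sup>+ z. ennreal (normal_density 0 (sqrt t) (0 + sqrt t * z)) * g (0 + sqrt t * z) \<partial>lborel)"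
    using t by (intro nn_integral_real_affine) auto
  also have "\<dots> = (\<integral>\<^sup>+ z. ennreal (sqrt t) * (ennreal (normal_density 0 (sqrt t) (0 + sqrt t * z)) * g (0 + sqrt t * z)) \<partial>lborel)"
    using t by (subst nn_integral_cmult) auto
  also have "\<dots> = (\<integral>\<^sup>+ z. ennreal (std_normal_density z) * g (0 + sqrt t * z) \<partial>lborel)"
  proof (rule nn_integral_cong)
    fix z :: real
    have "sqrt t * normal_density 0 (sqrt t) (0 + sqrt t * z) = std_normal_density z"
      using t by (simp add: normal_density_def real_sqrt_mult power_mult_distrib field_simps)
    then have "ennreal (sqrt t) * ennreal (normal_density 0 (sqrt t) (0 + sqrt t * z)) = ennreal (std_normal_density z)"
      using t by (simp only: ennreal_mult'[symmetric] real_sqrt_ge_zero less_imp_le)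
    then show "ennreal (sqrt t) * (ennreal (normal_density 0 (sqrt t) (0 + sqrt t * z)) * g (0 + sqrt t * z))
        = ennreal (std_normal_density z) * g (0 + sqrt t * z)"
      by (simp only: mult.assoc[symmetric])
  qed
  also have "\<dots> = (\<integral>\<^sup>+ z. g (0 + sqrt t * z) \<partial>std_normal_distribution)"
    by (rule nn_integral_density[symmetric]) auto
  also have "\<dots> = ennreal (Gamma (- p) / sqrt (2 * pi) * passage_density p t (0 - x))"
    unfolding g_def by (rule nn_integral_normal_power_tail[OF p t])
  finally show ?thesis unfolding g_def by simp
qed

text \<open>The expectation of (x - W t) powr (- p - 1) on W t < x is computed twice: directly from
  the law of W t, and through the position b s at the passage time s. As everything is nonnegative,
  integrability comes with the identity.\<close>

lemma nn_integral_passage_integrand_neg: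
  assumes p: "p < 0" and t: "0 < t" and x: "x \<le> b t"
  shows "(\<integral>\<^sup>+ s. ennreal (passage_integrand p t x s) \<partial>interval_measure F) = ennreal (passage_density p t (- x))"
proof -
  define C where "C = Gamma (- p) / sqrt (2 * pi)"
  have C: "C > 0" using p Gamma_real_pos[of "- p"] by (simp add: C_def)
  have p1: "p < 1" using p by simp
  note [measurable] = passage_integrand_measurable[OF p1]
  define g where "g = (\<lambda>w::real. ennreal (indicator {..<x} w * (x - w) powr (- p - 1)))"
  have g_meas[measurable]: "g \<in> borel_measurable borel" unfolding g_def by measurable
  have gx: "g x = 0" by (simp add: g_def)
  have TB: "T \<omega> < t" if "\<tau> \<omega> < ereal t" for \<omega>
    using that tau_nonneg[of \<omega>] by (cases "\<tau> \<omega>") auto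
  have "ennreal (C * passage_density p t (- x)) = (\<integral>\<^sup>+ \<omega>. g (W t \<omega>) \<partial>M)"
    using nn_integral_terminal_value[OF p t, of x] by (simp only: g_def C_def)
  \<comment> \<open>This is where x \<le> b t enters: g is supported on W t < x, where the path lies
    below the boundary at t.\<close>
  also have "\<dots> = (\<integral>\<^sup>+ \<omega>. (if \<tau> \<omega> < ereal t then g (W t \<omega>) else 0) \<partial>M)"
  proof (rule nn_integral_cong)
    fix \<omega> assume "\<omega> \<in> space M"
    then have "\<tau> \<omega> < ereal t" if "W t \<omega> < x" using tau_less_if_below t that x by simp
    then show "g (W t \<omega>) = (if \<tau> \<omega> < ereal t then g (W t \<omega>) else 0)" by (auto simp: g_def indicator_def)
  qed
  also have "\<dots> = (\<integral>\<^sup>+ \<omega>. (if \<tau> \<omega> < ereal t then \<integral>\<^sup>+ z. g (boundary (T \<omega>) + sqrt (t - T \<omega>) * z) \<partial>std_normal_distribution else 0) \<partial>M)"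
    by (rule nn_integral_passage[OF t g_meas gx])
  also have "\<dots> = (\<integral>\<^sup>+ \<omega>. (if \<tau> \<omega> < ereal t then ennreal (C * passage_density p (t - T \<omega>) (boundary (T \<omega>) - x)) else 0) \<partial>M)"
  proof (rule nn_integral_cong)
    fix \<omega>
    show "(if \<tau> \<omega> < ereal t then \<integral>\<^sup>+ z. g (boundary (T \<omega>) + sqrt (t - T \<omega>) * z) \<partial>std_normal_distribution else 0)
        = (if \<tau> \<omega> < ereal t then ennreal (C * passage_density p (t - T \<omega>) (boundary (T \<omega>) - x)) else 0)"
      using nn_integral_normal_power_tail[OF p, of "t - T \<omega>" x "boundary (T \<omega>)"] TB[of \<omega>]
      unfolding g_def C_def by (auto simp del: of_real_divide)
  qed
  \<comment> \<open>The restriction \<tau> < t moves into the indicator of \<open>{0<..<t}\<close>.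
    That indicator also excludes \<tau> = 0, a null event by regularity.\<close>
  also have "\<dots> = (\<integral>\<^sup>+ \<omega>. (if \<tau> \<omega> < \<infinity> then ennreal (C * passage_integrand p t x (T \<omega>)) else 0) \<partial>M)"
  proof (rule nn_integral_cong_AE)
    show "AE \<omega> in M. (if \<tau> \<omega> < ereal t then ennreal (C * passage_density p (t - T \<omega>) (boundary (T \<omega>) - x)) else 0)
        = (if \<tau> \<omega> < \<infinity> then ennreal (C * passage_integrand p t x (T \<omega>)) else 0)"
      using tau_pos_AE
    proof eventually_elim
      case (elim \<omega>)
      then show ?case by (cases "\<tau> \<omega>") (auto simp: passage_integrand_def)
    qed
  qed
  also have "\<dots> = (\<integral>\<^sup>+ s. ennreal (C * passage_integrand p t x s) \<partial>interval_measure F)"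
    by (rule nn_integral_F[symmetric]) measurable
  also have "\<dots> = (\<integral>\<^sup>+ s. ennreal C * ennreal (passage_integrand p t x s) \<partial>interval_measure F)"
    using C by (simp add: ennreal_mult')
  also have "\<dots> = ennreal C * (\<integral>\<^sup>+ s. ennreal (passage_integrand p t x s) \<partial>interval_measure F)"
    by (rule nn_integral_cmult) measurable
  finally have "ennreal C * ennreal (passage_density p t (- x)) = ennreal C * (\<integral>\<^sup>+ s. ennreal (passage_integrand p t x s) \<partial>interval_measure F)"
    using C by (simp add: ennreal_mult')
  then show ?thesis using C by (simp add: ennreal_mult_cancel_left)
qed

lemma passage_integrand_integral_neg:
  assumes p: "p < 0" and t: "0 < t" and x: "x \<le> b t"
  shows "integrable (interval_measure F) (passage_integrand p t x)"
    and "(LINT s|interval_measure F. passage_integrand p t x s) = passage_density p t (- x)"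
proof -
  have p1: "p < 1" using p by simp
  note [measurable] = passage_integrand_measurable[OF p1]
  have nn: "passage_integrand p t x s \<ge> 0" for s using passage_density_nonneg[OF p] by (simp add: passage_integrand_def)
  show "integrable (interval_measure F) (passage_integrand p t x)"
    by (rule integrableI_nonneg) (use nn nn_integral_passage_integrand_neg[OF assms] in auto)
  show "(LINT s|interval_measure F. passage_integrand p t x s) = passage_density p t (- x)"
    using nn passage_density_nonneg[OF p]
    by (subst integral_eq_nn_integral) (auto simp: nn_integral_passage_integrand_neg[OF assms])
qed

section \<open>Orders from zero to below one\<close>

lemma finite_measure_F: "finite_measure (interval_measure F)"
proof
  have "emeasure (interval_measure F) (space (interval_measure F)) = (\<integral>\<^sup>+ s. 1 \<partial>interval_measure F)" by simp
  also have "\<dots> = (\<integral>\<^sup>+ \<omega>. (if \<tau> \<omega> < \<infinity> then 1 else 0) \<partial>M)" by (rule nn_integral_F) simp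
  also have "\<dots> \<le> (\<integral>\<^sup>+ \<omega>. 1 \<partial>M)" by (rule nn_integral_mono) simp
  also have "\<dots> = 1" by (simp add: emeasure_space_1)
  finally show "emeasure (interval_measure F) (space (interval_measure F)) \<noteq> \<infinity>" by (auto simp: top_unique)
qed

text \<open>The equation of order p - 1 holds at the levels b t and b t - 1 / Suc n, and the
  quotients of both sides converge pointwise. Exchanging limit and integral is the difficulty: the
  natural majorant is singular of order a = (p + 1)/2, between 1/2 and 1, and F is an arbitrary
  passage distribution near t.\<close>

lemma passage_integrand_integral_differentiable:
  assumes p: "0 \<le> p" "p < 1" and t: "0 < t" and b: "b differentiable (at t)"
  shows "integrable (interval_measure F) (passage_integrand p t (b t))"
    and "(LINT s|interval_measure F. passage_integrand p t (b t) s) = passage_density p t (- b t)"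
proof -
  interpret IF: finite_measure "interval_measure F" by (rule finite_measure_F)
  define a where "a = (p + 1) / 2"
  have pm: "p - 1 < 0" using p by simp
  have pm1: "p - 1 < 1" using p by simp
  note [measurable] = passage_integrand_measurable[OF p(2)] passage_integrand_measurable[OF pm1]
  define \<Phi> where "\<Phi> = (\<lambda>n s. real (Suc n) * (passage_integrand (p - 1) t (b t) s - passage_integrand (p - 1) t (b t - 1 / real (Suc n)) s))"
  define L where "L = (\<lambda>n. real (Suc n) * (passage_density (p - 1) t (- b t) - passage_density (p - 1) t (- b t + 1 / real (Suc n))))"
  have [measurable]: "\<Phi> n \<in> borel_measurable borel" for n unfolding \<Phi>_def by measurable
  have xle: "b t - 1 / real (Suc n) \<le> b t" for n by simp
  have \<Phi>_int: "integrable (interval_measure F) (\<Phi> n)" for n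
    unfolding \<Phi>_def
    by (intro integrable_mult_right Bochner_Integration.integrable_diff passage_integrand_integral_neg pm t xle order_refl)
  have \<Phi>_integral: "(LINT s|interval_measure F. \<Phi> n s) = L n" for n
    unfolding \<Phi>_def L_def
    by (simp add: passage_integrand_integral_neg[OF pm t] xle)
  have L_lim: "L \<longlonglongrightarrow> passage_density p t (- b t)"
    unfolding L_def by (rule passage_density_difference_quotient[OF p(2) t])
  have \<Phi>_eq: "\<Phi> n s = indicator {0<..<t} s * (real (Suc n) * (passage_density (p - 1) (t - s) (boundary s - b t)
      - passage_density (p - 1) (t - s) (boundary s - b t + 1 / real (Suc n))))" for n s
    by (simp add: \<Phi>_def passage_integrand_def indicator_def algebra_simps)
  have \<Phi>_lim: "(\<lambda>n. \<Phi> n s) \<longlonglongrightarrow> passage_integrand p t (b t) s" for s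
  proof (cases "s \<in> {0<..<t}")
    case True
    then have "0 < t - s" by simp
    from passage_density_difference_quotient[OF p(2) this, of "boundary s - b t"] show ?thesis
      using True by (simp add: \<Phi>_eq passage_integrand_def)
  qed (simp add: \<Phi>_eq passage_integrand_def)
  have \<Phi>_mvt: "\<exists>\<xi>>boundary s - b t. \<Phi> n s = passage_density p (t - s) \<xi>" if "s \<in> {0<..<t}" for n s
  proof -
    from that have "0 < t - s" by simp
    from passage_density_mean_value[OF p(2) this, of "boundary s - b t" n]
    obtain \<xi> where "boundary s - b t < \<xi>"
      "real (Suc n) * (passage_density (p - 1) (t - s) (boundary s - b t) - passage_density (p - 1) (t - s) (boundary s - b t + 1 / real (Suc n)))
        = passage_density p (t - s) \<xi>" .
    then show ?thesis using that unfolding \<Phi>_eq by auto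
  qed
  obtain K where K: "K > 0" "\<And>z. \<bar>weighted_cylinder p z\<bar> \<le> K" using weighted_cylinder_bounded[OF p] by blast
  \<comment> \<open>K w dominates all quotients at once, but its integrability is not yet
    known.\<close>
  define w where "w = (\<lambda>s. indicator {0<..<t} s * (1 / (t - s) powr a))"
  have [measurable]: "w \<in> borel_measurable borel" unfolding w_def by measurable
  have w0: "w s \<ge> 0" for s by (simp add: w_def)
  have \<Phi>_bound: "\<bar>\<Phi> n s\<bar> \<le> K * w s" for n s
  proof (cases "s \<in> {0<..<t}")
    case True
    from \<Phi>_mvt[OF True, of n] obtain \<xi> where \<xi>: "\<Phi> n s = passage_density p (t - s) \<xi>" by blast
    show ?thesis
      unfolding \<xi> passage_density_def using True K(2)[of "\<xi> / sqrt (t - s)"]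
      by (simp add: w_def a_def abs_divide divide_right_mono)
  qed (simp add: \<Phi>_eq w_def)
  \<comment> \<open>Continuity at 0, where the function is positive, gives the lower bound c on a
    small interval; to the right of it positivity on z \<ge> 0 takes over.\<close>
  obtain \<delta> c where \<delta>: "\<delta> > 0" and c: "c > 0" and wc_ge: "\<And>z. \<bar>z\<bar> \<le> \<delta> \<Longrightarrow> c \<le> weighted_cylinder p z"
    and wc_nonneg: "\<And>z. - \<delta> \<le> z \<Longrightarrow> 0 \<le> weighted_cylinder p z"
  proof -
    define c where "c = weighted_cylinder p 0 / 2"
    have c: "c > 0" using weighted_cylinder_pos[OF p(2), of 0] by (simp add: c_def)
    have "\<forall>\<^sub>F z in nhds 0. c < weighted_cylinder p z"
      using isCont_weighted_cylinder[OF p(2), of 0] c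
      by (intro order_tendstoD[of _ "weighted_cylinder p 0"]) (auto simp: isCont_def tendsto_at_iff_tendsto_nhds c_def)
    then obtain d where d: "d > 0" "\<And>z. dist z 0 < d \<Longrightarrow> c < weighted_cylinder p z"
      unfolding eventually_nhds_metric by blast
    have 1: "c \<le> weighted_cylinder p z" if "\<bar>z\<bar> \<le> d / 2" for z
      using d(2)[of z] that d(1) by simp
    have 2: "0 \<le> weighted_cylinder p z" if "- (d / 2) \<le> z" for z
    proof (cases "z \<ge> 0")
      case True then show ?thesis using weighted_cylinder_pos[OF p(2)] by (simp add: less_imp_le)
    next
      case False then show ?thesis using 1[of z] that c by simp
    qed
    show ?thesis using that[of "d / 2" c] d(1) c 1 2 by simp
  qed
  obtain \<epsilon> where \<epsilon>: "0 < \<epsilon>" "\<epsilon> < t" and near: "\<And>s. t - \<epsilon> < s \<Longrightarrow> s < t \<Longrightarrow> \<bar>boundary s - b t\<bar> / sqrt (t - s) \<le> \<delta>"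
  proof -
    from b obtain l where "(b has_real_derivative l) (at t)" by (auto simp: real_differentiable_def)
    then have "((\<lambda>s. (b s - b t) / (s - t)) \<longlongrightarrow> l) (at t)" by (simp add: has_field_derivative_iff)
    then have "((\<lambda>s. \<bar>(b s - b t) / (s - t)\<bar>) \<longlongrightarrow> \<bar>l\<bar>) (at t)" by (rule tendsto_rabs)
    then have "\<forall>\<^sub>F s in at t. \<bar>(b s - b t) / (s - t)\<bar> < \<bar>l\<bar> + 1" by (rule order_tendstoD) simp
    then obtain \<eta> where \<eta>: "\<eta> > 0" "\<And>s. s \<noteq> t \<Longrightarrow> dist s t < \<eta> \<Longrightarrow> \<bar>(b s - b t) / (s - t)\<bar> < \<bar>l\<bar> + 1"
      unfolding eventually_at by auto
    \<comment> \<open>The slope bound gives |b s - b t| < (|l| + 1) (t - s), so the argument of the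
      cylinder function is below (|l| + 1) sqrt (t - s). The third term of the minimum brings this
      under \<delta>; t / 2 keeps the neighbourhood inside the positive times.\<close>
    define \<epsilon> where "\<epsilon> = min (min \<eta> (t / 2)) ((\<delta> / (\<bar>l\<bar> + 1))\<^sup>2)"
    have l1: "0 < \<bar>l\<bar> + 1" by simp
    have \<epsilon>0: "0 < \<epsilon>" "\<epsilon> < t" using \<eta>(1) t \<delta> l1 by (auto simp: \<epsilon>_def)
    have "\<bar>boundary s - b t\<bar> / sqrt (t - s) \<le> \<delta>" if s: "t - \<epsilon> < s" "s < t" for s
    proof -
      have u: "0 < t - s" "0 < sqrt (t - s)" using s by auto
      have s0: "0 < s" using s \<epsilon>0 by simp
      have "dist s t < \<eta>" using s by (simp add: \<epsilon>_def dist_real_def)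
      then have "\<bar>(b s - b t) / (s - t)\<bar> < \<bar>l\<bar> + 1" using \<eta>(2)[of s] s by simp
      then have "\<bar>b s - b t\<bar> < (\<bar>l\<bar> + 1) * (t - s)"
        using s by (simp add: abs_divide field_simps)
      moreover have "t - s = sqrt (t - s) * sqrt (t - s)" using u by simp
      ultimately have "\<bar>b s - b t\<bar> / sqrt (t - s) < (\<bar>l\<bar> + 1) * sqrt (t - s)"
        using u by (metis mult.assoc pos_divide_less_eq)
      also have "\<dots> \<le> (\<bar>l\<bar> + 1) * (\<delta> / (\<bar>l\<bar> + 1))"
      proof (rule mult_left_mono)
        have "t - s \<le> (\<delta> / (\<bar>l\<bar> + 1))\<^sup>2" using s by (simp add: \<epsilon>_def)
        then show "sqrt (t - s) \<le> \<delta> / (\<bar>l\<bar> + 1)" using \<delta> l1 by (intro real_le_lsqrt) auto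
      qed simp
      also have "\<dots> = \<delta>" using l1 by simp
      finally show ?thesis using s0 by (simp add: boundary_def)
    qed
    then show ?thesis using that \<epsilon>0 by blast
  qed
  define N where "N = {t - \<epsilon><..<t}"
  have Nsub: "s \<in> {0<..<t}" if "s \<in> N" for s using that \<epsilon> by (simp add: N_def)
  \<comment> \<open>The mean value point lies to the right of b s - b t, hence at or above -
    \<delta> after scaling, however far away it is. One-sided nonnegativity is exactly what is
    needed.\<close>
  have N_nonneg: "0 \<le> \<Phi> n s" if s: "s \<in> N" for n s
  proof -
    have u: "0 < sqrt (t - s)" using s by (simp add: N_def)
    from \<Phi>_mvt[OF Nsub[OF s], of n] obtain \<xi> where \<xi>: "boundary s - b t < \<xi>" "\<Phi> n s = passage_density p (t - s) \<xi>" by blast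
    have "\<bar>(boundary s - b t) / sqrt (t - s)\<bar> \<le> \<delta>" using near[of s] s u by (simp add: N_def abs_divide)
    then have "- \<delta> \<le> (boundary s - b t) / sqrt (t - s)" by linarith
    also have "\<dots> \<le> \<xi> / sqrt (t - s)" using \<xi>(1) u by (intro divide_right_mono) auto
    finally show ?thesis unfolding \<xi>(2) passage_density_def using wc_nonneg by simp
  qed
  have N_lower: "c * w s \<le> passage_integrand p t (b t) s" if s: "s \<in> N" for s
  proof -
    have u: "0 < sqrt (t - s)" using s by (simp add: N_def)
    have "\<bar>(boundary s - b t) / sqrt (t - s)\<bar> \<le> \<delta>" using near[of s] s u by (simp add: N_def abs_divide)
    from wc_ge[OF this] show ?thesis
      using Nsub[OF s] by (simp add: passage_integrand_def passage_density_def w_def a_def divide_right_mono)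
  qed
  \<comment> \<open>Away from t the remaining time is at least \<epsilon>, so the singular factor is
    bounded there.\<close>
  define E where "E = K / \<epsilon> powr a"
  have far: "\<bar>\<Phi> n s\<bar> \<le> E" if "s \<notin> N" for n s
  proof (cases "s \<in> {0<..<t}")
    case True
    then have "\<epsilon> \<le> t - s" using that by (simp add: N_def)
    then have "\<epsilon> powr a \<le> (t - s) powr a" using \<epsilon> p by (intro powr_mono2) (auto simp: a_def)
    then have "K * (1 / (t - s) powr a) \<le> E" using K(1) \<epsilon> True by (simp add: E_def frac_le)
    then show ?thesis using \<Phi>_bound[of n s] True by (simp add: w_def)
  next
    case False
    then show ?thesis using K(1) by (simp add: \<Phi>_eq E_def)
  qed
  have E0: "E \<ge> 0" using K(1) by (simp add: E_def)
  define m where "m = measure (interval_measure F) UNIV"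
  obtain B where B: "\<And>n. \<bar>L n\<bar> \<le> B"
    using convergent_imp_Bseq[OF convergentI[OF L_lim]] unfolding Bseq_def by auto
  \<comment> \<open>The full integral L n is bounded because it converges, and the part outside N is
    at most E times the total mass. Hence the nonnegative part near t is bounded uniformly in n, as
    Fatou's lemma requires.\<close>
  have near_int: "(\<integral>\<^sup>+ s. ennreal (indicator N s * \<Phi> n s) \<partial>interval_measure F) \<le> ennreal (B + E * m)" for n
  proof -
    have NI: "integrable (interval_measure F) (\<lambda>s. indicator N s * \<Phi> n s)"
      using integrable_mult_indicator[OF _ \<Phi>_int[of n], of N] by (simp add: N_def)
    have FI: "integrable (interval_measure F) (\<lambda>s. indicator (- N) s * \<Phi> n s)"
      using integrable_mult_indicator[OF _ \<Phi>_int[of n], of "- N"] by (simp add: N_def)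
    have "L n = (LINT s|interval_measure F. indicator N s * \<Phi> n s + indicator (- N) s * \<Phi> n s)"
      unfolding \<Phi>_integral[symmetric] by (rule Bochner_Integration.integral_cong) (auto simp: indicator_def)
    also have "\<dots> = (LINT s|interval_measure F. indicator N s * \<Phi> n s) + (LINT s|interval_measure F. indicator (- N) s * \<Phi> n s)"
      by (rule Bochner_Integration.integral_add[OF NI FI])
    finally have 1: "(LINT s|interval_measure F. indicator N s * \<Phi> n s) = L n - (LINT s|interval_measure F. indicator (- N) s * \<Phi> n s)"
      by simp
    have "\<bar>LINT s|interval_measure F. indicator (- N) s * \<Phi> n s\<bar> \<le> (LINT s|interval_measure F. E)"
      by (rule integral_abs_bound_integral[OF FI]) (use far E0 in \<open>auto simp: indicator_def\<close>)
    then have 2: "\<bar>LINT s|interval_measure F. indicator (- N) s * \<Phi> n s\<bar> \<le> E * m" by (simp add: m_def mult.commute)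
    have "(\<integral>\<^sup>+ s. ennreal (indicator N s * \<Phi> n s) \<partial>interval_measure F) = ennreal (LINT s|interval_measure F. indicator N s * \<Phi> n s)"
      by (rule nn_integral_eq_integral[OF NI]) (use N_nonneg in \<open>auto simp: indicator_def\<close>)
    also have "\<dots> \<le> ennreal (B + E * m)"
      unfolding 1 using B[of n] 2 by (intro ennreal_leI) linarith
    finally show ?thesis .
  qed
  have "(\<integral>\<^sup>+ s. ennreal (indicator N s * passage_integrand p t (b t) s) \<partial>interval_measure F) =
      (\<integral>\<^sup>+ s. liminf (\<lambda>n. ennreal (indicator N s * \<Phi> n s)) \<partial>interval_measure F)"
    by (rule nn_integral_cong) (intro lim_imp_Liminf[symmetric] tendsto_ennrealI tendsto_mult tendsto_const \<Phi>_lim; simp)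
  also have "\<dots> \<le> liminf (\<lambda>n. \<integral>\<^sup>+ s. ennreal (indicator N s * \<Phi> n s) \<partial>interval_measure F)"
    by (rule nn_integral_liminf) (simp add: N_def)
  also have "\<dots> \<le> ennreal (B + E * m)"
    using near_int by (intro Liminf_le) (simp_all add: always_eventually)
  finally have fatou: "(\<integral>\<^sup>+ s. ennreal (indicator N s * passage_integrand p t (b t) s) \<partial>interval_measure F) < \<infinity>"
    by (rule le_less_trans) simp
  have w_int: "integrable (interval_measure F) w"
  proof -
    have I1: "integrable (interval_measure F) (\<lambda>s. indicator N s * passage_integrand p t (b t) s)"
    proof (rule integrableI_nonneg)
      show "AE s in interval_measure F. 0 \<le> indicator N s * passage_integrand p t (b t) s"
      proof (intro AE_I2)
        fix s
        have "0 \<le> c * w s" using c w0 by simp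
        then show "0 \<le> indicator N s * passage_integrand p t (b t) s" using N_lower[of s] by (cases "s \<in> N") (auto intro: order_trans)
      qed
    qed (use fatou in \<open>auto simp: N_def\<close>)
    \<comment> \<open>Near t the lower bound c w \<le> integrand is read backwards as a bound for w.
      Elsewhere w is at most 1 / \<epsilon> powr a, integrable because the measure is
      finite.\<close>
    have "integrable (interval_measure F) (\<lambda>s. 1 / c * (indicator N s * passage_integrand p t (b t) s) + 1 / \<epsilon> powr a)"
      by (intro Bochner_Integration.integrable_add integrable_mult_right I1) simp
    then show ?thesis
    proof (rule Bochner_Integration.integrable_bound)
      show "AE s in interval_measure F. norm (w s) \<le> norm (1 / c * (indicator N s * passage_integrand p t (b t) s) + 1 / \<epsilon> powr a)"
      proof (intro AE_I2)
        fix s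
        have "w s \<le> 1 / c * (indicator N s * passage_integrand p t (b t) s) + 1 / \<epsilon> powr a"
        proof (cases "s \<in> N")
          case True
          have "w s \<le> passage_integrand p t (b t) s / c" using N_lower[OF True] c by (simp add: field_simps)
          then show ?thesis using True by (simp add: add_increasing2)
        next
          case False
          have "w s \<le> 1 / \<epsilon> powr a"
          proof (cases "s \<in> {0<..<t}")
            case True
            then have "\<epsilon> \<le> t - s" using False by (simp add: N_def)
            then have "\<epsilon> powr a \<le> (t - s) powr a" using \<epsilon> p by (intro powr_mono2) (auto simp: a_def)
            then show ?thesis using True \<epsilon> by (simp add: w_def frac_le)
          qed (simp add: w_def)
          then show ?thesis using False by simp
        qed
        then show "norm (w s) \<le> norm (1 / c * (indicator N s * passage_integrand p t (b t) s) + 1 / \<epsilon> powr a)"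
          using w0[of s] by simp
      qed
    qed simp
  qed
  have dom: "integrable (interval_measure F) (\<lambda>s. K * w s)" by (intro integrable_mult_right w_int)
  show "integrable (interval_measure F) (passage_integrand p t (b t))"
    by (rule integrable_dominated_convergence[OF _ _ dom, where s = \<Phi>]) (use \<Phi>_lim \<Phi>_bound in auto)
  have "(\<lambda>n. LINT s|interval_measure F. \<Phi> n s) \<longlonglongrightarrow> (LINT s|interval_measure F. passage_integrand p t (b t) s)"
    by (rule integral_dominated_convergence[OF _ _ dom]) (use \<Phi>_lim \<Phi>_bound in auto)
  then show "(LINT s|interval_measure F. passage_integrand p t (b t) s) = passage_density p t (- b t)"
    unfolding \<Phi>_integral using L_lim by (rule LIMSEQ_unique)
qed

lemma passage_equationI:
  assumes t: "0 < t" and int: "integrable (interval_measure F) (passage_integrand p t (b t))"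
    and eq: "(LINT s|interval_measure F. passage_integrand p t (b t) s) = passage_density p t (- b t)"
  shows "passage_equation b F p t"
proof -
  have *: "(\<lambda>s. indicator {0<..<t} s *\<^sub>R passage_kernel b p t s) = passage_integrand p t (b t)"
    by (auto simp: fun_eq_iff passage_integrand_def passage_kernel_eq_density boundary_def indicator_def)
  have "exp (- (b t)\<^sup>2 / (4 * t)) * parabolic_cylinder_real p (- b t / sqrt t) / t powr ((p + 1) / 2)
      = passage_density p t (- b t)"
    using t by (simp add: passage_density_def weighted_cylinder_def power_divide)
  then show ?thesis
    unfolding passage_equation_def set_integrable_def set_lebesgue_integral_def * using int eq by simp
qed

lemma passage_equation_neg: "p < 0 \<Longrightarrow> 0 < t \<Longrightarrow> passage_equation b F p t"
  by (intro passage_equationI passage_integrand_integral_neg) auto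

lemma passage_equation_differentiable:
  "0 \<le> p \<Longrightarrow> p < 1 \<Longrightarrow> 0 < t \<Longrightarrow> b differentiable (at t) \<Longrightarrow> passage_equation b F p t"
  by (intro passage_equationI passage_integrand_integral_differentiable)

end

section \<open>Reduction to paths that all start at zero\<close>

text \<open>The motion starts at 0 almost surely only. Subtracting W 0 leaves all increments
  unchanged and makes the start exact at every sample point.\<close>

lemma (in standard_brownian_motion) standard_brownian_motion_pinned:
  "standard_brownian_motion M (\<lambda>t \<omega>. W t \<omega> - W 0 \<omega>)"
proof
  show "random_variable borel (\<lambda>\<omega>. W t \<omega> - W 0 \<omega>)" if "t \<ge> 0" for t
    using random_variable_W[OF that] random_variable_W[of 0] by simp
  show "AE \<omega> in M. W 0 \<omega> - W 0 \<omega> = 0" by simp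
  show "continuous_on {0..} (\<lambda>t. W t \<omega> - W 0 \<omega>)" if "\<omega> \<in> space M" for \<omega>
    by (intro continuous_intros continuous_paths that)
  show "distributed M lborel (\<lambda>\<omega>. W t \<omega> - W 0 \<omega> - (W s \<omega> - W 0 \<omega>)) (normal_density 0 (sqrt (t - s)))"
    if "0 \<le> s" "s < t" for s t
    using normal_increments[OF that] by simp
  show "indep_vars (\<lambda>_. borel) (\<lambda>i \<omega>. W (r (Suc i)) \<omega> - W 0 \<omega> - (W (r i) \<omega> - W 0 \<omega>)) {..<n}"
    if "0 \<le> r 0" "\<And>i. i < n \<Longrightarrow> r i < r (Suc i)" for r :: "nat \<Rightarrow> real" and n
    using independent_increments[OF that] by simp
qed

theorem mainTheorem2:
  fixes M :: "'a measure" and W :: "real \<Rightarrow> 'a \<Rightarrow> real"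
    and b :: "real \<Rightarrow> real" and b0 :: ereal
  assumes "standard_brownian_motion M W"
    and "continuous_on {0<..} b"
    and "((\<lambda>t. ereal (b t)) \<longlongrightarrow> b0) (at_right 0)"
    and "b0 \<le> 0"
    and "measure M {\<omega> \<in> space M. first_passage_time W b \<omega> = 0} = 0"
    and "b0 = - \<infinity> \<Longrightarrow> \<exists>\<epsilon>>0. mono_on {0<..\<epsilon>} b"
  shows "(\<forall>p \<le> -1. \<forall>t>0. passage_equation b (first_passage_cdf M W b) p t) \<and>
    (b differentiable_on {0<..} \<longrightarrow>
      (\<forall>p. -1 < p \<and> p \<le> 0 \<longrightarrow> (\<forall>t>0. passage_equation b (first_passage_cdf M W b) p t))) \<and>
    (b C1_differentiable_on {0<..} \<longrightarrow>
      (\<forall>p. 0 < p \<and> p < 1 \<longrightarrow> (\<forall>t>0. passage_equation b (first_passage_cdf M W b) p t)))"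
proof -
  interpret W: brownian_boundary M W b
    using assms(1,2) by (simp add: brownian_boundary_def brownian_boundary_axioms_def)
  define V where "V = (\<lambda>t \<omega>. W t \<omega> - W 0 \<omega>)"
  interpret V: brownian_boundary M V b
    using W.standard_brownian_motion_pinned assms(2)
    by (simp add: brownian_boundary_def brownian_boundary_axioms_def V_def)
  \<comment> \<open>The passage times of the two motions agree almost surely, so both regularity and
    the distribution function carry over.\<close>
  have tau_eq: "AE \<omega> in M. first_passage_time V b \<omega> = first_passage_time W b \<omega>"
    using W.start_at_zero by eventually_elim (simp add: first_passage_time_def V_def)
  have [measurable]: "first_passage_time W b \<in> borel_measurable M" by (rule W.tau_measurable)
  have [measurable]: "first_passage_time V b \<in> borel_measurable M" by (rule V.tau_measurable)
  have "measure M {\<omega> \<in> space M. first_passage_time V b \<omega> = 0} = measure M {\<omega> \<in> space M. first_passage_time W b \<omega> = 0}"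
  proof (rule measure_eq_AE)
    show "AE \<omega> in M. (\<omega> \<in> {\<omega> \<in> space M. first_passage_time V b \<omega> = 0}) = (\<omega> \<in> {\<omega> \<in> space M. first_passage_time W b \<omega> = 0})"
      using tau_eq by eventually_elim simp
  qed auto
  then interpret V: brownian_passage M V b
    using assms(5) by unfold_locales (auto simp: V_def)
  have F_eq: "first_passage_cdf M V b = first_passage_cdf M W b"
  proof
    fix t
    show "first_passage_cdf M V b t = first_passage_cdf M W b t"
      unfolding first_passage_cdf_def
    proof (rule measure_eq_AE)
      show "AE \<omega> in M. (\<omega> \<in> {\<omega> \<in> space M. first_passage_time V b \<omega> \<le> ereal t}) = (\<omega> \<in> {\<omega> \<in> space M. first_passage_time W b \<omega> \<le> ereal t})"
        using tau_eq by eventually_elim simp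
    qed auto
  qed
  have neg: "passage_equation b (first_passage_cdf M W b) p t" if "p < 0" "0 < t" for p t
    using V.passage_equation_neg[OF that] unfolding F_eq .
  have diff: "passage_equation b (first_passage_cdf M W b) p t"
    if "0 \<le> p" "p < 1" "0 < t" "b differentiable_on {0<..}" for p t
  proof -
    have "b differentiable (at t)"
      using that(3,4) by (simp add: differentiable_on_eq_differentiable_at)
    from V.passage_equation_differentiable[OF that(1-3) this] show ?thesis unfolding F_eq .
  qed
  show ?thesis
  proof (intro conjI allI impI)
    show "passage_equation b (first_passage_cdf M W b) p t" if "p \<le> -1" "0 < t" for p t
      using neg that by simp
    show "passage_equation b (first_passage_cdf M W b) p t"
      if "b differentiable_on {0<..}" "-1 < p \<and> p \<le> 0" "0 < t" for p t
      using neg[of p t] diff[of p t] that by (cases "p < 0") auto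
    show "passage_equation b (first_passage_cdf M W b) p t"
      if "b C1_differentiable_on {0<..}" "0 < p \<and> p < 1" "0 < t" for p t
      using diff[of p t] C1_diff_imp_diff[of b] that by simp
  qed
qed

end
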